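(* Let $R$ be a commutative Noetherian ring, let $d\ge 1$, and let $\underline r=r_1,\dots,r_d$ be a regular sequence in $R$ with $(\underline r)=(r_1,\dots,r_d)R\ne R$. Let $M$ be the cokernel of the $R$-linear map $R\to R^d$ given by $a\mapsto (ar_1,\dots,ar_d)$, and let $m_1,\dots,m_d\in M$ be the images of the standard basis vectors of $R^d$. Write $\underline m=m_1,\dots,m_d$. Then the following hold. (1) For every integer $n\ge 1$, the module $\otimes_R^n M$ is torsion-free if and only if $n\le d-1$. (2) The element $\tau(\underline m)\in\otimes_R^dM$ satisfies $\operatorname{ann}_R\tau(\underline m)=(\underline r)$. (3) The $R$-linear map $R/(\underline r)\to\otimes_R^dM$ with $1\mapsto\tau(\underline m)$ is well defined and induces a splitting $$\otimes_R^dM\cong (R/(\underline r))\oplus W,$$ where $W$ is torsion-free (that is, the map is a split injection, identified with the inclusion of the first summand). In particular, identifying a homomorphism $f\in\operatorname{Hom}_R(R/(\underline r),\otimes_R^dM)$ with the element $f(1)$ of $\otimes_R^dM$ annihilated by $(\underline r)$, one has $$\operatorname{Hom}_R(R/(\underline r),\otimes_R^dM)=R\,\tau(\underline m)\ne 0.$$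
   Context: $\otimes_R^nM$ denotes the $n$-fold tensor power of $M$ over $R$. For elements $\underline m=m_1,\dots,m_d$ of an $R$-module $M$, $$\tau(\underline m):=\sum_{\sigma\in S_d}\operatorname{sign}(\sigma)\,m_{\sigma(1)}\otimes\cdots\otimes m_{\sigma(d)}\in\otimes_R^dM.$$ The torsion submodule of an $R$-module $N$ is the kernel of the natural map $N\to Q(R)\otimes_RN$, where $Q(R)$ is the total quotient ring of $R$ (the localization at the set of all non-zerodivisors of $R$). $N$ is torsion-free if its torsion submodule is $0$. *)

theory Defs
  imports "HOL-Algebra.Module" "HOL-Algebra.Ring_Divisibility" "HOL-Combinatorics.Permutations"
begin

text \<open>
  Modules are records of type \<open>('a, 'b) module\<close>, as in HOL-Algebra. This record type extends
  that of rings; where no multiplication on the module is meant, the fields \<open>mult\<close> and \<open>one\<close>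
  are left undefined.
\<close>

definition self_module :: "('a, 'x) ring_scheme \<Rightarrow> ('a, 'a) module" where
  "self_module R =
     \<lparr>carrier = carrier R, monoid.mult = monoid.mult R, monoid.one = \<one>\<^bsub>R\<^esub>,
      ring.zero = \<zero>\<^bsub>R\<^esub>, ring.add = ring.add R, smult = monoid.mult R\<rparr>"

definition quot_module :: "('a, 'b) module \<Rightarrow> 'b set \<Rightarrow> ('a, 'b set) module" where
  "quot_module M N =
     \<lparr>carrier = a_rcosets\<^bsub>M\<^esub> N, monoid.mult = undefined, monoid.one = undefined,
      ring.zero = N, ring.add = set_add M,
      smult = (\<lambda>a A. \<Union>x\<in>A. N +>\<^bsub>M\<^esub> (a \<odot>\<^bsub>M\<^esub> x))\<rparr>"

definition gen_submodule :: "('a, 'x) ring_scheme \<Rightarrow> ('a, 'b) module \<Rightarrow> 'b set \<Rightarrow> 'b set" where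
  "gen_submodule R M S = \<Inter>{N. submodule N R M \<and> S \<subseteq> N}"

definition direct_sum_module ::
    "('a, 'b) module \<Rightarrow> ('a, 'c) module \<Rightarrow> ('a, 'b \<times> 'c) module" where
  "direct_sum_module M N =
     \<lparr>carrier = carrier M \<times> carrier N, monoid.mult = undefined, monoid.one = undefined,
      ring.zero = (\<zero>\<^bsub>M\<^esub>, \<zero>\<^bsub>N\<^esub>),
      ring.add = (\<lambda>(x, y) (x', y'). (x \<oplus>\<^bsub>M\<^esub> x', y \<oplus>\<^bsub>N\<^esub> y')),
      smult = (\<lambda>a (x, y). (a \<odot>\<^bsub>M\<^esub> x, a \<odot>\<^bsub>N\<^esub> y))\<rparr>"

text \<open>Homomorphisms are extensional, so that equal homomorphisms are equal as functions.\<close>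

definition mod_hom ::
    "('a, 'x) ring_scheme \<Rightarrow> ('a, 'b) module \<Rightarrow> ('a, 'c) module \<Rightarrow> ('b \<Rightarrow> 'c) set" where
  "mod_hom R M N =
     {f \<in> carrier M \<rightarrow>\<^sub>E carrier N.
        (\<forall>x\<in>carrier M. \<forall>y\<in>carrier M. f (x \<oplus>\<^bsub>M\<^esub> y) = f x \<oplus>\<^bsub>N\<^esub> f y) \<and>
        (\<forall>a\<in>carrier R. \<forall>x\<in>carrier M. f (a \<odot>\<^bsub>M\<^esub> x) = a \<odot>\<^bsub>N\<^esub> f x)}"

definition mod_iso ::
    "('a, 'x) ring_scheme \<Rightarrow> ('a, 'b) module \<Rightarrow> ('a, 'c) module \<Rightarrow> ('b \<Rightarrow> 'c) set" where
  "mod_iso R M N = {f \<in> mod_hom R M N. bij_betw f (carrier M) (carrier N)}"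

definition annihilator :: "('a, 'x) ring_scheme \<Rightarrow> ('a, 'b) module \<Rightarrow> 'b \<Rightarrow> 'a set" where
  "annihilator R M x = {a \<in> carrier R. a \<odot>\<^bsub>M\<^esub> x = \<zero>\<^bsub>M\<^esub>}"

text \<open>
  The free module on \<open>X\<close>: finitely supported functions \<open>X \<rightarrow> R\<close>, extended by \<open>\<zero>\<close> outside \<open>X\<close>.
  For finite \<open>X\<close> the support condition is vacuous; in particular \<open>R\<^sup>d\<close> is
  \<open>free_module R {1..d}\<close>.
\<close>

definition free_module :: "('a, 'x) ring_scheme \<Rightarrow> 'i set \<Rightarrow> ('a, 'i \<Rightarrow> 'a) module" where
  "free_module R X =
     \<lparr>carrier = {f. (\<forall>x\<in>X. f x \<in> carrier R) \<and> (\<forall>x. x \<notin> X \<longrightarrow> f x = \<zero>\<^bsub>R\<^esub>) \<and>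
                    finite {x. f x \<noteq> \<zero>\<^bsub>R\<^esub>}},
      monoid.mult = undefined, monoid.one = undefined, ring.zero = (\<lambda>_. \<zero>\<^bsub>R\<^esub>),
      ring.add = (\<lambda>f g x. f x \<oplus>\<^bsub>R\<^esub> g x), smult = (\<lambda>a f x. a \<otimes>\<^bsub>R\<^esub> f x)\<rparr>"

definition basis_vec :: "('a, 'x) ring_scheme \<Rightarrow> 'i \<Rightarrow> 'i \<Rightarrow> 'a" where
  "basis_vec R i = (\<lambda>j. if j = i then \<one>\<^bsub>R\<^esub> else \<zero>\<^bsub>R\<^esub>)"

definition tensor_rels ::
    "('a, 'x) ring_scheme \<Rightarrow> ('a, 'b) module \<Rightarrow> ('a, 'c) module \<Rightarrow> ('b \<times> 'c \<Rightarrow> 'a) set" where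
  "tensor_rels R M N =
     (let F = free_module R (carrier M \<times> carrier N); e = basis_vec R in
       {e (x \<oplus>\<^bsub>M\<^esub> x', y) \<ominus>\<^bsub>F\<^esub> (e (x, y) \<oplus>\<^bsub>F\<^esub> e (x', y)) |x x' y.
          x \<in> carrier M \<and> x' \<in> carrier M \<and> y \<in> carrier N} \<union>
       {e (x, y \<oplus>\<^bsub>N\<^esub> y') \<ominus>\<^bsub>F\<^esub> (e (x, y) \<oplus>\<^bsub>F\<^esub> e (x, y')) |x y y'.
          x \<in> carrier M \<and> y \<in> carrier N \<and> y' \<in> carrier N} \<union>
       {e (a \<odot>\<^bsub>M\<^esub> x, y) \<ominus>\<^bsub>F\<^esub> a \<odot>\<^bsub>F\<^esub> e (x, y) |a x y.
          a \<in> carrier R \<and> x \<in> carrier M \<and> y \<in> carrier N} \<union>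
       {e (x, a \<odot>\<^bsub>N\<^esub> y) \<ominus>\<^bsub>F\<^esub> a \<odot>\<^bsub>F\<^esub> e (x, y) |a x y.
          a \<in> carrier R \<and> x \<in> carrier M \<and> y \<in> carrier N})"

definition tensor_prod ::
    "('a, 'x) ring_scheme \<Rightarrow> ('a, 'b) module \<Rightarrow> ('a, 'c) module
       \<Rightarrow> ('a, ('b \<times> 'c \<Rightarrow> 'a) set) module" where
  "tensor_prod R M N =
     (let F = free_module R (carrier M \<times> carrier N)
      in quot_module F (gen_submodule R F (tensor_rels R M N)))"

definition tensor ::
    "('a, 'x) ring_scheme \<Rightarrow> ('a, 'b) module \<Rightarrow> ('a, 'c) module \<Rightarrow> 'b \<Rightarrow> 'c
       \<Rightarrow> ('b \<times> 'c \<Rightarrow> 'a) set" where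
  "tensor R M N x y =
     (let F = free_module R (carrier M \<times> carrier N)
      in gen_submodule R F (tensor_rels R M N) +>\<^bsub>F\<^esub> basis_vec R (x, y))"

text \<open>
  The \<open>n\<close>-fold tensor power is the free module on \<open>n\<close>-tuples, represented by extensional
  functions on \<open>{1..n}\<close>, modulo the multilinearity relations.
\<close>

definition tensor_power_rels ::
    "('a, 'x) ring_scheme \<Rightarrow> ('a, 'b) module \<Rightarrow> nat \<Rightarrow> ((nat \<Rightarrow> 'b) \<Rightarrow> 'a) set" where
  "tensor_power_rels R M n =
     (let X = {1..n} \<rightarrow>\<^sub>E carrier M; F = free_module R X; e = basis_vec R in
       {e (x(i := u \<oplus>\<^bsub>M\<^esub> v)) \<ominus>\<^bsub>F\<^esub> (e (x(i := u)) \<oplus>\<^bsub>F\<^esub> e (x(i := v))) |x i u v.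
          x \<in> X \<and> i \<in> {1..n} \<and> u \<in> carrier M \<and> v \<in> carrier M} \<union>
       {e (x(i := a \<odot>\<^bsub>M\<^esub> u)) \<ominus>\<^bsub>F\<^esub> a \<odot>\<^bsub>F\<^esub> e (x(i := u)) |x i a u.
          x \<in> X \<and> i \<in> {1..n} \<and> a \<in> carrier R \<and> u \<in> carrier M})"

definition tensor_power ::
    "('a, 'x) ring_scheme \<Rightarrow> ('a, 'b) module \<Rightarrow> nat
       \<Rightarrow> ('a, ((nat \<Rightarrow> 'b) \<Rightarrow> 'a) set) module" where
  "tensor_power R M n =
     (let F = free_module R ({1..n} \<rightarrow>\<^sub>E carrier M)
      in quot_module F (gen_submodule R F (tensor_power_rels R M n)))"

definition pure_tensor ::
    "('a, 'x) ring_scheme \<Rightarrow> ('a, 'b) module \<Rightarrow> nat \<Rightarrow> (nat \<Rightarrow> 'b)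
       \<Rightarrow> ((nat \<Rightarrow> 'b) \<Rightarrow> 'a) set" where
  "pure_tensor R M n x =
     (let F = free_module R ({1..n} \<rightarrow>\<^sub>E carrier M)
      in gen_submodule R F (tensor_power_rels R M n) +>\<^bsub>F\<^esub> basis_vec R (restrict x {1..n}))"

definition tau ::
    "('a, 'x) ring_scheme \<Rightarrow> ('a, 'b) module \<Rightarrow> nat \<Rightarrow> (nat \<Rightarrow> 'b)
       \<Rightarrow> ((nat \<Rightarrow> 'b) \<Rightarrow> 'a) set" where
  "tau R M d m =
     (\<Oplus>\<^bsub>tensor_power R M d\<^esub> \<sigma> \<in> {\<sigma>. \<sigma> permutes {1..d}}.
        [sign \<sigma>] \<cdot>\<^bsub>tensor_power R M d\<^esub> pure_tensor R M d (\<lambda>i. m (\<sigma> i)))"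

definition nonzerodivisors :: "('a, 'x) ring_scheme \<Rightarrow> 'a set" where
  "nonzerodivisors R =
     {s \<in> carrier R. \<forall>a\<in>carrier R. s \<otimes>\<^bsub>R\<^esub> a = \<zero>\<^bsub>R\<^esub> \<longrightarrow> a = \<zero>\<^bsub>R\<^esub>}"

text \<open>The fraction \<open>a/s\<close>, as an equivalence class of pairs.\<close>

definition loc_frac :: "('a, 'x) ring_scheme \<Rightarrow> 'a set \<Rightarrow> 'a \<Rightarrow> 'a \<Rightarrow> ('a \<times> 'a) set" where
  "loc_frac R S a s =
     {(b, t). b \<in> carrier R \<and> t \<in> S \<and>
        (\<exists>u\<in>S. u \<otimes>\<^bsub>R\<^esub> (t \<otimes>\<^bsub>R\<^esub> a) = u \<otimes>\<^bsub>R\<^esub> (s \<otimes>\<^bsub>R\<^esub> b))}"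

text \<open>
  The localization at a multiplicative set \<open>S\<close>, as an \<open>R\<close>-algebra. The operations are computed
  on representatives; the unions are over equal classes.
\<close>

definition localization :: "('a, 'x) ring_scheme \<Rightarrow> 'a set \<Rightarrow> ('a, ('a \<times> 'a) set) module" where
  "localization R S =
     \<lparr>carrier = {loc_frac R S a s |a s. a \<in> carrier R \<and> s \<in> S},
      monoid.mult = (\<lambda>A B. \<Union>(a, s)\<in>A. \<Union>(b, t)\<in>B. loc_frac R S (a \<otimes>\<^bsub>R\<^esub> b) (s \<otimes>\<^bsub>R\<^esub> t)),
      monoid.one = loc_frac R S \<one>\<^bsub>R\<^esub> \<one>\<^bsub>R\<^esub>,
      ring.zero = loc_frac R S \<zero>\<^bsub>R\<^esub> \<one>\<^bsub>R\<^esub>,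
      ring.add = (\<lambda>A B. \<Union>(a, s)\<in>A. \<Union>(b, t)\<in>B.
               loc_frac R S ((t \<otimes>\<^bsub>R\<^esub> a) \<oplus>\<^bsub>R\<^esub> (s \<otimes>\<^bsub>R\<^esub> b)) (s \<otimes>\<^bsub>R\<^esub> t)),
      smult = (\<lambda>c A. \<Union>(a, s)\<in>A. loc_frac R S (c \<otimes>\<^bsub>R\<^esub> a) s)\<rparr>"

definition total_quotient_ring :: "('a, 'x) ring_scheme \<Rightarrow> ('a, ('a \<times> 'a) set) module" where
  "total_quotient_ring R = localization R (nonzerodivisors R)"

definition torsion_submodule :: "('a, 'x) ring_scheme \<Rightarrow> ('a, 'b) module \<Rightarrow> 'b set" where
  "torsion_submodule R N =
     (let Q = total_quotient_ring R
      in {x \<in> carrier N. tensor R Q N \<one>\<^bsub>Q\<^esub> x = \<zero>\<^bsub>tensor_prod R Q N\<^esub>})"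

definition torsion_free :: "('a, 'x) ring_scheme \<Rightarrow> ('a, 'b) module \<Rightarrow> bool" where
  "torsion_free R N \<longleftrightarrow> torsion_submodule R N = {\<zero>\<^bsub>N\<^esub>}"

definition cyclic_module :: "('a, 'x) ring_scheme \<Rightarrow> 'a set \<Rightarrow> ('a, 'a set) module" where
  "cyclic_module R I = quot_module (self_module R) I"

text \<open>
  Each \<open>r i\<close> is a nonzerodivisor on \<open>R/(r 1, \<dots>, r (i - 1))\<close>. That the ideal generated by the
  whole sequence is proper is not part of this definition.
\<close>

definition regular_sequence :: "('a, 'x) ring_scheme \<Rightarrow> nat \<Rightarrow> (nat \<Rightarrow> 'a) \<Rightarrow> bool" where
  "regular_sequence R d r \<longleftrightarrow>
     (\<forall>i\<in>{1..d}. r i \<in> carrier R) \<and>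
     (\<forall>i\<in>{1..d}. let C = cyclic_module R (Idl\<^bsub>R\<^esub> (r ` {1..<i}))
        in \<forall>x\<in>carrier C. r i \<odot>\<^bsub>C\<^esub> x = \<zero>\<^bsub>C\<^esub> \<longrightarrow> x = \<zero>\<^bsub>C\<^esub>)"

definition seq_map :: "('a, 'x) ring_scheme \<Rightarrow> nat \<Rightarrow> (nat \<Rightarrow> 'a) \<Rightarrow> 'a \<Rightarrow> nat \<Rightarrow> 'a" where
  "seq_map R d r a = (\<lambda>i. if i \<in> {1..d} then a \<otimes>\<^bsub>R\<^esub> r i else \<zero>\<^bsub>R\<^esub>)"

definition seq_coker ::
    "('a, 'x) ring_scheme \<Rightarrow> nat \<Rightarrow> (nat \<Rightarrow> 'a) \<Rightarrow> ('a, (nat \<Rightarrow> 'a) set) module" where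
  "seq_coker R d r = quot_module (free_module R {1..d}) (seq_map R d r ` carrier R)"

definition seq_coker_gen ::
    "('a, 'x) ring_scheme \<Rightarrow> nat \<Rightarrow> (nat \<Rightarrow> 'a) \<Rightarrow> nat \<Rightarrow> (nat \<Rightarrow> 'a) set" where
  "seq_coker_gen R d r i =
     (seq_map R d r ` carrier R) +>\<^bsub>free_module R {1..d}\<^esub> basis_vec R i"

end

theory Submission
  imports Defs
begin

text \<open>Let \<open>M\<close> be the cokernel of \<open>a \<mapsto> (a r\<^sub>1, \<dots>, a r\<^sub>d)\<close>, let \<open>T\<^sup>n\<close> be its \<open>n\<close>-th tensor power, and let
  \<open>I\<close> be the ideal of the sequence. Tensoring the presentation of \<open>M\<close> with \<open>T\<^sup>n\<close> exhibits \<open>T\<^sup>n\<^sup>+\<^sup>1\<close> as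
  the quotient of \<open>(T\<^sup>n)\<^sup>d\<close> by the tuples \<open>(r\<^sub>1 u, \<dots>, r\<^sub>d u)\<close> (\<open>T_famsum_zero_iff\<close>), and \<open>T\<^sup>0\<close> is the ring.
  Every assertion about \<open>T\<^sup>n\<close> is obtained by climbing this tower.

  The snake lemma for multiplication by \<open>r\<^sub>k\<^sub>+\<^sub>1\<close>, modulo \<open>(r\<^sub>1, \<dots>, r\<^sub>k)\<close>, attaches to an element
  of \<open>T\<^sup>n\<^sup>+\<^sup>1\<close> killed by \<open>r\<^sub>k\<^sub>+\<^sub>1\<close> an element of \<open>T\<^sup>n\<close> that is killed by all of \<open>I\<close> modulo
  \<open>(r\<^sub>1, \<dots>, r\<^sub>k\<^sub>+\<^sub>1)\<close>, and this assignment is injective if \<open>r\<^sub>k\<^sub>+\<^sub>1\<close> is regular on \<open>T\<^sup>n\<close>. If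
  \<open>r\<^sub>k\<^sub>+\<^sub>2\<close> is regular on \<open>T\<^sup>n\<close> modulo \<open>(r\<^sub>1, \<dots>, r\<^sub>k\<^sub>+\<^sub>1)\<close>, the target is zero; hence \<open>r\<^sub>k\<^sub>+\<^sub>1\<close> is regular on
  \<open>T\<^sup>n / (r\<^sub>1, \<dots>, r\<^sub>k) T\<^sup>n\<close> as long as \<open>n + k < d\<close> (\<open>regular_T\<close>). On the line \<open>n + k = d\<close> the same
  assignments, composed down to \<open>n = 0\<close>, embed the elements of \<open>T\<^sup>d\<close> killed by \<open>I\<close> into \<open>R/I\<close>
  (\<open>socle_T\<close>).

  Torsion elements are killed by every functional, because the total quotient ring contains the
  ring. Contracting the last tensor slot against the functionals of \<open>M\<close> given by the Koszul
  syzygies of the sequence shows that an element of \<open>T\<^sup>n\<close> killed by every functional is killed by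
  \<open>r\<^sub>j\<^sup>n\<close> for each \<open>j\<close> (\<open>functional_kernel_power_torsion\<close>). Since \<open>r\<^sub>1\<close> is regular on \<open>T\<^sup>n\<close> for
  \<open>n < d\<close>, these powers are torsion-free.

  For \<open>n = d\<close> the alternating tensor \<open>\<tau>\<close> is killed by each \<open>r\<^sub>j\<close>: with
  \<open>r\<^sub>1 m\<^sub>1 + \<dots> + r\<^sub>d m\<^sub>d = 0\<close> in the place of \<open>m\<^sub>j\<close> it expands to \<open>r\<^sub>j \<tau>\<close> plus multiples of
  alternating tensors with a repeated entry, which vanish. Reading off the
  coefficient of \<open>m\<^sub>1 \<otimes> \<dots> \<otimes> m\<^sub>d\<close> modulo \<open>I\<close> is a map \<open>T\<^sup>d \<rightarrow> R/I\<close> that sends \<open>\<tau>\<close> to \<open>1\<close>, so the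
  annihilator of \<open>\<tau>\<close> is \<open>I\<close> and \<open>R/I\<close> splits off with complement \<open>W\<close>, the kernel of that map. An
  element of \<open>W\<close> killed by \<open>I\<close> is zero: it and \<open>\<tau>\<close> have proportional images in \<open>R/I\<close>, but \<open>\<tau>\<close>
  generates a complement of \<open>W\<close> (\<open>W_socle\<close>). As the torsion of \<open>W\<close> is killed by powers of the
  \<open>r\<^sub>j\<close>, it vanishes. The elements of \<open>T\<^sup>d\<close> killed by \<open>I\<close> are therefore the multiples of \<open>\<tau>\<close>.
  For \<open>n > d\<close> the tensor \<open>\<tau> \<otimes> m\<^sub>1 \<otimes> \<dots> \<otimes> m\<^sub>1\<close> is killed by \<open>r\<^sub>1\<close> and nonzero, again by a coefficient
  modulo \<open>I\<close>.\<close>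

section \<open>Linear maps, quotients and free modules\<close>

definition linear_map ::
    "('a, 'x) ring_scheme \<Rightarrow> ('a, 'b) module \<Rightarrow> ('a, 'c) module \<Rightarrow> ('b \<Rightarrow> 'c) \<Rightarrow> bool" where
  "linear_map R M N f \<longleftrightarrow>
     (\<forall>x\<in>carrier M. f x \<in> carrier N) \<and>
     (\<forall>x\<in>carrier M. \<forall>y\<in>carrier M. f (x \<oplus>\<^bsub>M\<^esub> y) = f x \<oplus>\<^bsub>N\<^esub> f y) \<and>
     (\<forall>a\<in>carrier R. \<forall>x\<in>carrier M. f (a \<odot>\<^bsub>M\<^esub> x) = a \<odot>\<^bsub>N\<^esub> f x)"

lemma linear_mapI:
  assumes "\<And>x. x \<in> carrier M \<Longrightarrow> f x \<in> carrier N"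
    and "\<And>x y. \<lbrakk>x \<in> carrier M; y \<in> carrier M\<rbrakk> \<Longrightarrow> f (x \<oplus>\<^bsub>M\<^esub> y) = f x \<oplus>\<^bsub>N\<^esub> f y"
    and "\<And>a x. \<lbrakk>a \<in> carrier R; x \<in> carrier M\<rbrakk> \<Longrightarrow> f (a \<odot>\<^bsub>M\<^esub> x) = a \<odot>\<^bsub>N\<^esub> f x"
  shows "linear_map R M N f"
  using assms unfolding linear_map_def by blast

lemma linear_map_closed: "\<lbrakk>linear_map R M N f; x \<in> carrier M\<rbrakk> \<Longrightarrow> f x \<in> carrier N"
  and linear_map_add: "\<lbrakk>linear_map R M N f; x \<in> carrier M; y \<in> carrier M\<rbrakk>
    \<Longrightarrow> f (x \<oplus>\<^bsub>M\<^esub> y) = f x \<oplus>\<^bsub>N\<^esub> f y"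
  and linear_map_smult: "\<lbrakk>linear_map R M N f; a \<in> carrier R; x \<in> carrier M\<rbrakk>
    \<Longrightarrow> f (a \<odot>\<^bsub>M\<^esub> x) = a \<odot>\<^bsub>N\<^esub> f x"
  unfolding linear_map_def by blast+

lemma linear_map_comp:
  assumes "linear_map R M N f" "linear_map R N P g"
  shows "linear_map R M P (\<lambda>x. g (f x))"
  using assms unfolding linear_map_def by simp

lemma linear_map_cong:
  assumes "linear_map R M N f" "module R M" "\<And>x. x \<in> carrier M \<Longrightarrow> g x = f x"
  shows "linear_map R M N g"
proof -
  interpret M: module R M by fact
  show ?thesis using assms(1,3) unfolding linear_map_def by simp
qed

lemma linear_map_zero:
  assumes "linear_map R M N f" "module R M" "module R N"
  shows "f \<zero>\<^bsub>M\<^esub> = \<zero>\<^bsub>N\<^esub>"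
proof -
  interpret M: module R M by fact
  interpret N: module R N by fact
  have "f (\<zero>\<^bsub>R\<^esub> \<odot>\<^bsub>M\<^esub> \<zero>\<^bsub>M\<^esub>) = \<zero>\<^bsub>R\<^esub> \<odot>\<^bsub>N\<^esub> f \<zero>\<^bsub>M\<^esub>"
    by (rule linear_map_smult[OF assms(1)]) simp_all
  then show ?thesis using linear_map_closed[OF assms(1)] by simp
qed

lemma linear_map_neg:
  assumes "linear_map R M N f" "module R M" "module R N" "x \<in> carrier M"
  shows "f (\<ominus>\<^bsub>M\<^esub> x) = \<ominus>\<^bsub>N\<^esub> f x"
proof -
  interpret M: module R M by fact
  interpret N: module R N by fact
  have "f (\<ominus>\<^bsub>M\<^esub> x) \<oplus>\<^bsub>N\<^esub> f x = \<zero>\<^bsub>N\<^esub>"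
    using linear_map_add[OF assms(1), of "\<ominus>\<^bsub>M\<^esub> x" x] assms linear_map_zero[OF assms(1-3)]
    by (simp add: M.l_neg)
  then show ?thesis
    using assms linear_map_closed[OF assms(1)] by (simp add: N.minus_equality)
qed

lemma linear_map_diff:
  assumes "linear_map R M N f" "module R M" "module R N" "x \<in> carrier M" "y \<in> carrier M"
  shows "f (x \<ominus>\<^bsub>M\<^esub> y) = f x \<ominus>\<^bsub>N\<^esub> f y"
proof -
  interpret M: module R M by fact
  show ?thesis
    using assms by (simp add: a_minus_def linear_map_add linear_map_neg)
qed

lemma linear_map_finsum:
  assumes f: "linear_map R M N f" and M: "module R M" and N: "module R N"
    and "finite A" "g \<in> A \<rightarrow> carrier M"
  shows "f (\<Oplus>\<^bsub>M\<^esub>i\<in>A. g i) = (\<Oplus>\<^bsub>N\<^esub>i\<in>A. f (g i))"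
proof -
  interpret M: module R M by fact
  interpret N: module R N by fact
  show ?thesis using assms(4,5)
  proof (induction A)
    case empty
    then show ?case using linear_map_zero[OF f M N] by simp
  next
    case (insert a A)
    then have "f (\<Oplus>\<^bsub>M\<^esub>i\<in>insert a A. g i) = f (g a \<oplus>\<^bsub>M\<^esub> (\<Oplus>\<^bsub>M\<^esub>i\<in>A. g i))"
      by simp
    also have "\<dots> = f (g a) \<oplus>\<^bsub>N\<^esub> (\<Oplus>\<^bsub>N\<^esub>i\<in>A. f (g i))"
      using insert linear_map_add[OF f] M.finsum_closed[of g A] by (auto simp: Pi_def)
    also have "\<dots> = (\<Oplus>\<^bsub>N\<^esub>i\<in>insert a A. f (g i))"
      using insert linear_map_closed[OF f] by (subst N.finsum_insert) (auto simp: Pi_def)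
    finally show ?case .
  qed
qed

lemma linear_map_id: "linear_map R M M (\<lambda>x. x)"
  by (simp add: linear_map_def)

lemma kernel_submodule:
  assumes "linear_map R M N f" "module R M" "module R N"
  shows "submodule {x \<in> carrier M. f x = \<zero>\<^bsub>N\<^esub>} R M"
proof -
  interpret M: module R M by fact
  interpret N: module R N by fact
  show ?thesis
    by (rule M.submoduleI)
       (use assms in \<open>auto simp: linear_map_zero linear_map_neg linear_map_add linear_map_smult\<close>)
qed

lemma image_submodule:
  assumes f: "linear_map R M N f" and M: "module R M" and N: "module R N"
  shows "submodule (f ` carrier M) R N"
proof -
  interpret M: module R M by (rule M)
  interpret N: module R N by (rule N)
  show ?thesis
  proof (rule N.submoduleI)
    show "f ` carrier M \<subseteq> carrier N" using linear_map_closed[OF f] by (rule image_subsetI)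
    show "\<zero>\<^bsub>N\<^esub> \<in> f ` carrier M"
      using imageI[OF M.zero_closed, of f] linear_map_zero[OF f M N] by simp
  next
    fix v assume "v \<in> f ` carrier M"
    then obtain x where x: "v = f x" "x \<in> carrier M" by (rule imageE)
    then show "\<ominus>\<^bsub>N\<^esub> v \<in> f ` carrier M"
      using imageI[OF M.a_inv_closed[OF x(2)], of f] linear_map_neg[OF f M N x(2)] by simp
  next
    fix v w assume "v \<in> f ` carrier M" "w \<in> f ` carrier M"
    then obtain x y where x: "v = f x" "x \<in> carrier M" and y: "w = f y" "y \<in> carrier M"
      by (elim imageE)
    then show "v \<oplus>\<^bsub>N\<^esub> w \<in> f ` carrier M"
      using imageI[OF M.a_closed[OF x(2) y(2)], of f] linear_map_add[OF f x(2) y(2)] by simp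
  next
    fix c v assume c: "c \<in> carrier R" and "v \<in> f ` carrier M"
    then obtain x where x: "v = f x" "x \<in> carrier M" by (elim imageE)
    then show "c \<odot>\<^bsub>N\<^esub> v \<in> f ` carrier M"
      using imageI[OF M.smult_closed[OF c x(2)], of f] linear_map_smult[OF f c x(2)] by simp
  qed
qed

lemma gen_submodule_minimal:
  "\<lbrakk>submodule N R M; S \<subseteq> N\<rbrakk> \<Longrightarrow> gen_submodule R M S \<subseteq> N"
  unfolding gen_submodule_def by blast

lemma gen_submodule_superset: "S \<subseteq> gen_submodule R M S"
  unfolding gen_submodule_def by blast

lemma module_diff_eq_zero_iff:
  assumes "module R M" "x \<in> carrier M" "y \<in> carrier M"
  shows "x \<ominus>\<^bsub>M\<^esub> y = \<zero>\<^bsub>M\<^esub> \<longleftrightarrow> x = y"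
proof -
  interpret M: module R M by fact
  show ?thesis
    using assms(2,3) by (metis M.minus_equality M.minus_minus M.r_neg M.a_inv_closed a_minus_def)
qed

lemma submodule_facts:
  assumes "module R M" "submodule N R M"
  shows "abelian_subgroup N M" "N \<subseteq> carrier M" "\<zero>\<^bsub>M\<^esub> \<in> N" "subgroup N (add_monoid M)"
proof -
  interpret M: module R M by fact
  show sg: "subgroup N (add_monoid M)" using assms(2) by (rule submodule.axioms)
  show "abelian_subgroup N M"
    by (intro abelian_subgroupI3 additive_subgroupI sg M.abelian_group_axioms)
  show "N \<subseteq> carrier M" using M.submoduleE(1)[OF assms(2)] .
  show "\<zero>\<^bsub>M\<^esub> \<in> N" using subgroup.one_closed[OF sg] by simp
qed

lemma gen_submodule_submodule:
  assumes "module R M" "S \<subseteq> carrier M"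
  shows "submodule (gen_submodule R M S) R M"
proof -
  interpret M: module R M by fact
  have *: "submodule (carrier M) R M" by (rule M.carrier_is_submodule)
  show ?thesis
  proof (rule M.submoduleI)
    show "gen_submodule R M S \<subseteq> carrier M"
      by (rule gen_submodule_minimal[OF * assms(2)])
    show "\<zero>\<^bsub>M\<^esub> \<in> gen_submodule R M S"
      unfolding gen_submodule_def using submodule_facts(3)[OF assms(1)] by blast
  qed (unfold gen_submodule_def, (blast intro: M.submoduleE(3) M.submoduleE(4) M.submoduleE(5))+)
qed

lemma coset_eq_iff:
  assumes "module R M" "submodule N R M" "x \<in> carrier M" "y \<in> carrier M"
  shows "N +>\<^bsub>M\<^esub> x = N +>\<^bsub>M\<^esub> y \<longleftrightarrow> x \<ominus>\<^bsub>M\<^esub> y \<in> N"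
proof -
  interpret M: module R M by fact
  interpret N: abelian_subgroup N M by (rule submodule_facts[OF assms(1,2)])
  have "x \<in> N +>\<^bsub>M\<^esub> y \<longleftrightarrow> x \<oplus>\<^bsub>M\<^esub> \<ominus>\<^bsub>M\<^esub> y \<in> N"
    using assms(3,4) by (simp add: N.a_rcos_module)
  moreover have "N +>\<^bsub>M\<^esub> x = N +>\<^bsub>M\<^esub> y \<longleftrightarrow> x \<in> N +>\<^bsub>M\<^esub> y"
    using N.a_rcos_self[of x] N.a_repr_independence'[of x y] assms(3,4) by auto
  ultimately show ?thesis by (simp add: a_minus_def)
qed

lemma quot_carrier: "carrier (quot_module M N) = (\<lambda>x. N +>\<^bsub>M\<^esub> x) ` carrier M"
  unfolding quot_module_def by (auto simp: A_RCOSETS_def')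

lemma quot_zero:
  assumes "module R M" "submodule N R M"
  shows "\<zero>\<^bsub>quot_module M N\<^esub> = N +>\<^bsub>M\<^esub> \<zero>\<^bsub>M\<^esub>"
proof -
  interpret M: module R M by fact
  show ?thesis using submodule_facts[OF assms] by (simp add: quot_module_def)
qed

lemma quot_add:
  assumes "module R M" "submodule N R M" "x \<in> carrier M" "y \<in> carrier M"
  shows "(N +>\<^bsub>M\<^esub> x) \<oplus>\<^bsub>quot_module M N\<^esub> (N +>\<^bsub>M\<^esub> y) = N +>\<^bsub>M\<^esub> (x \<oplus>\<^bsub>M\<^esub> y)"
proof -
  interpret N: abelian_subgroup N M by (rule submodule_facts[OF assms(1,2)])
  show ?thesis using assms(3,4) by (simp add: quot_module_def N.a_rcos_sum)
qed

lemma quot_smult: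
  assumes "module R M" "submodule N R M" "a \<in> carrier R" "x \<in> carrier M"
  shows "a \<odot>\<^bsub>quot_module M N\<^esub> (N +>\<^bsub>M\<^esub> x) = N +>\<^bsub>M\<^esub> (a \<odot>\<^bsub>M\<^esub> x)"
proof -
  interpret M: module R M by fact
  interpret N: abelian_subgroup N M by (rule submodule_facts[OF assms(1,2)])
  have "N +>\<^bsub>M\<^esub> (a \<odot>\<^bsub>M\<^esub> y) = N +>\<^bsub>M\<^esub> (a \<odot>\<^bsub>M\<^esub> x)" if y: "y \<in> N +>\<^bsub>M\<^esub> x" for y
  proof -
    have yc: "y \<in> carrier M" using y assms(4) N.a_elemrcos_carrier by blast
    have "y \<ominus>\<^bsub>M\<^esub> x \<in> N" using N.a_rcos_module_imp[OF assms(4) y] by (simp add: a_minus_def)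
    then have "a \<odot>\<^bsub>M\<^esub> (y \<ominus>\<^bsub>M\<^esub> x) \<in> N"
      using M.submoduleE(4)[OF assms(2,3)] by blast
    moreover have "a \<odot>\<^bsub>M\<^esub> (y \<ominus>\<^bsub>M\<^esub> x) = a \<odot>\<^bsub>M\<^esub> y \<ominus>\<^bsub>M\<^esub> a \<odot>\<^bsub>M\<^esub> x"
      using assms(3,4) yc by (simp add: a_minus_def M.smult_r_distr M.smult_r_minus)
    ultimately show ?thesis
      using coset_eq_iff[OF assms(1,2), of "a \<odot>\<^bsub>M\<^esub> y" "a \<odot>\<^bsub>M\<^esub> x"] assms(3,4) yc by simp
  qed
  then have "(\<Union>y\<in>N +>\<^bsub>M\<^esub> x. N +>\<^bsub>M\<^esub> (a \<odot>\<^bsub>M\<^esub> y)) = (\<Union>y\<in>N +>\<^bsub>M\<^esub> x. N +>\<^bsub>M\<^esub> (a \<odot>\<^bsub>M\<^esub> x))"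
    by (rule SUP_cong[OF refl])
  also have "\<dots> = N +>\<^bsub>M\<^esub> (a \<odot>\<^bsub>M\<^esub> x)" using N.a_rcos_self[OF assms(4)] by blast
  finally show ?thesis by (simp add: quot_module_def)
qed

lemma quot_is_module:
  assumes "module R M" "submodule N R M"
  shows "module R (quot_module M N)"
proof -
  interpret M: module R M by fact
  note [simp] = quot_add[OF assms] quot_smult[OF assms] quot_zero[OF assms] quot_carrier[of M N]
  show ?thesis
  proof (rule moduleI)
    show "cring R" by (rule M.is_cring)
    show "abelian_group (quot_module M N)"
    proof (rule abelian_groupI)
      fix x assume "x \<in> carrier (quot_module M N)"
      then obtain u where u: "u \<in> carrier M" "x = N +>\<^bsub>M\<^esub> u" by auto
      have "N +>\<^bsub>M\<^esub> (\<ominus>\<^bsub>M\<^esub> u) \<in> carrier (quot_module M N)"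
        "(N +>\<^bsub>M\<^esub> (\<ominus>\<^bsub>M\<^esub> u)) \<oplus>\<^bsub>quot_module M N\<^esub> x = \<zero>\<^bsub>quot_module M N\<^esub>"
        using u by (auto simp: M.l_neg)
      then show "\<exists>y\<in>carrier (quot_module M N). y \<oplus>\<^bsub>quot_module M N\<^esub> x = \<zero>\<^bsub>quot_module M N\<^esub>"
        by blast
    qed (auto simp: M.a_ac)
  qed (auto simp: M.smult_l_distr M.smult_r_distr M.smult_assoc1)
qed

lemma quot_eq_zero_iff:
  assumes "module R M" "submodule N R M" "x \<in> carrier M"
  shows "N +>\<^bsub>M\<^esub> x = \<zero>\<^bsub>quot_module M N\<^esub> \<longleftrightarrow> x \<in> N"
proof -
  interpret M: module R M by fact
  have "\<ominus>\<^bsub>M\<^esub> \<zero>\<^bsub>M\<^esub> = \<zero>\<^bsub>M\<^esub>" by (rule M.minus_equality) simp_all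
  then have "x \<ominus>\<^bsub>M\<^esub> \<zero>\<^bsub>M\<^esub> = x" using assms(3) by (simp only: a_minus_def M.r_zero)
  then show ?thesis
    using assms by (simp add: quot_zero coset_eq_iff[OF assms(1,2)])
qed

lemma quot_proj_linear:
  assumes "module R M" "submodule N R M"
  shows "linear_map R M (quot_module M N) (\<lambda>x. N +>\<^bsub>M\<^esub> x)"
  by (rule linear_mapI) (auto simp: quot_carrier quot_add[OF assms] quot_smult[OF assms])

lemma quot_universal:
  assumes M: "module R M" and N: "submodule N R M" and P: "module R P"
    and f: "linear_map R M P f" and fN: "\<And>x. x \<in> N \<Longrightarrow> f x = \<zero>\<^bsub>P\<^esub>"
  shows "\<exists>h. linear_map R (quot_module M N) P h \<and> (\<forall>x\<in>carrier M. h (N +>\<^bsub>M\<^esub> x) = f x)"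
proof -
  interpret M: module R M by fact
  interpret P: module R P by fact
  define h where "h A = f (SOME x. x \<in> carrier M \<and> A = N +>\<^bsub>M\<^esub> x)" for A
  have h: "h (N +>\<^bsub>M\<^esub> x) = f x" if x: "x \<in> carrier M" for x
  proof -
    let ?y = "SOME y. y \<in> carrier M \<and> N +>\<^bsub>M\<^esub> x = N +>\<^bsub>M\<^esub> y"
    have y: "?y \<in> carrier M \<and> N +>\<^bsub>M\<^esub> x = N +>\<^bsub>M\<^esub> ?y"
      by (rule someI[of _ x]) (use x in simp)
    then have "f (x \<ominus>\<^bsub>M\<^esub> ?y) = \<zero>\<^bsub>P\<^esub>" using coset_eq_iff[OF M N, of x ?y] fN x by simp
    then have "f x = f ?y"
      using y x linear_map_closed[OF f]
      by (simp add: linear_map_diff[OF f M P] module_diff_eq_zero_iff[OF P])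
    then show ?thesis by (simp add: h_def)
  qed
  have "linear_map R (quot_module M N) P h"
    by (rule linear_mapI)
       (use f in \<open>auto simp: quot_carrier quot_add[OF M N] quot_smult[OF M N] h
          linear_map_closed linear_map_add linear_map_smult\<close>)
  with h show ?thesis by blast
qed

lemma self_module_simps [simp]:
  "carrier (self_module R) = carrier R" "\<zero>\<^bsub>self_module R\<^esub> = \<zero>\<^bsub>R\<^esub>"
  "x \<oplus>\<^bsub>self_module R\<^esub> y = x \<oplus>\<^bsub>R\<^esub> y" "a \<odot>\<^bsub>self_module R\<^esub> x = a \<otimes>\<^bsub>R\<^esub> x"
  by (simp_all add: self_module_def)

lemma self_module_coset [simp]: "I +>\<^bsub>self_module R\<^esub> a = I +>\<^bsub>R\<^esub> a"
  by (simp add: a_r_coset_def')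

lemma self_is_module:
  assumes "cring R" shows "module R (self_module R)"
proof -
  interpret cring R by fact
  show ?thesis
    by (rule moduleI)
       (auto intro!: abelian_groupI exI[of _ "\<ominus>\<^bsub>R\<^esub> _"] bexI[of _ "\<ominus>\<^bsub>R\<^esub> _"]
         simp: is_cring l_distr r_distr m_assoc a_ac l_neg r_neg)
qed

lemma free_module_simps:
  "carrier (free_module R X) = {f. (\<forall>x\<in>X. f x \<in> carrier R) \<and> (\<forall>x. x \<notin> X \<longrightarrow> f x = \<zero>\<^bsub>R\<^esub>) \<and>
     finite {x. f x \<noteq> \<zero>\<^bsub>R\<^esub>}}"
  "\<zero>\<^bsub>free_module R X\<^esub> = (\<lambda>_. \<zero>\<^bsub>R\<^esub>)"
  "f \<oplus>\<^bsub>free_module R X\<^esub> g = (\<lambda>x. f x \<oplus>\<^bsub>R\<^esub> g x)"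
  "a \<odot>\<^bsub>free_module R X\<^esub> f = (\<lambda>x. a \<otimes>\<^bsub>R\<^esub> f x)"
  by (simp_all add: free_module_def)

lemma free_coord_closed:
  assumes "cring R" "f \<in> carrier (free_module R X)"
  shows "f x \<in> carrier R"
proof -
  interpret cring R by fact
  show ?thesis using assms(2) by (cases "x \<in> X") (auto simp: free_module_simps)
qed

lemma free_is_module:
  assumes "cring R" shows "module R (free_module R X)"
proof -
  interpret cring R by fact
  let ?F = "free_module R X"
  note cl = free_coord_closed[OF assms]
  have add: "(\<lambda>x. f x \<oplus>\<^bsub>R\<^esub> g x) \<in> carrier ?F" if "f \<in> carrier ?F" "g \<in> carrier ?F" for f g
  proof -
    have "{x. f x \<oplus>\<^bsub>R\<^esub> g x \<noteq> \<zero>\<^bsub>R\<^esub>} \<subseteq> {x. f x \<noteq> \<zero>\<^bsub>R\<^esub>} \<union> {x. g x \<noteq> \<zero>\<^bsub>R\<^esub>}" by auto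
    then have "finite {x. f x \<oplus>\<^bsub>R\<^esub> g x \<noteq> \<zero>\<^bsub>R\<^esub>}"
      using that by (auto simp: free_module_simps intro: finite_subset)
    then show ?thesis using that by (auto simp: free_module_simps)
  qed
  have sm: "(\<lambda>x. a \<otimes>\<^bsub>R\<^esub> f x) \<in> carrier ?F" if "a \<in> carrier R" "f \<in> carrier ?F" for a f
  proof -
    have "{x. a \<otimes>\<^bsub>R\<^esub> f x \<noteq> \<zero>\<^bsub>R\<^esub>} \<subseteq> {x. f x \<noteq> \<zero>\<^bsub>R\<^esub>}" using that(1) by auto
    then have "finite {x. a \<otimes>\<^bsub>R\<^esub> f x \<noteq> \<zero>\<^bsub>R\<^esub>}"
      using that by (auto simp: free_module_simps intro: finite_subset)
    then show ?thesis using that by (auto simp: free_module_simps)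
  qed
  have z: "(\<lambda>_. \<zero>\<^bsub>R\<^esub>) \<in> carrier ?F" by (auto simp: free_module_simps)
  show ?thesis
  proof (rule moduleI)
    show "abelian_group ?F"
    proof (rule abelian_groupI)
      fix f assume f: "f \<in> carrier ?F"
      show "\<exists>g\<in>carrier ?F. g \<oplus>\<^bsub>?F\<^esub> f = \<zero>\<^bsub>?F\<^esub>"
      proof (rule bexI[of _ "\<lambda>x. (\<ominus>\<^bsub>R\<^esub> \<one>\<^bsub>R\<^esub>) \<otimes>\<^bsub>R\<^esub> f x"])
        show "(\<lambda>x. (\<ominus>\<^bsub>R\<^esub> \<one>\<^bsub>R\<^esub>) \<otimes>\<^bsub>R\<^esub> f x) \<in> carrier ?F" using sm f by simp
        show "(\<lambda>x. (\<ominus>\<^bsub>R\<^esub> \<one>\<^bsub>R\<^esub>) \<otimes>\<^bsub>R\<^esub> f x) \<oplus>\<^bsub>?F\<^esub> f = \<zero>\<^bsub>?F\<^esub>"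
          using cl[OF f] by (simp add: free_module_simps(2-) l_minus l_neg)
      qed
    qed (auto simp: free_module_simps(2-) add z cl a_ac)
  qed (auto simp: is_cring free_module_simps(2-) sm cl l_distr r_distr m_assoc)
qed

lemma basis_vec_closed:
  assumes "cring R" "x \<in> X" shows "basis_vec R x \<in> carrier (free_module R X)"
proof -
  interpret cring R by fact
  have "{y. basis_vec R x y \<noteq> \<zero>\<^bsub>R\<^esub>} \<subseteq> {x}" by (auto simp: basis_vec_def)
  then show ?thesis
    using assms(2) finite_subset by (auto simp: free_module_simps basis_vec_def)
qed

lemma free_module_induct [consumes 2, case_names zero step]:
  assumes R: "cring R" and f: "f \<in> carrier (free_module R X)"
    and zero: "P \<zero>\<^bsub>free_module R X\<^esub>"
    and step: "\<And>g a x. \<lbrakk>g \<in> carrier (free_module R X); P g; a \<in> carrier R; x \<in> X\<rbrakk>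
      \<Longrightarrow> P (g \<oplus>\<^bsub>free_module R X\<^esub> a \<odot>\<^bsub>free_module R X\<^esub> basis_vec R x)"
  shows "P f"
proof -
  interpret cring R by fact
  have "P f" if "finite A" "f \<in> carrier (free_module R X)" "{x. f x \<noteq> \<zero>\<^bsub>R\<^esub>} = A" for A f
    using that
  proof (induction A arbitrary: f)
    case empty
    then have "f = (\<lambda>_. \<zero>\<^bsub>R\<^esub>)" by auto
    then show ?case using zero by (simp add: free_module_simps)
  next
    case (insert x A)
    let ?g = "f(x := \<zero>\<^bsub>R\<^esub>)"
    have supp: "{y. ?g y \<noteq> \<zero>\<^bsub>R\<^esub>} = A" using insert.prems(2) insert.hyps(2) by auto
    have x: "x \<in> X" using insert.prems by (auto simp: free_module_simps)
    have g: "?g \<in> carrier (free_module R X)"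
      using insert.prems(1) supp insert.hyps(1) by (auto simp: free_module_simps)
    have eq: "f = ?g \<oplus>\<^bsub>free_module R X\<^esub> f x \<odot>\<^bsub>free_module R X\<^esub> basis_vec R x"
      using free_coord_closed[OF R insert.prems(1)]
      by (auto simp: free_module_simps(2-) basis_vec_def)
    show ?case
      by (subst eq)
         (rule step[OF g insert.IH[OF g supp] free_coord_closed[OF R insert.prems(1), of x] x])
  qed
  moreover have "finite {x. f x \<noteq> \<zero>\<^bsub>R\<^esub>}" using f by (simp add: free_module_simps)
  ultimately show ?thesis using f by blast
qed

lemma free_universal:
  assumes P: "module R P" and \<beta>: "\<And>x. x \<in> X \<Longrightarrow> \<beta> x \<in> carrier P"
  shows "\<exists>f. linear_map R (free_module R X) P f \<and> (\<forall>x\<in>X. f (basis_vec R x) = \<beta> x)"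
proof -
  interpret P: module R P by fact
  let ?F = "free_module R X"
  have R: "cring R" by (rule P.is_cring)
  note cl = free_coord_closed[OF R]
  define f where "f g = (\<Oplus>\<^bsub>P\<^esub>x\<in>{x. g x \<noteq> \<zero>\<^bsub>R\<^esub>}. g x \<odot>\<^bsub>P\<^esub> \<beta> x)" for g
  have f: "f g = (\<Oplus>\<^bsub>P\<^esub>x\<in>A. g x \<odot>\<^bsub>P\<^esub> \<beta> x)"
    if "g \<in> carrier ?F" "finite A" "A \<subseteq> X" "{x. g x \<noteq> \<zero>\<^bsub>R\<^esub>} \<subseteq> A" for g A
    unfolding f_def
    by (rule P.add.finprod_mono_neutral_cong_left) (use that \<beta> cl[OF that(1)] in auto)
  have supp: "finite {x. g x \<noteq> \<zero>\<^bsub>R\<^esub>}" "{x. g x \<noteq> \<zero>\<^bsub>R\<^esub>} \<subseteq> X" if "g \<in> carrier ?F" for g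
    using that by (auto simp: free_module_simps)
  interpret F: module R ?F by (rule free_is_module[OF R])
  have "linear_map R ?F P f"
  proof (rule linear_mapI)
    fix g h assume g: "g \<in> carrier ?F" and h: "h \<in> carrier ?F"
    let ?A = "{x. g x \<noteq> \<zero>\<^bsub>R\<^esub>} \<union> {x. h x \<noteq> \<zero>\<^bsub>R\<^esub>}"
    have A: "finite ?A" "?A \<subseteq> X" using supp[OF g] supp[OF h] by auto
    have "{x. (g \<oplus>\<^bsub>?F\<^esub> h) x \<noteq> \<zero>\<^bsub>R\<^esub>} \<subseteq> ?A" by (auto simp: free_module_simps(2-))
    then have "f (g \<oplus>\<^bsub>?F\<^esub> h) = (\<Oplus>\<^bsub>P\<^esub>x\<in>?A. (g x \<oplus>\<^bsub>R\<^esub> h x) \<odot>\<^bsub>P\<^esub> \<beta> x)"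
      using f[OF F.a_closed[OF g h] A] by (simp add: free_module_simps(2-))
    also have "\<dots> = (\<Oplus>\<^bsub>P\<^esub>x\<in>?A. g x \<odot>\<^bsub>P\<^esub> \<beta> x \<oplus>\<^bsub>P\<^esub> h x \<odot>\<^bsub>P\<^esub> \<beta> x)"
      by (rule P.finsum_cong') (use cl[OF g] cl[OF h] \<beta> A in \<open>auto simp: P.smult_l_distr subset_iff\<close>)
    also have "\<dots> = f g \<oplus>\<^bsub>P\<^esub> f h"
      by (subst P.finsum_addf)
         (use cl[OF g] cl[OF h] \<beta> A f[OF g A] f[OF h A] in \<open>auto simp: subset_iff\<close>)
    finally show "f (g \<oplus>\<^bsub>?F\<^esub> h) = f g \<oplus>\<^bsub>P\<^esub> f h" .
  next
    fix g assume g: "g \<in> carrier ?F"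
    show "f g \<in> carrier P"
      unfolding f_def by (rule P.finsum_closed) (use supp[OF g] cl[OF g] \<beta> in auto)
    fix a assume a: "a \<in> carrier R"
    let ?A = "{x. g x \<noteq> \<zero>\<^bsub>R\<^esub>}"
    have "{x. (a \<odot>\<^bsub>?F\<^esub> g) x \<noteq> \<zero>\<^bsub>R\<^esub>} \<subseteq> ?A" using a by (auto simp: free_module_simps(2-))
    then have "f (a \<odot>\<^bsub>?F\<^esub> g) = (\<Oplus>\<^bsub>P\<^esub>x\<in>?A. (a \<otimes>\<^bsub>R\<^esub> g x) \<odot>\<^bsub>P\<^esub> \<beta> x)"
      using f[OF F.smult_closed[OF a g] supp[OF g]] by (simp add: free_module_simps(2-))
    also have "\<dots> = (\<Oplus>\<^bsub>P\<^esub>x\<in>?A. a \<odot>\<^bsub>P\<^esub> (g x \<odot>\<^bsub>P\<^esub> \<beta> x))"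
      by (rule P.finsum_cong') (use cl[OF g] a \<beta> supp[OF g] in \<open>auto simp: P.smult_assoc1 subset_iff\<close>)
    also have "\<dots> = a \<odot>\<^bsub>P\<^esub> f g"
      unfolding f_def
      by (rule P.finsum_smult_ldistr[symmetric]) (use cl[OF g] a \<beta> supp[OF g] in auto)
    finally show "f (a \<odot>\<^bsub>?F\<^esub> g) = a \<odot>\<^bsub>P\<^esub> f g" .
  qed
  moreover have "f (basis_vec R x) = \<beta> x" if x: "x \<in> X" for x
  proof -
    have "f (basis_vec R x) = (\<Oplus>\<^bsub>P\<^esub>y\<in>{x}. basis_vec R x y \<odot>\<^bsub>P\<^esub> \<beta> y)"
      by (rule f[OF basis_vec_closed[OF R x]]) (use x in \<open>auto simp: basis_vec_def\<close>)
    also have "\<dots> = \<beta> x" using \<beta>[OF x] by (simp add: basis_vec_def)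
    finally show ?thesis .
  qed
  ultimately show ?thesis by blast
qed

section \<open>Modules presented by generators and relations\<close>

text \<open>A map out of a presented module is a choice of values on the generators whose linear extension
  kills the relations. The tensor product and the tensor powers are both of this kind.\<close>

lemma presented_universal:
  assumes P: "module R P" and \<beta>: "\<And>x. x \<in> X \<Longrightarrow> \<beta> x \<in> carrier P"
    and S: "S \<subseteq> carrier (free_module R X)"
    and kills: "\<And>f s. \<lbrakk>linear_map R (free_module R X) P f;
      \<And>x. x \<in> X \<Longrightarrow> f (basis_vec R x) = \<beta> x; s \<in> S\<rbrakk> \<Longrightarrow> f s = \<zero>\<^bsub>P\<^esub>"
  shows "\<exists>h.
    linear_map R (quot_module (free_module R X) (gen_submodule R (free_module R X) S)) P h \<and>
    (\<forall>x\<in>X. h (gen_submodule R (free_module R X) S +>\<^bsub>free_module R X\<^esub> basis_vec R x) = \<beta> x)"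
proof -
  interpret P: module R P by fact
  let ?F = "free_module R X"
  have R: "cring R" by (rule P.is_cring)
  have F: "module R ?F" by (rule free_is_module[OF R])
  obtain f where f: "linear_map R ?F P f" "\<And>x. x \<in> X \<Longrightarrow> f (basis_vec R x) = \<beta> x"
    using free_universal[where X = X and \<beta> = \<beta>, OF P \<beta>] by blast
  have "S \<subseteq> {x \<in> carrier ?F. f x = \<zero>\<^bsub>P\<^esub>}" using kills[OF f] S by blast
  then have "gen_submodule R ?F S \<subseteq> {x \<in> carrier ?F. f x = \<zero>\<^bsub>P\<^esub>}"
    by (rule gen_submodule_minimal[OF kernel_submodule[OF f(1) F P]])
  then obtain h where h: "linear_map R (quot_module ?F (gen_submodule R ?F S)) P h"
    "\<And>x. x \<in> carrier ?F \<Longrightarrow> h (gen_submodule R ?F S +>\<^bsub>?F\<^esub> x) = f x"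
    using quot_universal[OF F gen_submodule_submodule[OF F S] P f(1)] by blast
  then have "\<forall>x\<in>X. h (gen_submodule R ?F S +>\<^bsub>?F\<^esub> basis_vec R x) = \<beta> x"
    using f(2) h(2)[OF basis_vec_closed[OF R]] by simp
  with h(1) show ?thesis by blast
qed

lemma presented_induct:
  assumes R: "cring R" and S: "S \<subseteq> carrier (free_module R X)"
  defines "G \<equiv> gen_submodule R (free_module R X) S"
  defines "Q \<equiv> quot_module (free_module R X) G"
  assumes t: "t \<in> carrier Q" and zero: "P \<zero>\<^bsub>Q\<^esub>"
    and step: "\<And>u a x. \<lbrakk>u \<in> carrier Q; P u; a \<in> carrier R; x \<in> X\<rbrakk>
      \<Longrightarrow> P (u \<oplus>\<^bsub>Q\<^esub> a \<odot>\<^bsub>Q\<^esub> (G +>\<^bsub>free_module R X\<^esub> basis_vec R x))"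
  shows "P t"
proof -
  let ?F = "free_module R X"
  have F: "module R ?F" by (rule free_is_module[OF R])
  have G: "submodule G R ?F" unfolding G_def by (rule gen_submodule_submodule[OF F S])
  interpret F: module R ?F by (rule F)
  have "P (G +>\<^bsub>?F\<^esub> f)" if "f \<in> carrier ?F" for f
    using R that
  proof (induction rule: free_module_induct)
    case zero
    then show ?case using assms(6) quot_zero[OF F G] by (simp add: Q_def)
  next
    case (step g a x)
    note g0 = step.hyps(1) and ax = step.hyps(2,3)
    have e: "basis_vec R x \<in> carrier ?F" by (rule basis_vec_closed[OF R ax(2)])
    have g: "G +>\<^bsub>?F\<^esub> g \<in> carrier Q" using g0 by (auto simp: Q_def quot_carrier)
    have "P ((G +>\<^bsub>?F\<^esub> g) \<oplus>\<^bsub>Q\<^esub> a \<odot>\<^bsub>Q\<^esub> (G +>\<^bsub>?F\<^esub> basis_vec R x))"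
      by (rule assms(7)[OF g step.IH ax])
    then show ?case
      using g0 ax(1) e by (simp add: Q_def quot_smult[OF F G] quot_add[OF F G])
  qed
  then show ?thesis using t by (auto simp: Q_def quot_carrier)
qed

section \<open>The tensor product and torsion\<close>

lemma tensor_rels_closed:
  assumes "module R M" "module R N"
  shows "tensor_rels R M N \<subseteq> carrier (free_module R (carrier M \<times> carrier N))"
proof -
  interpret M: module R M by fact
  interpret N: module R N by fact
  interpret F: module R "free_module R (carrier M \<times> carrier N)"
    by (rule free_is_module[OF M.is_cring])
  have "basis_vec R (x, y) \<in> carrier (free_module R (carrier M \<times> carrier N))"
    if "x \<in> carrier M" "y \<in> carrier N" for x y
    by (rule basis_vec_closed[OF M.is_cring]) (use that in auto)
  then show ?thesis
    unfolding tensor_rels_def Let_def by (auto intro!: F.minus_closed F.a_closed F.smult_closed)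
qed

lemma tensor_prod_module:
  assumes "module R M" "module R N"
  shows "module R (tensor_prod R M N)"
proof -
  interpret M: module R M by fact
  show ?thesis
    unfolding tensor_prod_def Let_def
    by (intro quot_is_module gen_submodule_submodule tensor_rels_closed free_is_module
        M.is_cring assms)
qed

lemma tensor_closed:
  assumes "module R M" "x \<in> carrier M" "y \<in> carrier N"
  shows "tensor R M N x y \<in> carrier (tensor_prod R M N)"
proof -
  interpret M: module R M by fact
  show ?thesis
    unfolding tensor_prod_def tensor_def Let_def quot_carrier
    using basis_vec_closed[OF M.is_cring, of "(x, y)" "carrier M \<times> carrier N"] assms by auto
qed

text \<open>Scalars move across the tensor sign, by the last two families of relations.\<close>

lemma tensor_smult_middle:
  assumes M: "module R M" and N: "module R N"
    and "a \<in> carrier R" "x \<in> carrier M" "y \<in> carrier N"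
  shows "tensor R M N (a \<odot>\<^bsub>M\<^esub> x) y = a \<odot>\<^bsub>tensor_prod R M N\<^esub> tensor R M N x y"
    and "tensor R M N x (a \<odot>\<^bsub>N\<^esub> y) = a \<odot>\<^bsub>tensor_prod R M N\<^esub> tensor R M N x y"
proof -
  interpret M: module R M by fact
  interpret N: module R N by fact
  let ?F = "free_module R (carrier M \<times> carrier N)"
  let ?G = "gen_submodule R ?F (tensor_rels R M N)"
  have F: "module R ?F" by (rule free_is_module[OF M.is_cring])
  interpret F: module R ?F by (rule F)
  have G: "submodule ?G R ?F" by (rule gen_submodule_submodule[OF F tensor_rels_closed[OF M N]])
  have e: "basis_vec R (x, y) \<in> carrier ?F" if "x \<in> carrier M" "y \<in> carrier N" for x y
    by (rule basis_vec_closed[OF M.is_cring]) (use that in auto)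
  have "basis_vec R (a \<odot>\<^bsub>M\<^esub> x, y) \<ominus>\<^bsub>?F\<^esub> a \<odot>\<^bsub>?F\<^esub> basis_vec R (x, y) \<in> tensor_rels R M N"
    unfolding tensor_rels_def Let_def
    by (rule UnI1, rule UnI2, rule CollectI, intro exI conjI, rule refl) (use assms(3-5) in auto)
  moreover have
    "basis_vec R (x, a \<odot>\<^bsub>N\<^esub> y) \<ominus>\<^bsub>?F\<^esub> a \<odot>\<^bsub>?F\<^esub> basis_vec R (x, y) \<in> tensor_rels R M N"
    unfolding tensor_rels_def Let_def
    by (rule UnI2, rule CollectI, intro exI conjI, rule refl) (use assms(3-5) in auto)
  ultimately have "basis_vec R (a \<odot>\<^bsub>M\<^esub> x, y) \<ominus>\<^bsub>?F\<^esub> a \<odot>\<^bsub>?F\<^esub> basis_vec R (x, y) \<in> ?G"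
    "basis_vec R (x, a \<odot>\<^bsub>N\<^esub> y) \<ominus>\<^bsub>?F\<^esub> a \<odot>\<^bsub>?F\<^esub> basis_vec R (x, y) \<in> ?G"
    using gen_submodule_superset[of "tensor_rels R M N" R ?F] by (simp_all add: subset_iff)
  then show "tensor R M N (a \<odot>\<^bsub>M\<^esub> x) y = a \<odot>\<^bsub>tensor_prod R M N\<^esub> tensor R M N x y"
    "tensor R M N x (a \<odot>\<^bsub>N\<^esub> y) = a \<odot>\<^bsub>tensor_prod R M N\<^esub> tensor R M N x y"
    using assms(3-5) by (simp_all add: tensor_def tensor_prod_def Let_def quot_smult[OF F G]
        coset_eq_iff[OF F G] e)
qed

lemma tensor_prod_universal:
  assumes M: "module R M" and N: "module R N" and P: "module R P"
    and \<beta>: "\<And>x y. \<lbrakk>x \<in> carrier M; y \<in> carrier N\<rbrakk> \<Longrightarrow> \<beta> x y \<in> carrier P"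
    and "\<And>x x' y. \<lbrakk>x \<in> carrier M; x' \<in> carrier M; y \<in> carrier N\<rbrakk>
      \<Longrightarrow> \<beta> (x \<oplus>\<^bsub>M\<^esub> x') y = \<beta> x y \<oplus>\<^bsub>P\<^esub> \<beta> x' y"
    and "\<And>x y y'. \<lbrakk>x \<in> carrier M; y \<in> carrier N; y' \<in> carrier N\<rbrakk>
      \<Longrightarrow> \<beta> x (y \<oplus>\<^bsub>N\<^esub> y') = \<beta> x y \<oplus>\<^bsub>P\<^esub> \<beta> x y'"
    and "\<And>a x y. \<lbrakk>a \<in> carrier R; x \<in> carrier M; y \<in> carrier N\<rbrakk>
      \<Longrightarrow> \<beta> (a \<odot>\<^bsub>M\<^esub> x) y = a \<odot>\<^bsub>P\<^esub> \<beta> x y"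
    and "\<And>a x y. \<lbrakk>a \<in> carrier R; x \<in> carrier M; y \<in> carrier N\<rbrakk>
      \<Longrightarrow> \<beta> x (a \<odot>\<^bsub>N\<^esub> y) = a \<odot>\<^bsub>P\<^esub> \<beta> x y"
  shows "\<exists>h. linear_map R (tensor_prod R M N) P h \<and>
    (\<forall>x\<in>carrier M. \<forall>y\<in>carrier N. h (tensor R M N x y) = \<beta> x y)"
proof -
  interpret M: module R M by (rule M)
  interpret N: module R N by (rule N)
  interpret P: module R P by (rule P)
  let ?X = "carrier M \<times> carrier N"
  let ?F = "free_module R ?X"
  have F: "module R ?F" by (rule free_is_module[OF M.is_cring])
  interpret F: module R ?F by (rule F)
  have e: "basis_vec R (x, y) \<in> carrier ?F" if "x \<in> carrier M" "y \<in> carrier N" for x y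
    by (rule basis_vec_closed[OF M.is_cring]) (use that in auto)
  have "\<exists>h. linear_map R (quot_module ?F (gen_submodule R ?F (tensor_rels R M N))) P h \<and>
    (\<forall>z\<in>?X. h (gen_submodule R ?F (tensor_rels R M N) +>\<^bsub>?F\<^esub> basis_vec R z) =
       (case z of (x, y) \<Rightarrow> \<beta> x y))"
  proof (rule presented_universal[OF P _ tensor_rels_closed[OF M N],
        where \<beta> = "\<lambda>z. case z of (x, y) \<Rightarrow> \<beta> x y"])
    fix f s
    assume f: "linear_map R ?F P f"
      and f\<beta>: "\<And>z. z \<in> ?X \<Longrightarrow> f (basis_vec R z) = (case z of (x, y) \<Rightarrow> \<beta> x y)"
      and s: "s \<in> tensor_rels R M N"
    have b: "f (basis_vec R (x, y)) = \<beta> x y" if "x \<in> carrier M" "y \<in> carrier N" for x y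
      using f\<beta>[of "(x, y)"] that by simp
    have m: "u \<ominus>\<^bsub>P\<^esub> u = \<zero>\<^bsub>P\<^esub>" if "u \<in> carrier P" for u
      using module_diff_eq_zero_iff[OF P that that] by simp
    note f_simps = linear_map_diff[OF f F P] linear_map_add[OF f] linear_map_smult[OF f]
    from s consider
      x x' y where "s = basis_vec R (x \<oplus>\<^bsub>M\<^esub> x', y) \<ominus>\<^bsub>?F\<^esub> (basis_vec R (x, y) \<oplus>\<^bsub>?F\<^esub> basis_vec R (x', y))"
        "x \<in> carrier M" "x' \<in> carrier M" "y \<in> carrier N"
    | x y y' where "s = basis_vec R (x, y \<oplus>\<^bsub>N\<^esub> y') \<ominus>\<^bsub>?F\<^esub> (basis_vec R (x, y) \<oplus>\<^bsub>?F\<^esub> basis_vec R (x, y'))"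
        "x \<in> carrier M" "y \<in> carrier N" "y' \<in> carrier N"
    | a x y where "s = basis_vec R (a \<odot>\<^bsub>M\<^esub> x, y) \<ominus>\<^bsub>?F\<^esub> a \<odot>\<^bsub>?F\<^esub> basis_vec R (x, y)"
        "a \<in> carrier R" "x \<in> carrier M" "y \<in> carrier N"
    | a x y where "s = basis_vec R (x, a \<odot>\<^bsub>N\<^esub> y) \<ominus>\<^bsub>?F\<^esub> a \<odot>\<^bsub>?F\<^esub> basis_vec R (x, y)"
        "a \<in> carrier R" "x \<in> carrier M" "y \<in> carrier N"
      unfolding tensor_rels_def Let_def by (elim UnE CollectE exE conjE) (rule that; assumption)+
    then show "f s = \<zero>\<^bsub>P\<^esub>"
    proof cases
      case 1
      then have "f s = \<beta> (x \<oplus>\<^bsub>M\<^esub> x') y \<ominus>\<^bsub>P\<^esub> (\<beta> x y \<oplus>\<^bsub>P\<^esub> \<beta> x' y)"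
        by (simp add: f_simps e b)
      also have "\<dots> = \<zero>\<^bsub>P\<^esub>"
        unfolding assms(5)[OF 1(2-)] by (rule m) (use 1(2-) \<beta> in simp)
      finally show ?thesis .
    next
      case 2
      then have "f s = \<beta> x (y \<oplus>\<^bsub>N\<^esub> y') \<ominus>\<^bsub>P\<^esub> (\<beta> x y \<oplus>\<^bsub>P\<^esub> \<beta> x y')"
        by (simp add: f_simps e b)
      also have "\<dots> = \<zero>\<^bsub>P\<^esub>"
        unfolding assms(6)[OF 2(2-)] by (rule m) (use 2(2-) \<beta> in simp)
      finally show ?thesis .
    next
      case 3
      then have "f s = \<beta> (a \<odot>\<^bsub>M\<^esub> x) y \<ominus>\<^bsub>P\<^esub> (a \<odot>\<^bsub>P\<^esub> \<beta> x y)"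
        by (simp add: f_simps e b)
      also have "\<dots> = \<zero>\<^bsub>P\<^esub>"
        unfolding assms(7)[OF 3(2-)] by (rule m) (use 3(2-) \<beta> in simp)
      finally show ?thesis .
    next
      case 4
      then have "f s = \<beta> x (a \<odot>\<^bsub>N\<^esub> y) \<ominus>\<^bsub>P\<^esub> (a \<odot>\<^bsub>P\<^esub> \<beta> x y)"
        by (simp add: f_simps e b)
      also have "\<dots> = \<zero>\<^bsub>P\<^esub>"
        unfolding assms(8)[OF 4(2-)] by (rule m) (use 4(2-) \<beta> in simp)
      finally show ?thesis .
    qed
  qed (use \<beta> in auto)
  then obtain h where h: "linear_map R (tensor_prod R M N) P h"
    "\<And>z. z \<in> ?X \<Longrightarrow> h (gen_submodule R ?F (tensor_rels R M N) +>\<^bsub>?F\<^esub> basis_vec R z) =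
       (case z of (x, y) \<Rightarrow> \<beta> x y)"
    unfolding tensor_prod_def Let_def by blast
  have "\<forall>x\<in>carrier M. \<forall>y\<in>carrier N. h (tensor R M N x y) = \<beta> x y"
    using h(2)[of "(_, _)"] by (simp add: tensor_def Let_def)
  with h(1) show ?thesis by blast
qed

lemma nonzerodivisors_mult:
  assumes "cring R" "s \<in> nonzerodivisors R" "t \<in> nonzerodivisors R"
  shows "s \<otimes>\<^bsub>R\<^esub> t \<in> nonzerodivisors R"
proof -
  interpret cring R by fact
  have s: "s \<in> carrier R" "\<And>a. \<lbrakk>a \<in> carrier R; s \<otimes>\<^bsub>R\<^esub> a = \<zero>\<^bsub>R\<^esub>\<rbrakk> \<Longrightarrow> a = \<zero>\<^bsub>R\<^esub>"
    and t: "t \<in> carrier R" "\<And>a. \<lbrakk>a \<in> carrier R; t \<otimes>\<^bsub>R\<^esub> a = \<zero>\<^bsub>R\<^esub>\<rbrakk> \<Longrightarrow> a = \<zero>\<^bsub>R\<^esub>"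
    using assms(2,3) unfolding nonzerodivisors_def by blast+
  have "a = \<zero>\<^bsub>R\<^esub>" if a: "a \<in> carrier R" "s \<otimes>\<^bsub>R\<^esub> t \<otimes>\<^bsub>R\<^esub> a = \<zero>\<^bsub>R\<^esub>" for a
  proof (rule t(2)[OF a(1)], rule s(2))
    show "s \<otimes>\<^bsub>R\<^esub> (t \<otimes>\<^bsub>R\<^esub> a) = \<zero>\<^bsub>R\<^esub>" using a s(1) t(1) by (simp add: m_assoc)
  qed (use a(1) t(1) in simp)
  then show ?thesis using s(1) t(1) unfolding nonzerodivisors_def by simp
qed

lemma nonzerodivisors_one:
  assumes "cring R" shows "\<one>\<^bsub>R\<^esub> \<in> nonzerodivisors R"
proof -
  interpret cring R by fact
  show ?thesis by (auto simp: nonzerodivisors_def)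
qed

lemma nonzerodivisors_cancel:
  assumes "cring R" "s \<in> nonzerodivisors R" "a \<in> carrier R" "b \<in> carrier R"
    and "s \<otimes>\<^bsub>R\<^esub> a = s \<otimes>\<^bsub>R\<^esub> b"
  shows "a = b"
proof -
  interpret cring R by fact
  have s: "s \<in> carrier R" using assms(2) by (simp add: nonzerodivisors_def)
  have "s \<otimes>\<^bsub>R\<^esub> (a \<ominus>\<^bsub>R\<^esub> b) = \<zero>\<^bsub>R\<^esub>"
    using assms(3-5) s by (simp add: a_minus_def r_distr r_minus r_neg)
  then have "a \<ominus>\<^bsub>R\<^esub> b = \<zero>\<^bsub>R\<^esub>"
    using assms(2-4) by (simp add: nonzerodivisors_def)
  then show ?thesis using assms(3,4) by simp
qed

context
  fixes R :: "('a, 'x) ring_scheme" (structure)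
  assumes R: "cring R"
begin

interpretation cring R by (rule R)

private abbreviation S where "S \<equiv> nonzerodivisors R"
private abbreviation Q where "Q \<equiv> total_quotient_ring R"
private abbreviation fr where "fr \<equiv> loc_frac R (nonzerodivisors R)"

private lemma S_carrier: "s \<in> S \<Longrightarrow> s \<in> carrier R"
  by (simp add: nonzerodivisors_def)

text \<open>The denominators are nonzerodivisors, so the auxiliary factor in the equivalence of fractions
  cancels.\<close>

private lemma fr_mem:
  assumes "a \<in> carrier R" "s \<in> S"
  shows "(b, t) \<in> fr a s \<longleftrightarrow> b \<in> carrier R \<and> t \<in> S \<and> t \<otimes> a = s \<otimes> b"
proof -
  have "t \<otimes> a = s \<otimes> b" if "u \<in> S" "u \<otimes> (t \<otimes> a) = u \<otimes> (s \<otimes> b)" "b \<in> carrier R" "t \<in> S" for u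
    using nonzerodivisors_cancel[OF R that(1) _ _ that(2)] that S_carrier assms by auto
  then show ?thesis using nonzerodivisors_one[OF R] by (auto simp: loc_frac_def)
qed

private lemma fr_eq_iff:
  assumes "a \<in> carrier R" "s \<in> S" "b \<in> carrier R" "t \<in> S"
  shows "fr a s = fr b t \<longleftrightarrow> t \<otimes> a = s \<otimes> b"
proof
  assume "fr a s = fr b t"
  then show "t \<otimes> a = s \<otimes> b" using fr_mem[OF assms(1,2), of b t] fr_mem[OF assms(3,4), of b t] assms
    by auto
next
  have sub: "fr a s \<subseteq> fr b t" if eq: "t \<otimes> a = s \<otimes> b"
    and ab: "a \<in> carrier R" "s \<in> S" "b \<in> carrier R" "t \<in> S" for a b s t
  proof
    fix z assume z: "z \<in> fr a s"
    obtain c v where [simp]: "z = (c, v)" by (cases z)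
    have c: "c \<in> carrier R" "v \<in> S" "v \<otimes> a = s \<otimes> c" using z fr_mem[OF ab(1,2)] by auto
    note car = ab(1,3) c(1) S_carrier[OF ab(2)] S_carrier[OF ab(4)] S_carrier[OF c(2)]
    have "s \<otimes> (v \<otimes> b) = v \<otimes> (s \<otimes> b)" using car by (simp add: m_ac)
    also have "\<dots> = v \<otimes> (t \<otimes> a)" by (simp add: eq)
    also have "\<dots> = t \<otimes> (v \<otimes> a)" using car by (simp add: m_ac)
    also have "\<dots> = s \<otimes> (t \<otimes> c)" using car by (simp add: c(3) m_ac)
    finally have "v \<otimes> b = t \<otimes> c"
      using nonzerodivisors_cancel[OF R ab(2)] car by auto
    then show "z \<in> fr b t" using c ab by (simp add: fr_mem)
  qed
  assume eq: "t \<otimes> a = s \<otimes> b"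
  show "fr a s = fr b t"
    using sub[OF eq assms] sub[OF eq[symmetric] assms(3,4,1,2)] by blast
qed

private lemma Q_carrier: "carrier Q = {fr a s |a s. a \<in> carrier R \<and> s \<in> S}"
  by (simp add: total_quotient_ring_def localization_def)

private lemma Q_add:
  assumes "a \<in> carrier R" "s \<in> S" "b \<in> carrier R" "t \<in> S"
  shows "fr a s \<oplus>\<^bsub>Q\<^esub> fr b t = fr (t \<otimes> a \<oplus> s \<otimes> b) (s \<otimes> t)"
proof -
  have *: "fr (t' \<otimes> a' \<oplus> s' \<otimes> b') (s' \<otimes> t') = fr (t \<otimes> a \<oplus> s \<otimes> b) (s \<otimes> t)"
    if "(a', s') \<in> fr a s" "(b', t') \<in> fr b t" for a' s' b' t'
  proof -
    have a': "a' \<in> carrier R" "s' \<in> S" "s' \<otimes> a = s \<otimes> a'"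
      and b': "b' \<in> carrier R" "t' \<in> S" "t' \<otimes> b = t \<otimes> b'"
      using that fr_mem assms by auto
    note car = assms(1,3) a'(1) b'(1) S_carrier[OF assms(2)] S_carrier[OF assms(4)]
      S_carrier[OF a'(2)] S_carrier[OF b'(2)]
    have "(s \<otimes> t) \<otimes> (t' \<otimes> a' \<oplus> s' \<otimes> b') = t \<otimes> t' \<otimes> (s \<otimes> a') \<oplus> s \<otimes> s' \<otimes> (t \<otimes> b')"
      using car by (simp add: r_distr m_ac)
    also have "\<dots> = t \<otimes> t' \<otimes> (s' \<otimes> a) \<oplus> s \<otimes> s' \<otimes> (t' \<otimes> b)" by (simp add: a'(3) b'(3))
    also have "\<dots> = (s' \<otimes> t') \<otimes> (t \<otimes> a \<oplus> s \<otimes> b)"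
      using car by (simp add: r_distr m_ac)
    finally show ?thesis
      by (subst fr_eq_iff) (use car assms a' b' nonzerodivisors_mult[OF R] in auto)
  qed
  have "(a, s) \<in> fr a s" "(b, t) \<in> fr b t" using fr_mem assms by auto
  then have "(\<Union>(a', s')\<in>fr a s. \<Union>(b', t')\<in>fr b t. fr (t' \<otimes> a' \<oplus> s' \<otimes> b') (s' \<otimes> t')) =
      fr (t \<otimes> a \<oplus> s \<otimes> b) (s \<otimes> t)"
    using * by blast
  then show ?thesis by (simp add: total_quotient_ring_def localization_def)
qed

private lemma Q_smult:
  assumes "c \<in> carrier R" "a \<in> carrier R" "s \<in> S"
  shows "c \<odot>\<^bsub>Q\<^esub> fr a s = fr (c \<otimes> a) s"
proof -
  have *: "fr (c \<otimes> a') s' = fr (c \<otimes> a) s" if "(a', s') \<in> fr a s" for a' s'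
  proof -
    have a': "a' \<in> carrier R" "s' \<in> S" "s' \<otimes> a = s \<otimes> a'" using that fr_mem assms by auto
    note car = assms(1,2) a'(1) S_carrier[OF assms(3)] S_carrier[OF a'(2)]
    have "s \<otimes> (c \<otimes> a') = c \<otimes> (s \<otimes> a')" using car by (simp add: m_ac)
    also have "\<dots> = s' \<otimes> (c \<otimes> a)" using car by (simp add: a'(3)[symmetric] m_ac)
    finally show ?thesis by (subst fr_eq_iff) (use car assms a' in auto)
  qed
  have "(a, s) \<in> fr a s" using fr_mem assms by auto
  then have "(\<Union>(a', s')\<in>fr a s. fr (c \<otimes> a') s') = fr (c \<otimes> a) s" using * by blast
  then show ?thesis by (simp add: total_quotient_ring_def localization_def)
qed

private lemma Q_zero: "\<zero>\<^bsub>Q\<^esub> = fr \<zero> \<one>" and Q_one: "\<one>\<^bsub>Q\<^esub> = fr \<one> \<one>"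
  by (simp_all add: total_quotient_ring_def localization_def)

lemma total_quotient_ring_module: "module R Q"
proof -
  note S1 = nonzerodivisors_one[OF R] and Sm = nonzerodivisors_mult[OF R]
  note ops = Q_add Q_smult Q_zero fr_eq_iff S1 Sm S_carrier
  have elim: "\<exists>a s. a \<in> carrier R \<and> s \<in> S \<and> A = fr a s" if "A \<in> carrier Q" for A
    using that by (auto simp: Q_carrier)
  have frc: "fr a s \<in> carrier Q" if "a \<in> carrier R" "s \<in> S" for a s
    using that by (auto simp: Q_carrier)
  show ?thesis
  proof (rule moduleI)
    show "abelian_group Q"
    proof (rule abelian_groupI)
      fix A B assume "A \<in> carrier Q" "B \<in> carrier Q"
      then obtain a s b t where *: "a \<in> carrier R" "s \<in> S" "b \<in> carrier R" "t \<in> S"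
        "A = fr a s" "B = fr b t" using elim by meson
      show "A \<oplus>\<^bsub>Q\<^esub> B \<in> carrier Q" using * by (simp add: ops frc)
      show "A \<oplus>\<^bsub>Q\<^esub> B = B \<oplus>\<^bsub>Q\<^esub> A"
        using * by (simp add: ops m_comm a_comm)
      fix C assume "C \<in> carrier Q"
      then obtain c v where **: "c \<in> carrier R" "v \<in> S" "C = fr c v" using elim by meson
      show "A \<oplus>\<^bsub>Q\<^esub> B \<oplus>\<^bsub>Q\<^esub> C = A \<oplus>\<^bsub>Q\<^esub> (B \<oplus>\<^bsub>Q\<^esub> C)"
        using * ** by (simp add: ops r_distr m_ac a_ac)
    next
      fix A assume "A \<in> carrier Q"
      then obtain a s where *: "a \<in> carrier R" "s \<in> S" "A = fr a s" using elim by meson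
      show "\<zero>\<^bsub>Q\<^esub> \<oplus>\<^bsub>Q\<^esub> A = A" using * by (simp add: ops)
      have "fr (\<ominus> a) s \<oplus>\<^bsub>Q\<^esub> A = \<zero>\<^bsub>Q\<^esub>"
        using * by (simp add: ops r_minus l_neg)
      then show "\<exists>B\<in>carrier Q. B \<oplus>\<^bsub>Q\<^esub> A = \<zero>\<^bsub>Q\<^esub>" using * frc by blast
    qed (simp add: Q_zero frc S1)
  next
    fix c A assume c: "c \<in> carrier R" and "A \<in> carrier Q"
    then obtain a s where *: "a \<in> carrier R" "s \<in> S" "A = fr a s" using elim by meson
    show "c \<odot>\<^bsub>Q\<^esub> A \<in> carrier Q" using * c by (simp add: ops frc)
    {
      fix e assume e: "e \<in> carrier R"
      show "(c \<oplus> e) \<odot>\<^bsub>Q\<^esub> A = c \<odot>\<^bsub>Q\<^esub> A \<oplus>\<^bsub>Q\<^esub> e \<odot>\<^bsub>Q\<^esub> A"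
        using * c e by (simp add: ops r_distr l_distr m_ac)
      show "(c \<otimes> e) \<odot>\<^bsub>Q\<^esub> A = c \<odot>\<^bsub>Q\<^esub> (e \<odot>\<^bsub>Q\<^esub> A)"
        using * c e by (simp add: ops m_ac)
    next
      fix B assume "B \<in> carrier Q"
      then obtain b t where "b \<in> carrier R" "t \<in> S" "B = fr b t" using elim by meson
      then show "c \<odot>\<^bsub>Q\<^esub> (A \<oplus>\<^bsub>Q\<^esub> B) = c \<odot>\<^bsub>Q\<^esub> A \<oplus>\<^bsub>Q\<^esub> c \<odot>\<^bsub>Q\<^esub> B"
        using * c by (simp add: ops r_distr m_ac)
    }
  next
    fix A assume "A \<in> carrier Q"
    then obtain a s where *: "a \<in> carrier R" "s \<in> S" "A = fr a s" using elim by meson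
    then show "\<one> \<odot>\<^bsub>Q\<^esub> A = A" by (simp add: ops)
  qed (rule R)
qed

text \<open>Torsion sees the total quotient ring only through its unit, which is divisible by every
  nonzerodivisor and is killed by no nonzero ring element.\<close>

lemma total_quotient_one_closed: "\<one>\<^bsub>Q\<^esub> \<in> carrier Q"
  unfolding Q_one Q_carrier using nonzerodivisors_one[OF R] by blast

lemma total_quotient_one_divisible:
  assumes "s \<in> nonzerodivisors R"
  shows "\<exists>u\<in>carrier Q. s \<odot>\<^bsub>Q\<^esub> u = \<one>\<^bsub>Q\<^esub>"
proof (rule bexI)
  show "s \<odot>\<^bsub>Q\<^esub> fr \<one> s = \<one>\<^bsub>Q\<^esub>"
    using assms S_carrier nonzerodivisors_one[OF R] by (simp add: Q_one Q_smult fr_eq_iff)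
  show "fr \<one> s \<in> carrier Q" using assms by (auto simp: Q_carrier)
qed

lemma total_quotient_one_faithful:
  assumes "a \<in> carrier R" "a \<odot>\<^bsub>Q\<^esub> \<one>\<^bsub>Q\<^esub> = \<zero>\<^bsub>Q\<^esub>"
  shows "a = \<zero>"
  using assms nonzerodivisors_one[OF R] by (simp add: Q_one Q_zero Q_smult fr_eq_iff)

end

text \<open>If \<open>1 = s u\<close> in the total quotient ring, then \<open>1 \<otimes> x = u \<otimes> s x = 0\<close>.\<close>

lemma torsion_if_killed_by_nonzerodivisor:
  assumes N: "module R N" and x: "x \<in> carrier N"
    and s: "s \<in> nonzerodivisors R" "s \<odot>\<^bsub>N\<^esub> x = \<zero>\<^bsub>N\<^esub>"
  shows "x \<in> torsion_submodule R N"
proof -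
  interpret N: module R N by fact
  have R: "cring R" by (rule N.is_cring)
  let ?Q = "total_quotient_ring R"
  have Q: "module R ?Q" by (rule total_quotient_ring_module[OF R])
  interpret T: module R "tensor_prod R ?Q N" by (rule tensor_prod_module[OF Q N])
  have sc: "s \<in> carrier R" using s(1) by (simp add: nonzerodivisors_def)
  obtain u where u: "u \<in> carrier ?Q" "s \<odot>\<^bsub>?Q\<^esub> u = \<one>\<^bsub>?Q\<^esub>"
    using total_quotient_one_divisible[OF R s(1)] by blast
  have "tensor R ?Q N \<one>\<^bsub>?Q\<^esub> x = tensor R ?Q N u (s \<odot>\<^bsub>N\<^esub> x)"
    unfolding u(2)[symmetric] using tensor_smult_middle[OF Q N sc u(1) x] by simp
  also have "\<dots> = tensor R ?Q N u (\<zero>\<^bsub>R\<^esub> \<odot>\<^bsub>N\<^esub> x)" using s(2) x by simp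
  also have "\<dots> = \<zero>\<^bsub>tensor_prod R ?Q N\<^esub>"
    by (subst tensor_smult_middle(2)[OF Q N _ u(1) x])
       (use tensor_closed[OF Q u(1) x] in simp_all)
  finally show ?thesis using x by (simp add: torsion_submodule_def Let_def)
qed

text \<open>A functional \<open>\<phi>\<close> on \<open>N\<close> induces the map \<open>A \<otimes> y \<mapsto> \<phi> y A\<close> into the total quotient ring, which
  contains the ring and sees \<open>\<phi> x\<close> as the image of \<open>1 \<otimes> x\<close>. For tensor powers of \<open>M\<close> the functionals
  are numerous enough to bound the torsion in this way.\<close>

lemma functional_vanishes_on_torsion:
  assumes N: "module R N" and x: "x \<in> torsion_submodule R N"
    and \<phi>: "linear_map R N (self_module R) \<phi>"
  shows "\<phi> x = \<zero>\<^bsub>R\<^esub>"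
proof -
  interpret N: module R N by fact
  have R: "cring R" by (rule N.is_cring)
  let ?Q = "total_quotient_ring R"
  have Q: "module R ?Q" by (rule total_quotient_ring_module[OF R])
  interpret Q: module R ?Q by (rule Q)
  have xc: "x \<in> carrier N" and x0: "tensor R ?Q N \<one>\<^bsub>?Q\<^esub> x = \<zero>\<^bsub>tensor_prod R ?Q N\<^esub>"
    using x by (auto simp: torsion_submodule_def Let_def)
  have cl: "\<And>y. y \<in> carrier N \<Longrightarrow> \<phi> y \<in> carrier R" using linear_map_closed[OF \<phi>] by simp
  have swap: "c \<odot>\<^bsub>?Q\<^esub> (e \<odot>\<^bsub>?Q\<^esub> A) = e \<odot>\<^bsub>?Q\<^esub> (c \<odot>\<^bsub>?Q\<^esub> A)"
    if "c \<in> carrier R" "e \<in> carrier R" "A \<in> carrier ?Q" for c e A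
    using that by (metis N.m_comm Q.smult_assoc1)
  have "\<exists>h. linear_map R (tensor_prod R ?Q N) ?Q h \<and>
      (\<forall>A\<in>carrier ?Q. \<forall>y\<in>carrier N. h (tensor R ?Q N A y) = \<phi> y \<odot>\<^bsub>?Q\<^esub> A)"
    by (rule tensor_prod_universal[OF Q N Q, where \<beta> = "\<lambda>A y. \<phi> y \<odot>\<^bsub>?Q\<^esub> A"])
       (simp_all add: cl linear_map_add[OF \<phi>] linear_map_smult[OF \<phi>] Q.smult_l_distr
         Q.smult_r_distr Q.smult_assoc1 swap)
  then obtain h where h: "linear_map R (tensor_prod R ?Q N) ?Q h"
    "\<And>A y. \<lbrakk>A \<in> carrier ?Q; y \<in> carrier N\<rbrakk> \<Longrightarrow> h (tensor R ?Q N A y) = \<phi> y \<odot>\<^bsub>?Q\<^esub> A"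
    by blast
  have "\<phi> x \<odot>\<^bsub>?Q\<^esub> \<one>\<^bsub>?Q\<^esub> = \<zero>\<^bsub>?Q\<^esub>"
    using h(2)[OF total_quotient_one_closed[OF R] xc] x0
      linear_map_zero[OF h(1) tensor_prod_module[OF Q N] Q] by simp
  then show ?thesis using total_quotient_one_faithful[OF R] cl[OF xc] by blast
qed

lemma zero_in_torsion_submodule:
  assumes "module R N" shows "\<zero>\<^bsub>N\<^esub> \<in> torsion_submodule R N"
proof -
  interpret N: module R N by fact
  show ?thesis
    by (rule torsion_if_killed_by_nonzerodivisor[OF assms _ nonzerodivisors_one[OF N.is_cring]])
       simp_all
qed

section \<open>Tensor powers\<close>

(* Index sets are written {1..n} throughout; the simplifier must not turn them into {Suc 0..n}. *)
declare One_nat_def [simp del]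

definition multilinear ::
    "('a, 'x) ring_scheme \<Rightarrow> ('a, 'b) module \<Rightarrow> nat \<Rightarrow> ('a, 'c) module
       \<Rightarrow> ((nat \<Rightarrow> 'b) \<Rightarrow> 'c) \<Rightarrow> bool" where
  "multilinear R M n P \<beta> \<longleftrightarrow>
     (\<forall>x\<in>{1..n} \<rightarrow>\<^sub>E carrier M. \<beta> x \<in> carrier P) \<and>
     (\<forall>x\<in>{1..n} \<rightarrow>\<^sub>E carrier M. \<forall>i\<in>{1..n}. linear_map R M P (\<lambda>u. \<beta> (x(i := u))))"

lemma PiE_upd:
  assumes "x \<in> I \<rightarrow>\<^sub>E A" "i \<in> I" "u \<in> A" shows "x(i := u) \<in> I \<rightarrow>\<^sub>E A"
  using assms by (auto simp: PiE_def Pi_def extensional_def)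

lemma tensor_power_rels_closed:
  assumes "module R M"
  shows "tensor_power_rels R M n \<subseteq> carrier (free_module R ({1..n} \<rightarrow>\<^sub>E carrier M))"
proof -
  interpret M: module R M by fact
  let ?X = "{1..n} \<rightarrow>\<^sub>E carrier M"
  interpret F: module R "free_module R ?X" by (rule free_is_module[OF M.is_cring])
  have "basis_vec R (x(i := u)) \<in> carrier (free_module R ?X)"
    if "x \<in> ?X" "i \<in> {1..n}" "u \<in> carrier M" for x i u
    by (rule basis_vec_closed[OF M.is_cring PiE_upd[OF that]])
  then show ?thesis
    unfolding tensor_power_rels_def Let_def
    by (auto intro!: F.minus_closed F.a_closed F.smult_closed)
qed

lemma tensor_power_module:
  assumes "module R M"
  shows "module R (tensor_power R M n)"
proof -
  interpret M: module R M by fact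
  show ?thesis
    unfolding tensor_power_def Let_def
    by (intro quot_is_module gen_submodule_submodule tensor_power_rels_closed free_is_module
        M.is_cring assms)
qed

lemma pure_tensor_multilinear:
  assumes M: "module R M"
  shows "multilinear R M n (tensor_power R M n) (pure_tensor R M n)"
proof -
  interpret M: module R M by fact
  let ?X = "{1..n} \<rightarrow>\<^sub>E carrier M"
  let ?F = "free_module R ?X"
  let ?rels = "tensor_power_rels R M n"
  let ?G = "gen_submodule R ?F ?rels"
  have F: "module R ?F" by (rule free_is_module[OF M.is_cring])
  interpret F: module R ?F by (rule F)
  have G: "submodule ?G R ?F" by (rule gen_submodule_submodule[OF F tensor_power_rels_closed[OF M]])
  have e: "basis_vec R x \<in> carrier ?F" if "x \<in> ?X" for x
    by (rule basis_vec_closed[OF M.is_cring that])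
  have p: "pure_tensor R M n x = ?G +>\<^bsub>?F\<^esub> basis_vec R x" if "x \<in> ?X" for x
    by (simp only: pure_tensor_def Let_def PiE_restrict[OF that])
  have closed: "pure_tensor R M n x \<in> carrier (tensor_power R M n)" if "x \<in> ?X" for x
    unfolding p[OF that] tensor_power_def Let_def quot_carrier using e[OF that] by (rule imageI)
  have "linear_map R M (tensor_power R M n) (\<lambda>u. pure_tensor R M n (x(i := u)))"
    if x: "x \<in> ?X" and i: "i \<in> {1..n}" for x i
  proof (rule linear_mapI)
    fix u assume u: "u \<in> carrier M"
    note xu = PiE_upd[OF x i u]
    show "pure_tensor R M n (x(i := u)) \<in> carrier (tensor_power R M n)" by (rule closed[OF xu])
    {
      fix v assume v: "v \<in> carrier M"
      have "basis_vec R (x(i := u \<oplus>\<^bsub>M\<^esub> v)) \<ominus>\<^bsub>?F\<^esub>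
          (basis_vec R (x(i := u)) \<oplus>\<^bsub>?F\<^esub> basis_vec R (x(i := v))) \<in> ?rels"
        unfolding tensor_power_rels_def Let_def
        by (rule UnI1, rule CollectI, intro exI conjI, rule refl) (use x i u v in auto)
      then have "basis_vec R (x(i := u \<oplus>\<^bsub>M\<^esub> v)) \<ominus>\<^bsub>?F\<^esub>
          (basis_vec R (x(i := u)) \<oplus>\<^bsub>?F\<^esub> basis_vec R (x(i := v))) \<in> ?G"
        by (rule subsetD[OF gen_submodule_superset])
      moreover have "u \<oplus>\<^bsub>M\<^esub> v \<in> carrier M" using u v by simp
      note xuv = PiE_upd[OF x i this] and xv = PiE_upd[OF x i v]
      ultimately show "pure_tensor R M n (x(i := u \<oplus>\<^bsub>M\<^esub> v)) =
          pure_tensor R M n (x(i := u)) \<oplus>\<^bsub>tensor_power R M n\<^esub> pure_tensor R M n (x(i := v))"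
        by (simp add: p[OF xu] p[OF xv] p[OF xuv] tensor_power_def Let_def
            quot_add[OF F G e[OF xu] e[OF xv]]
            coset_eq_iff[OF F G e[OF xuv] F.a_closed[OF e[OF xu] e[OF xv]]])
    next
      fix a assume a: "a \<in> carrier R"
      have "basis_vec R (x(i := a \<odot>\<^bsub>M\<^esub> u)) \<ominus>\<^bsub>?F\<^esub> a \<odot>\<^bsub>?F\<^esub> basis_vec R (x(i := u)) \<in> ?rels"
        unfolding tensor_power_rels_def Let_def
        by (rule UnI2, rule CollectI, intro exI conjI, rule refl) (use x i u a in auto)
      then have "basis_vec R (x(i := a \<odot>\<^bsub>M\<^esub> u)) \<ominus>\<^bsub>?F\<^esub> a \<odot>\<^bsub>?F\<^esub> basis_vec R (x(i := u)) \<in> ?G"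
        by (rule subsetD[OF gen_submodule_superset])
      moreover have "a \<odot>\<^bsub>M\<^esub> u \<in> carrier M" using u a by simp
      note xau = PiE_upd[OF x i this]
      ultimately show "pure_tensor R M n (x(i := a \<odot>\<^bsub>M\<^esub> u)) =
          a \<odot>\<^bsub>tensor_power R M n\<^esub> pure_tensor R M n (x(i := u))"
        by (simp add: p[OF xu] p[OF xau] tensor_power_def Let_def
            quot_smult[OF F G a e[OF xu]]
            coset_eq_iff[OF F G e[OF xau] F.smult_closed[OF a e[OF xu]]])
    }
  qed
  with closed show ?thesis unfolding multilinear_def by blast
qed

lemma pure_tensor_closed:
  assumes "module R M" "x \<in> {1..n} \<rightarrow>\<^sub>E carrier M"
  shows "pure_tensor R M n x \<in> carrier (tensor_power R M n)"
  using pure_tensor_multilinear[OF assms(1), of n] assms(2) unfolding multilinear_def by blast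

lemma pure_tensor_slot_linear:
  assumes "module R M" "x \<in> {1..n} \<rightarrow>\<^sub>E carrier M" "i \<in> {1..n}"
  shows "linear_map R M (tensor_power R M n) (\<lambda>u. pure_tensor R M n (x(i := u)))"
  using pure_tensor_multilinear[OF assms(1), of n] assms(2,3) unfolding multilinear_def by blast

lemma pure_tensor_cong:
  assumes "\<And>i. i \<in> {1..n} \<Longrightarrow> x i = y i"
  shows "pure_tensor R M n x = pure_tensor R M n y"
proof -
  have "restrict x {1..n} = restrict y {1..n}" using assms by (auto simp: restrict_def)
  then show ?thesis by (simp add: pure_tensor_def)
qed

lemma tensor_power_universal:
  assumes M: "module R M" and P: "module R P" and \<beta>: "multilinear R M n P \<beta>"
  shows "\<exists>h. linear_map R (tensor_power R M n) P h \<and>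
    (\<forall>x\<in>{1..n} \<rightarrow>\<^sub>E carrier M. h (pure_tensor R M n x) = \<beta> x)"
proof -
  interpret M: module R M by (rule M)
  interpret P: module R P by (rule P)
  let ?X = "{1..n} \<rightarrow>\<^sub>E carrier M"
  let ?F = "free_module R ?X"
  let ?rels = "tensor_power_rels R M n"
  have F: "module R ?F" by (rule free_is_module[OF M.is_cring])
  interpret F: module R ?F by (rule F)
  have \<beta>c: "\<And>x. x \<in> ?X \<Longrightarrow> \<beta> x \<in> carrier P" using \<beta> unfolding multilinear_def by blast
  have \<beta>l: "linear_map R M P (\<lambda>u. \<beta> (x(i := u)))" if "x \<in> ?X" "i \<in> {1..n}" for x i
    using \<beta> that unfolding multilinear_def by blast
  have e: "basis_vec R x \<in> carrier ?F" if "x \<in> ?X" for x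
    by (rule basis_vec_closed[OF M.is_cring that])
  have m: "u \<ominus>\<^bsub>P\<^esub> u = \<zero>\<^bsub>P\<^esub>" if "u \<in> carrier P" for u
    using module_diff_eq_zero_iff[OF P that that] by simp
  have "\<exists>h. linear_map R (quot_module ?F (gen_submodule R ?F ?rels)) P h \<and>
    (\<forall>x\<in>?X. h (gen_submodule R ?F ?rels +>\<^bsub>?F\<^esub> basis_vec R x) = \<beta> x)"
  proof (rule presented_universal[OF P \<beta>c tensor_power_rels_closed[OF M]])
    fix f s
    assume f: "linear_map R ?F P f" and f\<beta>: "\<And>x. x \<in> ?X \<Longrightarrow> f (basis_vec R x) = \<beta> x"
      and s: "s \<in> ?rels"
    from s consider
      x i u v where "s = basis_vec R (x(i := u \<oplus>\<^bsub>M\<^esub> v)) \<ominus>\<^bsub>?F\<^esub>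
          (basis_vec R (x(i := u)) \<oplus>\<^bsub>?F\<^esub> basis_vec R (x(i := v)))"
        "x \<in> ?X" "i \<in> {1..n}" "u \<in> carrier M" "v \<in> carrier M"
    | x i a u where "s = basis_vec R (x(i := a \<odot>\<^bsub>M\<^esub> u)) \<ominus>\<^bsub>?F\<^esub> a \<odot>\<^bsub>?F\<^esub> basis_vec R (x(i := u))"
        "x \<in> ?X" "i \<in> {1..n}" "a \<in> carrier R" "u \<in> carrier M"
      unfolding tensor_power_rels_def Let_def
      by (elim UnE CollectE exE conjE) (rule that; assumption)+
    then show "f s = \<zero>\<^bsub>P\<^esub>"
    proof cases
      case 1
      have "u \<oplus>\<^bsub>M\<^esub> v \<in> carrier M" using 1 by simp
      note xuv = PiE_upd[OF 1(2,3) this] and xu = PiE_upd[OF 1(2,3,4)] and xv = PiE_upd[OF 1(2,3,5)]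
      have "f s = \<beta> (x(i := u \<oplus>\<^bsub>M\<^esub> v)) \<ominus>\<^bsub>P\<^esub> (\<beta> (x(i := u)) \<oplus>\<^bsub>P\<^esub> \<beta> (x(i := v)))"
        unfolding 1(1) f\<beta>[OF xuv, symmetric] f\<beta>[OF xu, symmetric] f\<beta>[OF xv, symmetric]
        by (simp add: linear_map_diff[OF f F P] linear_map_add[OF f] e[OF xuv] e[OF xu] e[OF xv])
      also have "\<dots> = \<zero>\<^bsub>P\<^esub>"
        unfolding linear_map_add[OF \<beta>l[OF 1(2,3)] 1(4,5)]
        by (rule m) (use \<beta>c[OF xu] \<beta>c[OF xv] in simp)
      finally show ?thesis .
    next
      case 2
      have "a \<odot>\<^bsub>M\<^esub> u \<in> carrier M" using 2 by simp
      note xau = PiE_upd[OF 2(2,3) this] and xu = PiE_upd[OF 2(2,3,5)]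
      have "f s = \<beta> (x(i := a \<odot>\<^bsub>M\<^esub> u)) \<ominus>\<^bsub>P\<^esub> a \<odot>\<^bsub>P\<^esub> \<beta> (x(i := u))"
        unfolding 2(1) f\<beta>[OF xau, symmetric] f\<beta>[OF xu, symmetric]
        by (simp add: linear_map_diff[OF f F P] linear_map_smult[OF f] e[OF xau] e[OF xu] 2(4))
      also have "\<dots> = \<zero>\<^bsub>P\<^esub>"
        unfolding linear_map_smult[OF \<beta>l[OF 2(2,3)] 2(4,5)]
        by (rule m) (use \<beta>c[OF xu] 2(4) in simp)
      finally show ?thesis .
    qed
  qed
  then obtain h where h: "linear_map R (tensor_power R M n) P h"
    "\<And>x. x \<in> ?X \<Longrightarrow> h (gen_submodule R ?F ?rels +>\<^bsub>?F\<^esub> basis_vec R x) = \<beta> x"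
    unfolding tensor_power_def Let_def by blast
  have "\<forall>x\<in>?X. h (pure_tensor R M n x) = \<beta> x"
  proof
    fix x assume x: "x \<in> ?X"
    show "h (pure_tensor R M n x) = \<beta> x"
      using h(2)[OF x] by (simp only: pure_tensor_def Let_def PiE_restrict[OF x])
  qed
  with h(1) show ?thesis by blast
qed

lemma tensor_power_induct [consumes 2, case_names zero step]:
  assumes M: "module R M" and t: "t \<in> carrier (tensor_power R M n)"
    and zero: "P \<zero>\<^bsub>tensor_power R M n\<^esub>"
    and step: "\<And>u a x. \<lbrakk>u \<in> carrier (tensor_power R M n); P u; a \<in> carrier R;
        x \<in> {1..n} \<rightarrow>\<^sub>E carrier M\<rbrakk>
      \<Longrightarrow> P (u \<oplus>\<^bsub>tensor_power R M n\<^esub> a \<odot>\<^bsub>tensor_power R M n\<^esub> pure_tensor R M n x)"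
  shows "P t"
proof -
  interpret M: module R M by (rule M)
  let ?F = "free_module R ({1..n} \<rightarrow>\<^sub>E carrier M)"
  let ?G = "gen_submodule R ?F (tensor_power_rels R M n)"
  let ?Q = "quot_module ?F ?G"
  show ?thesis
  proof (rule presented_induct[OF M.is_cring tensor_power_rels_closed[OF M], of t n P])
    show "t \<in> carrier ?Q"
      using t by (simp add: tensor_power_def Let_def)
    show "P \<zero>\<^bsub>?Q\<^esub>"
      using zero by (simp add: tensor_power_def Let_def)
  next
    fix u a x
    assume *: "u \<in> carrier ?Q"
      "P u" "a \<in> carrier R" and x: "x \<in> {1..n} \<rightarrow>\<^sub>E carrier M"
    show "P (u \<oplus>\<^bsub>?Q\<^esub> a \<odot>\<^bsub>?Q\<^esub> (?G +>\<^bsub>?F\<^esub> basis_vec R x))"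
      using step[of u a x] * x
      by (simp only: tensor_power_def pure_tensor_def Let_def PiE_restrict[OF x])
  qed
qed

text \<open>Pure tensors generate, so two linear maps that agree on them are equal.\<close>

lemma tensor_power_ext:
  assumes M: "module R M" and P: "module R P"
    and f: "linear_map R (tensor_power R M n) P f" and g: "linear_map R (tensor_power R M n) P g"
    and eq: "\<And>x. x \<in> {1..n} \<rightarrow>\<^sub>E carrier M \<Longrightarrow> f (pure_tensor R M n x) = g (pure_tensor R M n x)"
    and t: "t \<in> carrier (tensor_power R M n)"
  shows "f t = g t"
  using M t
proof (induction rule: tensor_power_induct)
  case zero
  show ?case
    using linear_map_zero[OF f tensor_power_module[OF M] P]
      linear_map_zero[OF g tensor_power_module[OF M] P] by simp
next
  case (step u a x)
  interpret T: module R "tensor_power R M n" by (rule tensor_power_module[OF M])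
  note p = pure_tensor_closed[OF M step.hyps(3)]
  show ?case
    using step.hyps step.IH p eq[OF step.hyps(3)]
    by (simp add: linear_map_add[OF f] linear_map_add[OF g] linear_map_smult[OF f]
        linear_map_smult[OF g])
qed

section \<open>The cokernel of a sequence and its tensor powers\<close>

definition lincomb :: "('a, 'b) module \<Rightarrow> 'i set \<Rightarrow> ('i \<Rightarrow> 'a) \<Rightarrow> ('i \<Rightarrow> 'b) \<Rightarrow> 'b" where
  "lincomb P I a p = (\<Oplus>\<^bsub>P\<^esub>i\<in>I. a i \<odot>\<^bsub>P\<^esub> p i)"

lemma lincomb_closed:
  assumes "module R P" "\<And>i. i \<in> I \<Longrightarrow> a i \<in> carrier R" "\<And>i. i \<in> I \<Longrightarrow> p i \<in> carrier P"
  shows "lincomb P I a p \<in> carrier P"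
proof -
  interpret P: module R P by (rule assms(1))
  show ?thesis unfolding lincomb_def by (rule P.finsum_closed) (use assms(2,3) in auto)
qed

lemma lincomb_cong:
  assumes "module R P" "\<And>i. i \<in> I \<Longrightarrow> b i \<in> carrier R" "\<And>i. i \<in> I \<Longrightarrow> q i \<in> carrier P"
    and "\<And>i. i \<in> I \<Longrightarrow> a i = b i" "\<And>i. i \<in> I \<Longrightarrow> p i = q i"
  shows "lincomb P I a p = lincomb P I b q"
proof -
  interpret P: module R P by (rule assms(1))
  show ?thesis
    unfolding lincomb_def by (rule P.finsum_cong'[OF refl]) (use assms(2-5) in auto)
qed

lemma linear_map_lincomb_image:
  assumes f: "linear_map R P N f" and P: "module R P" and N: "module R N" and "finite I"
    and "\<And>i. i \<in> I \<Longrightarrow> a i \<in> carrier R" "\<And>i. i \<in> I \<Longrightarrow> p i \<in> carrier P"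
  shows "f (lincomb P I a p) = lincomb N I a (\<lambda>i. f (p i))"
proof -
  interpret P: module R P by (rule P)
  interpret N: module R N by (rule N)
  have "f (lincomb P I a p) = (\<Oplus>\<^bsub>N\<^esub>i\<in>I. f (a i \<odot>\<^bsub>P\<^esub> p i))"
    unfolding lincomb_def by (rule linear_map_finsum[OF f P N]) (use assms(4-6) in auto)
  also have "\<dots> = lincomb N I a (\<lambda>i. f (p i))"
    unfolding lincomb_def
    by (rule N.finsum_cong'[OF refl])
       (use assms(5,6) linear_map_closed[OF f] linear_map_smult[OF f] in auto)
  finally show ?thesis .
qed

lemma lincomb_add_left:
  assumes "module R P" "\<And>i. i \<in> I \<Longrightarrow> a i \<in> carrier R" "\<And>i. i \<in> I \<Longrightarrow> b i \<in> carrier R"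
    "\<And>i. i \<in> I \<Longrightarrow> p i \<in> carrier P"
  shows "lincomb P I (\<lambda>i. a i \<oplus>\<^bsub>R\<^esub> b i) p = lincomb P I a p \<oplus>\<^bsub>P\<^esub> lincomb P I b p"
proof -
  interpret P: module R P by (rule assms(1))
  have "lincomb P I (\<lambda>i. a i \<oplus>\<^bsub>R\<^esub> b i) p = (\<Oplus>\<^bsub>P\<^esub>i\<in>I. a i \<odot>\<^bsub>P\<^esub> p i \<oplus>\<^bsub>P\<^esub> b i \<odot>\<^bsub>P\<^esub> p i)"
    unfolding lincomb_def
    by (rule P.finsum_cong'[OF refl]) (use assms(2-4) P.smult_l_distr in auto)
  also have "\<dots> = lincomb P I a p \<oplus>\<^bsub>P\<^esub> lincomb P I b p"
    unfolding lincomb_def by (rule P.finsum_addf) (use assms(2-4) in auto)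
  finally show ?thesis .
qed

lemma lincomb_add_right:
  assumes "module R P" "\<And>i. i \<in> I \<Longrightarrow> a i \<in> carrier R" "\<And>i. i \<in> I \<Longrightarrow> p i \<in> carrier P"
    "\<And>i. i \<in> I \<Longrightarrow> q i \<in> carrier P"
  shows "lincomb P I a (\<lambda>i. p i \<oplus>\<^bsub>P\<^esub> q i) = lincomb P I a p \<oplus>\<^bsub>P\<^esub> lincomb P I a q"
proof -
  interpret P: module R P by (rule assms(1))
  have "lincomb P I a (\<lambda>i. p i \<oplus>\<^bsub>P\<^esub> q i) = (\<Oplus>\<^bsub>P\<^esub>i\<in>I. a i \<odot>\<^bsub>P\<^esub> p i \<oplus>\<^bsub>P\<^esub> a i \<odot>\<^bsub>P\<^esub> q i)"
    unfolding lincomb_def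
    by (rule P.finsum_cong'[OF refl]) (use assms(2-4) P.smult_r_distr in auto)
  also have "\<dots> = lincomb P I a p \<oplus>\<^bsub>P\<^esub> lincomb P I a q"
    unfolding lincomb_def by (rule P.finsum_addf) (use assms(2-4) in auto)
  finally show ?thesis .
qed

lemma lincomb_smult_left:
  assumes "module R P" "finite I" "c \<in> carrier R" "\<And>i. i \<in> I \<Longrightarrow> a i \<in> carrier R"
    "\<And>i. i \<in> I \<Longrightarrow> p i \<in> carrier P"
  shows "lincomb P I (\<lambda>i. c \<otimes>\<^bsub>R\<^esub> a i) p = c \<odot>\<^bsub>P\<^esub> lincomb P I a p"
proof -
  interpret P: module R P by (rule assms(1))
  have "lincomb P I (\<lambda>i. c \<otimes>\<^bsub>R\<^esub> a i) p = (\<Oplus>\<^bsub>P\<^esub>i\<in>I. c \<odot>\<^bsub>P\<^esub> (a i \<odot>\<^bsub>P\<^esub> p i))"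
    unfolding lincomb_def
    by (rule P.finsum_cong'[OF refl]) (use assms(3-5) P.smult_assoc1 in auto)
  also have "\<dots> = c \<odot>\<^bsub>P\<^esub> lincomb P I a p"
    unfolding lincomb_def by (rule P.finsum_smult_ldistr[symmetric]) (use assms(2-5) in auto)
  finally show ?thesis .
qed

lemma lincomb_smult_right:
  assumes "module R P" "finite I" "c \<in> carrier R" "\<And>i. i \<in> I \<Longrightarrow> a i \<in> carrier R"
    "\<And>i. i \<in> I \<Longrightarrow> p i \<in> carrier P"
  shows "lincomb P I a (\<lambda>i. c \<odot>\<^bsub>P\<^esub> p i) = c \<odot>\<^bsub>P\<^esub> lincomb P I a p"
proof -
  interpret P: module R P by (rule assms(1))
  have "lincomb P I a (\<lambda>i. c \<odot>\<^bsub>P\<^esub> p i) = lincomb P I (\<lambda>i. c \<otimes>\<^bsub>R\<^esub> a i) p"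
    unfolding lincomb_def
  proof (rule P.finsum_cong'[OF refl])
    fix i assume i: "i \<in> I"
    have "a i \<odot>\<^bsub>P\<^esub> (c \<odot>\<^bsub>P\<^esub> p i) = (a i \<otimes>\<^bsub>R\<^esub> c) \<odot>\<^bsub>P\<^esub> p i"
      using assms(3-5) i P.smult_assoc1 by simp
    also have "a i \<otimes>\<^bsub>R\<^esub> c = c \<otimes>\<^bsub>R\<^esub> a i" using assms(3,4) i by (simp add: P.m_comm)
    finally show "a i \<odot>\<^bsub>P\<^esub> (c \<odot>\<^bsub>P\<^esub> p i) = (c \<otimes>\<^bsub>R\<^esub> a i) \<odot>\<^bsub>P\<^esub> p i" .
  qed (use assms(3-5) in auto)
  then show ?thesis using lincomb_smult_left[OF assms] by simp
qed

lemma lincomb_single: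
  assumes "module R P" "finite I" "j \<in> I" "p j \<in> carrier P"
    and "\<And>i. \<lbrakk>i \<in> I; i \<noteq> j\<rbrakk> \<Longrightarrow> a i \<odot>\<^bsub>P\<^esub> p i = \<zero>\<^bsub>P\<^esub>" "a j \<in> carrier R"
  shows "lincomb P I a p = a j \<odot>\<^bsub>P\<^esub> p j"
proof -
  interpret P: module R P by (rule assms(1))
  have "lincomb P I a p = (\<Oplus>\<^bsub>P\<^esub>i\<in>I. if j = i then a j \<odot>\<^bsub>P\<^esub> p j else \<zero>\<^bsub>P\<^esub>)"
    unfolding lincomb_def by (rule P.finsum_cong'[OF refl]) (use assms(3-6) in auto)
  also have "\<dots> = a j \<odot>\<^bsub>P\<^esub> p j"
    using P.finsum_singleton[OF assms(3,2), of "\<lambda>_. a j \<odot>\<^bsub>P\<^esub> p j"] assms(4,6) by simp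
  finally show ?thesis .
qed

lemma lincomb_basis_vec:
  assumes "module R P" "finite I" "j \<in> I" "\<And>i. i \<in> I \<Longrightarrow> p i \<in> carrier P"
  shows "lincomb P I (basis_vec R j) p = p j"
proof -
  interpret P: module R P by (rule assms(1))
  show ?thesis
    using lincomb_single[OF assms(1-3), of p "basis_vec R j"] assms(3,4)
    by (simp add: basis_vec_def)
qed

lemma lincomb_linear_left:
  assumes P: "module R P" and "finite I" and p: "\<And>i. i \<in> I \<Longrightarrow> p i \<in> carrier P"
  shows "linear_map R (free_module R I) P (\<lambda>v. lincomb P I v p)"
proof -
  interpret P: module R P by (rule P)
  note cl = free_coord_closed[OF P.is_cring]
  show ?thesis
  proof (rule linear_mapI)
    fix v assume v: "v \<in> carrier (free_module R I)"
    show "lincomb P I v p \<in> carrier P" by (rule lincomb_closed[OF P]) (use cl[OF v] p in auto)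
    fix w assume w: "w \<in> carrier (free_module R I)"
    show "lincomb P I (v \<oplus>\<^bsub>free_module R I\<^esub> w) p = lincomb P I v p \<oplus>\<^bsub>P\<^esub> lincomb P I w p"
      unfolding free_module_simps(3) by (rule lincomb_add_left[OF P cl[OF v] cl[OF w] p])
  next
    fix c v assume c: "c \<in> carrier R" and v: "v \<in> carrier (free_module R I)"
    show "lincomb P I (c \<odot>\<^bsub>free_module R I\<^esub> v) p = c \<odot>\<^bsub>P\<^esub> lincomb P I v p"
      unfolding free_module_simps(4) by (rule lincomb_smult_left[OF P assms(2) c cl[OF v] p])
  qed
qed

lemma lincomb_linear_right:
  assumes N: "module R N" and P: "module R P" and I: "finite I"
    and f: "\<And>i. i \<in> I \<Longrightarrow> linear_map R N P (f i)" and a: "\<And>i. i \<in> I \<Longrightarrow> a i \<in> carrier R"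
  shows "linear_map R N P (\<lambda>u. lincomb P I a (\<lambda>i. f i u))"
proof -
  interpret N: module R N by (rule N)
  interpret P: module R P by (rule P)
  note cl = linear_map_closed[OF f]
  show ?thesis
  proof (rule linear_mapI)
    fix u assume u: "u \<in> carrier N"
    show "lincomb P I a (\<lambda>i. f i u) \<in> carrier P" by (rule lincomb_closed[OF P a cl[OF _ u]])
    fix w assume w: "w \<in> carrier N"
    have "lincomb P I a (\<lambda>i. f i (u \<oplus>\<^bsub>N\<^esub> w)) = lincomb P I a (\<lambda>i. f i u \<oplus>\<^bsub>P\<^esub> f i w)"
      by (rule lincomb_cong[OF P]) (use a cl u w linear_map_add[OF f] in auto)
    also have "\<dots> = lincomb P I a (\<lambda>i. f i u) \<oplus>\<^bsub>P\<^esub> lincomb P I a (\<lambda>i. f i w)"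
      by (rule lincomb_add_right[OF P a cl[OF _ u] cl[OF _ w]])
    finally show "lincomb P I a (\<lambda>i. f i (u \<oplus>\<^bsub>N\<^esub> w)) =
      lincomb P I a (\<lambda>i. f i u) \<oplus>\<^bsub>P\<^esub> lincomb P I a (\<lambda>i. f i w)" .
  next
    fix c u assume c: "c \<in> carrier R" and u: "u \<in> carrier N"
    have "lincomb P I a (\<lambda>i. f i (c \<odot>\<^bsub>N\<^esub> u)) = lincomb P I a (\<lambda>i. c \<odot>\<^bsub>P\<^esub> f i u)"
      by (rule lincomb_cong[OF P]) (use a cl u c linear_map_smult[OF f] in auto)
    also have "\<dots> = c \<odot>\<^bsub>P\<^esub> lincomb P I a (\<lambda>i. f i u)"
      by (rule lincomb_smult_right[OF P I c a cl[OF _ u]])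
    finally show "lincomb P I a (\<lambda>i. f i (c \<odot>\<^bsub>N\<^esub> u)) = c \<odot>\<^bsub>P\<^esub> lincomb P I a (\<lambda>i. f i u)" .
  qed
qed

lemma free_module_ext:
  assumes P: "module R P"
    and f: "linear_map R (free_module R X) P f" and g: "linear_map R (free_module R X) P g"
    and eq: "\<And>x. x \<in> X \<Longrightarrow> f (basis_vec R x) = g (basis_vec R x)"
    and v: "v \<in> carrier (free_module R X)"
  shows "f v = g v"
proof -
  interpret P: module R P by (rule P)
  note F = free_is_module[OF P.is_cring, of X]
  interpret F: module R "free_module R X" by (rule F)
  show ?thesis
    using P.is_cring v
  proof (induction rule: free_module_induct)
    case zero
    show ?case using linear_map_zero[OF f F P] linear_map_zero[OF g F P] by simp
  next
    case (step w a x)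
    then show ?case
      using basis_vec_closed[OF P.is_cring step.hyps(3)] eq[OF step.hyps(3)]
      by (simp add: linear_map_add[OF f] linear_map_add[OF g] linear_map_smult[OF f]
          linear_map_smult[OF g])
  qed
qed

locale ring_sequence = cring R for R (structure) +
  fixes d :: nat and r :: "nat \<Rightarrow> 'a"
  assumes r_closed: "\<And>i. i \<in> {1..d} \<Longrightarrow> r i \<in> carrier R"
begin

abbreviation F where "F \<equiv> free_module R {1..d}"
abbreviation L where "L \<equiv> seq_map R d r ` carrier R"
abbreviation M where "M \<equiv> seq_coker R d r"
abbreviation T where "T n \<equiv> tensor_power R M n"
abbreviation m where "m \<equiv> seq_coker_gen R d r"
abbreviation tuples where "tuples n \<equiv> {1..n::nat} \<rightarrow>\<^sub>E carrier M"
abbreviation pure where "pure \<equiv> pure_tensor R M"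

lemma F_module: "module R F"
  by (rule free_is_module[OF is_cring])

lemma seq_map_linear: "linear_map R (self_module R) F (seq_map R d r)"
proof (rule linear_mapI)
  fix a assume a: "a \<in> carrier (self_module R)"
  have "finite {i. seq_map R d r a i \<noteq> \<zero>}"
    by (rule finite_subset[of _ "{1..d}"]) (auto simp: seq_map_def)
  then show "seq_map R d r a \<in> carrier F"
    using a r_closed by (auto simp: free_module_simps seq_map_def)
  fix b assume b: "b \<in> carrier (self_module R)"
  show "seq_map R d r (a \<oplus>\<^bsub>self_module R\<^esub> b) = seq_map R d r a \<oplus>\<^bsub>F\<^esub> seq_map R d r b"
    using a b r_closed by (simp add: free_module_simps(3) seq_map_def l_distr fun_eq_iff)
next
  fix c a assume "c \<in> carrier R" "a \<in> carrier (self_module R)"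
  then show "seq_map R d r (c \<odot>\<^bsub>self_module R\<^esub> a) = c \<odot>\<^bsub>F\<^esub> seq_map R d r a"
    using r_closed by (simp add: free_module_simps(4) seq_map_def m_assoc fun_eq_iff)
qed

lemma L_submodule: "submodule L R F"
  using image_submodule[OF seq_map_linear self_is_module[OF is_cring] F_module] by simp

lemma M_module: "module R M"
  unfolding seq_coker_def by (rule quot_is_module[OF F_module L_submodule])

lemma T_module: "module R (T n)"
  by (rule tensor_power_module[OF M_module])

lemma coset_map_linear: "linear_map R F M (\<lambda>v. L +>\<^bsub>F\<^esub> v)"
  unfolding seq_coker_def by (rule quot_proj_linear[OF F_module L_submodule])

lemma M_carrier: "carrier M = (\<lambda>v. L +>\<^bsub>F\<^esub> v) ` carrier F"
  unfolding seq_coker_def by (rule quot_carrier)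

lemma gen_closed: "i \<in> {1..d} \<Longrightarrow> m i \<in> carrier M"
  unfolding M_carrier seq_coker_gen_def by (rule imageI[OF basis_vec_closed[OF is_cring]])

lemma coset_eq_lincomb:
  assumes "v \<in> carrier F"
  shows "L +>\<^bsub>F\<^esub> v = lincomb M {1..d} v m"
proof (rule free_module_ext[OF M_module coset_map_linear _ _ assms])
  show "linear_map R F M (\<lambda>v. lincomb M {1..d} v m)"
    by (rule lincomb_linear_left[OF M_module]) (simp_all add: gen_closed)
  fix i assume "i \<in> {1..d}"
  then show "L +>\<^bsub>F\<^esub> basis_vec R i = lincomb M {1..d} (basis_vec R i) m"
    using lincomb_basis_vec[OF M_module, of "{1..d}" i m] gen_closed by (simp add: seq_coker_gen_def)
qed

lemma M_expand:
  assumes "A \<in> carrier M"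
  obtains v where "v \<in> carrier F" "A = lincomb M {1..d} v m"
  using assms coset_eq_lincomb unfolding M_carrier by blast

lemma sum_r_m: "lincomb M {1..d} r m = \<zero>\<^bsub>M\<^esub>"
proof -
  let ?v = "seq_map R d r \<one>"
  have v: "?v \<in> carrier F" using linear_map_closed[OF seq_map_linear, of \<one>] by simp
  have "lincomb M {1..d} r m = lincomb M {1..d} ?v m"
    by (rule lincomb_cong[OF M_module])
       (use r_closed gen_closed free_coord_closed[OF is_cring v] in \<open>auto simp: seq_map_def\<close>)
  also have "\<dots> = L +>\<^bsub>F\<^esub> ?v" by (rule coset_eq_lincomb[OF v, symmetric])
  also have "\<dots> = \<zero>\<^bsub>M\<^esub>"
    unfolding seq_coker_def quot_eq_zero_iff[OF F_module L_submodule v] by (rule imageI) simp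
  finally show ?thesis .
qed

text \<open>The linear map out of the cokernel that sends the \<open>i\<close>-th generator to \<open>p i\<close>, computed from a
  chosen preimage in the free module. The choice does not matter when the \<open>p i\<close> satisfy the relation
  with coefficients \<open>r i\<close>.\<close>

definition coker_lift :: "('a, 'c) module \<Rightarrow> (nat \<Rightarrow> 'c) \<Rightarrow> (nat \<Rightarrow> 'a) set \<Rightarrow> 'c" where
  "coker_lift P p A = lincomb P {1..d} (SOME v. v \<in> carrier F \<and> A = L +>\<^bsub>F\<^esub> v) p"

lemma coker_rep:
  assumes "A \<in> carrier M"
  shows "(SOME v. v \<in> carrier F \<and> A = L +>\<^bsub>F\<^esub> v) \<in> carrier F"
    and "A = L +>\<^bsub>F\<^esub> (SOME v. v \<in> carrier F \<and> A = L +>\<^bsub>F\<^esub> v)"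
proof -
  have "\<exists>v. v \<in> carrier F \<and> A = L +>\<^bsub>F\<^esub> v" using assms unfolding M_carrier by blast
  from someI_ex[OF this] show "(SOME v. v \<in> carrier F \<and> A = L +>\<^bsub>F\<^esub> v) \<in> carrier F"
    and "A = L +>\<^bsub>F\<^esub> (SOME v. v \<in> carrier F \<and> A = L +>\<^bsub>F\<^esub> v)" by blast+
qed

lemma coker_lift_linear:
  assumes P: "module R P" and p: "\<And>i. i \<in> {1..d} \<Longrightarrow> p i \<in> carrier P"
    and rel: "lincomb P {1..d} r p = \<zero>\<^bsub>P\<^esub>"
  shows "linear_map R M P (coker_lift P p)"
    and "\<And>i. i \<in> {1..d} \<Longrightarrow> coker_lift P p (m i) = p i"
proof -
  interpret P: module R P by (rule P)
  interpret F: module R F by (rule F_module)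
  let ?f = "\<lambda>v. lincomb P {1..d} v p"
  have f: "linear_map R F P ?f" by (rule lincomb_linear_left[OF P]) (simp_all add: p)
  have zero: "?f v = \<zero>\<^bsub>P\<^esub>" if "v \<in> L" for v
  proof -
    from that obtain a where a: "v = seq_map R d r a" "a \<in> carrier R" by (rule imageE)
    have "?f v = lincomb P {1..d} (\<lambda>i. a \<otimes> r i) p"
      unfolding a(1) by (rule lincomb_cong[OF P]) (simp_all add: a(2) r_closed p seq_map_def)
    also have "\<dots> = a \<odot>\<^bsub>P\<^esub> lincomb P {1..d} r p"
      by (rule lincomb_smult_left[OF P]) (simp_all add: a(2) r_closed p)
    finally show ?thesis using rel a(2) by simp
  qed
  obtain h where h: "linear_map R M P h" "\<And>v. v \<in> carrier F \<Longrightarrow> h (L +>\<^bsub>F\<^esub> v) = ?f v"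
    using quot_universal[OF F_module L_submodule P f zero] unfolding seq_coker_def by blast
  have eq: "coker_lift P p A = h A" if A: "A \<in> carrier M" for A
    unfolding coker_lift_def h(2)[OF coker_rep(1)[OF A], symmetric] coker_rep(2)[OF A, symmetric] ..
  show "linear_map R M P (coker_lift P p)"
    by (rule linear_map_cong[OF h(1) M_module eq])
  fix i assume i: "i \<in> {1..d}"
  have "coker_lift P p (m i) = ?f (basis_vec R i)"
    unfolding eq[OF gen_closed[OF i]] unfolding seq_coker_gen_def
    by (rule h(2)[OF basis_vec_closed[OF is_cring i]])
  also have "\<dots> = p i" by (rule lincomb_basis_vec[OF P _ i p]) simp
  finally show "coker_lift P p (m i) = p i" .
qed

lemma coker_lift_linear_family:
  assumes N: "module R N" and P: "module R P" and A: "A \<in> carrier M"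
    and f: "\<And>i. i \<in> {1..d} \<Longrightarrow> linear_map R N P (f i)"
  shows "linear_map R N P (\<lambda>u. coker_lift P (\<lambda>i. f i u) A)"
  unfolding coker_lift_def
  by (rule lincomb_linear_right[OF N P _ f free_coord_closed[OF is_cring coker_rep(1)[OF A]]]) simp

lemma tuples_append:
  assumes "x \<in> tuples n" "A \<in> carrier M" shows "x(Suc n := A) \<in> tuples (Suc n)"
  using assms by (auto simp: PiE_def Pi_def extensional_def le_Suc_eq)

lemma tuples_take:
  assumes "x \<in> tuples (Suc n)" shows "restrict x {1..n} \<in> tuples n"
  using assms by (auto simp: PiE_def Pi_def)

lemma tuples_last:
  assumes "x \<in> tuples (Suc n)" shows "x (Suc n) \<in> carrier M"
  using assms by (auto simp: PiE_def Pi_def)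

lemma adjoin_exists:
  assumes "A \<in> carrier M"
  shows "\<exists>h. linear_map R (T n) (T (Suc n)) h \<and>
    (\<forall>x\<in>tuples n. h (pure n x) = pure (Suc n) (x(Suc n := A)))"
proof (rule tensor_power_universal[OF M_module T_module])
  show "multilinear R M n (T (Suc n)) (\<lambda>x. pure (Suc n) (x(Suc n := A)))"
    unfolding multilinear_def
  proof (intro conjI ballI)
    fix x assume x: "x \<in> tuples n"
    note xA = tuples_append[OF x assms]
    show "pure (Suc n) (x(Suc n := A)) \<in> carrier (T (Suc n))"
      by (rule pure_tensor_closed[OF M_module xA])
    fix i assume i: "i \<in> {1..n}"
    have "linear_map R M (T (Suc n)) (\<lambda>u. pure (Suc n) ((x(Suc n := A))(i := u)))"
      by (rule pure_tensor_slot_linear[OF M_module xA]) (use i in auto)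
    moreover have "(x(i := u))(Suc n := A) = (x(Suc n := A))(i := u)" for u
      using i by (intro fun_upd_twist) auto
    ultimately show "linear_map R M (T (Suc n)) (\<lambda>u. pure (Suc n) ((x(i := u))(Suc n := A)))"
      by simp
  qed
qed

text \<open>The map \<open>t \<mapsto> t \<otimes> m\<^sub>i\<close> from one tensor power to the next.\<close>

definition adjoin :: "nat \<Rightarrow> nat \<Rightarrow> ((nat \<Rightarrow> (nat \<Rightarrow> 'a) set) \<Rightarrow> 'a) set \<Rightarrow> ((nat \<Rightarrow> (nat \<Rightarrow> 'a) set) \<Rightarrow> 'a) set"
  where "adjoin n i = (SOME h. linear_map R (T n) (T (Suc n)) h \<and>
    (\<forall>x\<in>tuples n. h (pure n x) = pure (Suc n) (x(Suc n := m i))))"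

lemma adjoin_linear: "i \<in> {1..d} \<Longrightarrow> linear_map R (T n) (T (Suc n)) (adjoin n i)"
  and adjoin_pure: "\<lbrakk>i \<in> {1..d}; x \<in> tuples n\<rbrakk> \<Longrightarrow> adjoin n i (pure n x) = pure (Suc n) (x(Suc n := m i))"
  using someI_ex[OF adjoin_exists[OF gen_closed, of i n]] unfolding adjoin_def by blast+

text \<open>As \<open>T (Suc n)\<close> is \<open>T n \<otimes> M\<close> and \<open>M\<close> has \<open>d\<close> generators with one relation, a map out of \<open>T (Suc n)\<close>
  is given by \<open>d\<close> maps out of \<open>T n\<close> that satisfy this relation pointwise: on a pure tensor, apply
  them to the first \<open>n\<close> slots and let the last slot combine the results.\<close>

lemma tower_universal:
  assumes P: "module R P" and g: "\<And>i. i \<in> {1..d} \<Longrightarrow> linear_map R (T n) P (g i)"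
    and rel: "\<And>t. t \<in> carrier (T n) \<Longrightarrow> lincomb P {1..d} r (\<lambda>i. g i t) = \<zero>\<^bsub>P\<^esub>"
  shows "\<exists>h. linear_map R (T (Suc n)) P h \<and>
    (\<forall>i\<in>{1..d}. \<forall>t\<in>carrier (T n). h (adjoin n i t) = g i t)"
proof -
  define \<beta> where "\<beta> x = coker_lift P (\<lambda>i. g i (pure n x)) (x (Suc n))" for x
  have lin: "linear_map R M P (coker_lift P (\<lambda>i. g i (pure n x)))"
    and gen: "\<And>i. i \<in> {1..d} \<Longrightarrow> coker_lift P (\<lambda>i. g i (pure n x)) (m i) = g i (pure n x)"
    if x: "x \<in> tuples n" for x
    using coker_lift_linear[OF P linear_map_closed[OF g] rel] pure_tensor_closed[OF M_module x]
    by blast+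
  have take: "pure n x = pure n (restrict x {1..n})" for x
    by (rule pure_tensor_cong) simp
  have "multilinear R M (Suc n) P \<beta>"
    unfolding multilinear_def
  proof (intro conjI ballI)
    fix x assume x: "x \<in> tuples (Suc n)"
    show "\<beta> x \<in> carrier P"
      unfolding \<beta>_def take[of x]
      by (rule linear_map_closed[OF lin[OF tuples_take[OF x]] tuples_last[OF x]])
    fix i assume i: "i \<in> {1..Suc n}"
    show "linear_map R M P (\<lambda>u. \<beta> (x(i := u)))"
    proof (cases "i = Suc n")
      case True
      have "pure n (x(Suc n := u)) = pure n (restrict x {1..n})" for u
        by (rule pure_tensor_cong) simp
      then show ?thesis
        unfolding True \<beta>_def using lin[OF tuples_take[OF x]] by simp
    next
      case False
      then have i': "i \<in> {1..n}" using i by auto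
      have "pure n (x(i := u)) = pure n ((restrict x {1..n})(i := u))" for u
        by (rule pure_tensor_cong) simp
      then have eq: "\<beta> (x(i := u)) =
          coker_lift P (\<lambda>j. g j (pure n ((restrict x {1..n})(i := u)))) (x (Suc n))" for u
        using False by (simp add: \<beta>_def)
      show ?thesis
        unfolding eq
        by (rule coker_lift_linear_family[OF M_module P tuples_last[OF x]],
            rule linear_map_comp[OF pure_tensor_slot_linear[OF M_module tuples_take[OF x] i'] g])
    qed
  qed
  from tensor_power_universal[OF M_module P this]
  obtain h where h: "linear_map R (T (Suc n)) P h"
    "\<And>x. x \<in> tuples (Suc n) \<Longrightarrow> h (pure (Suc n) x) = \<beta> x"
    by blast
  have "h (adjoin n i t) = g i t" if i: "i \<in> {1..d}" and t: "t \<in> carrier (T n)" for i t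
  proof (rule tensor_power_ext[OF M_module P linear_map_comp[OF adjoin_linear[OF i] h(1)] g[OF i] _ t])
    fix x assume x: "x \<in> tuples n"
    have "pure n (x(Suc n := m i)) = pure n x" by (rule pure_tensor_cong) simp
    then have "\<beta> (x(Suc n := m i)) = g i (pure n x)" using gen[OF x i] by (simp add: \<beta>_def)
    then show "h (adjoin n i (pure n x)) = g i (pure n x)"
      by (simp add: adjoin_pure[OF i x] h(2)[OF tuples_append[OF x gen_closed[OF i]]])
  qed
  with h(1) show ?thesis by blast
qed

end

section \<open>Regular sequences along a tower of modules\<close>

definition famsum :: "('a, 'c) module \<Rightarrow> 'i set \<Rightarrow> ('i \<Rightarrow> 'b \<Rightarrow> 'c) \<Rightarrow> ('i \<Rightarrow> 'b) \<Rightarrow> 'c" where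
  "famsum P I e t = (\<Oplus>\<^bsub>P\<^esub>i\<in>I. e i (t i))"

lemma famsum_closed:
  assumes "module R P" "\<And>i. i \<in> I \<Longrightarrow> linear_map R N P (e i)" "\<And>i. i \<in> I \<Longrightarrow> t i \<in> carrier N"
  shows "famsum P I e t \<in> carrier P"
proof -
  interpret P: module R P by (rule assms(1))
  show ?thesis unfolding famsum_def
    by (rule P.finsum_closed) (use linear_map_closed[OF assms(2)] assms(3) in auto)
qed

lemma famsum_cong:
  assumes "module R P" "\<And>i. i \<in> I \<Longrightarrow> linear_map R N P (e i)" "\<And>i. i \<in> I \<Longrightarrow> t i \<in> carrier N"
    and "\<And>i. i \<in> I \<Longrightarrow> s i = t i"
  shows "famsum P I e s = famsum P I e t"
proof -
  interpret P: module R P by (rule assms(1))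
  show ?thesis unfolding famsum_def
    by (rule P.finsum_cong'[OF refl]) (use linear_map_closed[OF assms(2)] assms(3,4) in auto)
qed

lemma famsum_add:
  assumes "module R P" "\<And>i. i \<in> I \<Longrightarrow> linear_map R N P (e i)" "\<And>i. i \<in> I \<Longrightarrow> t i \<in> carrier N"
    "\<And>i. i \<in> I \<Longrightarrow> s i \<in> carrier N"
  shows "famsum P I e (\<lambda>i. t i \<oplus>\<^bsub>N\<^esub> s i) = famsum P I e t \<oplus>\<^bsub>P\<^esub> famsum P I e s"
proof -
  interpret P: module R P by (rule assms(1))
  note cl = linear_map_closed[OF assms(2)]
  have "famsum P I e (\<lambda>i. t i \<oplus>\<^bsub>N\<^esub> s i) = (\<Oplus>\<^bsub>P\<^esub>i\<in>I. e i (t i) \<oplus>\<^bsub>P\<^esub> e i (s i))"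
    unfolding famsum_def
    by (rule P.finsum_cong'[OF refl]) (use cl assms(3,4) linear_map_add[OF assms(2)] in auto)
  also have "\<dots> = famsum P I e t \<oplus>\<^bsub>P\<^esub> famsum P I e s"
    unfolding famsum_def by (rule P.finsum_addf) (use cl assms(3,4) in auto)
  finally show ?thesis .
qed

lemma famsum_smult:
  assumes "module R P" "finite I" "\<And>i. i \<in> I \<Longrightarrow> linear_map R N P (e i)"
    "\<And>i. i \<in> I \<Longrightarrow> t i \<in> carrier N" "c \<in> carrier R"
  shows "famsum P I e (\<lambda>i. c \<odot>\<^bsub>N\<^esub> t i) = c \<odot>\<^bsub>P\<^esub> famsum P I e t"
proof -
  interpret P: module R P by (rule assms(1))
  note cl = linear_map_closed[OF assms(3)]
  have "famsum P I e (\<lambda>i. c \<odot>\<^bsub>N\<^esub> t i) = (\<Oplus>\<^bsub>P\<^esub>i\<in>I. c \<odot>\<^bsub>P\<^esub> e i (t i))"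
    unfolding famsum_def
    by (rule P.finsum_cong'[OF refl]) (use cl assms(4,5) linear_map_smult[OF assms(3)] in auto)
  also have "\<dots> = c \<odot>\<^bsub>P\<^esub> famsum P I e t"
    unfolding famsum_def by (rule P.finsum_smult_ldistr[symmetric]) (use cl assms(2,4,5) in auto)
  finally show ?thesis .
qed

lemma famsum_diff:
  assumes P: "module R P" and N: "module R N" and I: "finite I"
    and e: "\<And>i. i \<in> I \<Longrightarrow> linear_map R N P (e i)"
    and t: "\<And>i. i \<in> I \<Longrightarrow> t i \<in> carrier N" and s: "\<And>i. i \<in> I \<Longrightarrow> s i \<in> carrier N"
  shows "famsum P I e (\<lambda>i. t i \<ominus>\<^bsub>N\<^esub> s i) = famsum P I e t \<ominus>\<^bsub>P\<^esub> famsum P I e s"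
proof -
  interpret P: module R P by (rule P)
  interpret N: module R N by (rule N)
  have neg: "\<ominus>\<^bsub>R\<^esub> \<one>\<^bsub>R\<^esub> \<in> carrier R" by simp
  have N1: "(\<ominus>\<^bsub>R\<^esub> \<one>\<^bsub>R\<^esub>) \<odot>\<^bsub>N\<^esub> x = \<ominus>\<^bsub>N\<^esub> x" if "x \<in> carrier N" for x
    using that N.smult_l_minus[OF P.one_closed that] by simp
  have P1: "(\<ominus>\<^bsub>R\<^esub> \<one>\<^bsub>R\<^esub>) \<odot>\<^bsub>P\<^esub> x = \<ominus>\<^bsub>P\<^esub> x" if "x \<in> carrier P" for x
    using that P.smult_l_minus[OF P.one_closed that] by simp
  have "famsum P I e (\<lambda>i. t i \<ominus>\<^bsub>N\<^esub> s i) =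
      famsum P I e (\<lambda>i. t i \<oplus>\<^bsub>N\<^esub> (\<ominus>\<^bsub>R\<^esub> \<one>\<^bsub>R\<^esub>) \<odot>\<^bsub>N\<^esub> s i)"
    by (rule famsum_cong[OF P e]) (use t s N1 in \<open>simp_all add: a_minus_def\<close>)
  also have "\<dots> = famsum P I e t \<oplus>\<^bsub>P\<^esub> (\<ominus>\<^bsub>R\<^esub> \<one>\<^bsub>R\<^esub>) \<odot>\<^bsub>P\<^esub> famsum P I e s"
    using famsum_add[where s = "\<lambda>i. (\<ominus>\<^bsub>R\<^esub> \<one>\<^bsub>R\<^esub>) \<odot>\<^bsub>N\<^esub> s i", OF P e t] famsum_smult[OF P I e s neg] s by simp
  also have "\<dots> = famsum P I e t \<ominus>\<^bsub>P\<^esub> famsum P I e s"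
    using P1[of "famsum P I e s"] famsum_closed[where t = s, OF P e s] by (simp add: a_minus_def)
  finally show ?thesis .
qed

lemma linear_map_famsum:
  assumes f: "linear_map R P Q f" and P: "module R P" and Q: "module R Q" and I: "finite I"
    and e: "\<And>i. i \<in> I \<Longrightarrow> linear_map R N P (e i)" and t: "\<And>i. i \<in> I \<Longrightarrow> t i \<in> carrier N"
  shows "f (famsum P I e t) = famsum Q I (\<lambda>i x. f (e i x)) t"
  unfolding famsum_def
  by (rule linear_map_finsum[OF f P Q I]) (use linear_map_closed[OF e t] in auto)

lemma submodule_ops:
  assumes "module R P" "submodule S R P"
  shows "\<And>x. x \<in> S \<Longrightarrow> x \<in> carrier P" "\<zero>\<^bsub>P\<^esub> \<in> S"
    "\<And>x y. \<lbrakk>x \<in> S; y \<in> S\<rbrakk> \<Longrightarrow> x \<oplus>\<^bsub>P\<^esub> y \<in> S" "\<And>x y. \<lbrakk>x \<in> S; y \<in> S\<rbrakk> \<Longrightarrow> x \<ominus>\<^bsub>P\<^esub> y \<in> S"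
    "\<And>a x. \<lbrakk>a \<in> carrier R; x \<in> S\<rbrakk> \<Longrightarrow> a \<odot>\<^bsub>P\<^esub> x \<in> S"
proof -
  interpret P: module R P by (rule assms(1))
  note E = P.submoduleE[OF assms(2)]
  show "\<zero>\<^bsub>P\<^esub> \<in> S" by (rule submodule_facts(3)[OF assms])
  show "\<And>x. x \<in> S \<Longrightarrow> x \<in> carrier P" using E(1) by blast
  show "\<And>x y. \<lbrakk>x \<in> S; y \<in> S\<rbrakk> \<Longrightarrow> x \<oplus>\<^bsub>P\<^esub> y \<in> S" by (rule E(5))
  show "\<And>x y. \<lbrakk>x \<in> S; y \<in> S\<rbrakk> \<Longrightarrow> x \<ominus>\<^bsub>P\<^esub> y \<in> S" unfolding a_minus_def using E(3,5) by blast
  show "\<And>a x. \<lbrakk>a \<in> carrier R; x \<in> S\<rbrakk> \<Longrightarrow> a \<odot>\<^bsub>P\<^esub> x \<in> S" by (rule E(4))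
qed

lemma submodule_finsum:
  assumes P: "module R P" and S: "submodule S R P" and "finite I" "\<And>i. i \<in> I \<Longrightarrow> f i \<in> S"
  shows "(\<Oplus>\<^bsub>P\<^esub>i\<in>I. f i) \<in> S"
proof -
  interpret P: module R P by (rule P)
  note ops = submodule_ops[OF P S]
  show ?thesis using assms(3,4)
  proof (induction I)
    case empty
    show ?case using ops(2) by simp
  next
    case (insert i I)
    have "(\<Oplus>\<^bsub>P\<^esub>i\<in>insert i I. f i) = f i \<oplus>\<^bsub>P\<^esub> (\<Oplus>\<^bsub>P\<^esub>i\<in>I. f i)"
      by (rule P.finsum_insert) (use insert ops(1) in auto)
    then show ?case using insert ops(3) by simp
  qed
qed

text \<open>The submodule \<open>(r\<^sub>1, \<dots>, r\<^sub>k) P\<close>, built one generator at a time so that induction on \<open>k\<close> peels off the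
  last one.\<close>

primrec head_mult ::
    "('a, 'x) ring_scheme \<Rightarrow> (nat \<Rightarrow> 'a) \<Rightarrow> ('a, 'b) module \<Rightarrow> nat \<Rightarrow> 'b set" where
  "head_mult R r P 0 = {\<zero>\<^bsub>P\<^esub>}"
| "head_mult R r P (Suc k) =
     {x \<oplus>\<^bsub>P\<^esub> r (Suc k) \<odot>\<^bsub>P\<^esub> u |x u. x \<in> head_mult R r P k \<and> u \<in> carrier P}"

context ring_sequence
begin

abbreviation J where "J \<equiv> head_mult R r"

lemma J_SucI: "\<lbrakk>x \<in> J P k; u \<in> carrier P\<rbrakk> \<Longrightarrow> x \<oplus>\<^bsub>P\<^esub> r (Suc k) \<odot>\<^bsub>P\<^esub> u \<in> J P (Suc k)"
  by (simp only: head_mult.simps mem_Collect_eq) blast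

lemma J_submodule:
  assumes P: "module R P" and "k \<le> d"
  shows "submodule (J P k) R P"
  using assms(2)
proof (induction k)
  case 0
  interpret P: module R P by (rule P)
  show ?case by (rule P.submoduleI) (simp_all add: P.minus_equality)
next
  case (Suc k)
  interpret P: module R P by (rule P)
  have IH: "submodule (J P k) R P" using Suc by simp
  note ops = submodule_ops[OF P IH]
  have rk: "r (Suc k) \<in> carrier R" using Suc.prems by (intro r_closed) auto
  show ?case
  proof (rule P.submoduleI)
    show "J P (Suc k) \<subseteq> carrier P" using ops(1) rk by auto
    show "\<zero>\<^bsub>P\<^esub> \<in> J P (Suc k)"
      using ops(2) rk by (auto intro!: exI[of _ "\<zero>\<^bsub>P\<^esub>"])
  next
    fix v w assume "v \<in> J P (Suc k)" "w \<in> J P (Suc k)"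
    then obtain x u y z where *: "v = x \<oplus>\<^bsub>P\<^esub> r (Suc k) \<odot>\<^bsub>P\<^esub> u" "x \<in> J P k" "u \<in> carrier P"
      "w = y \<oplus>\<^bsub>P\<^esub> r (Suc k) \<odot>\<^bsub>P\<^esub> z" "y \<in> J P k" "z \<in> carrier P" by auto
    have "v \<oplus>\<^bsub>P\<^esub> w = (x \<oplus>\<^bsub>P\<^esub> y) \<oplus>\<^bsub>P\<^esub> r (Suc k) \<odot>\<^bsub>P\<^esub> (u \<oplus>\<^bsub>P\<^esub> z)"
      using * ops(1)[OF *(2)] ops(1)[OF *(5)] rk by (simp add: P.smult_r_distr P.a_ac)
    moreover have "x \<oplus>\<^bsub>P\<^esub> y \<in> J P k" "u \<oplus>\<^bsub>P\<^esub> z \<in> carrier P" using * ops(3) by simp_all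
    ultimately show "v \<oplus>\<^bsub>P\<^esub> w \<in> J P (Suc k)" using J_SucI by (simp del: head_mult.simps)
  next
    fix c v assume c: "c \<in> carrier R" and "v \<in> J P (Suc k)"
    then obtain x u where *: "v = x \<oplus>\<^bsub>P\<^esub> r (Suc k) \<odot>\<^bsub>P\<^esub> u" "x \<in> J P k" "u \<in> carrier P" by auto
    have "c \<odot>\<^bsub>P\<^esub> (r (Suc k) \<odot>\<^bsub>P\<^esub> u) = r (Suc k) \<odot>\<^bsub>P\<^esub> (c \<odot>\<^bsub>P\<^esub> u)"
      using c rk *(3) by (metis P.smult_assoc1 m_comm)
    then have "c \<odot>\<^bsub>P\<^esub> v = c \<odot>\<^bsub>P\<^esub> x \<oplus>\<^bsub>P\<^esub> r (Suc k) \<odot>\<^bsub>P\<^esub> (c \<odot>\<^bsub>P\<^esub> u)"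
      using * ops(1)[OF *(2)] rk c by (simp add: P.smult_r_distr)
    moreover have "c \<odot>\<^bsub>P\<^esub> x \<in> J P k" "c \<odot>\<^bsub>P\<^esub> u \<in> carrier P" using * c ops(5) by simp_all
    ultimately show "c \<odot>\<^bsub>P\<^esub> v \<in> J P (Suc k)" using J_SucI by (simp del: head_mult.simps)
  next
    fix v assume "v \<in> J P (Suc k)"
    then obtain x u where *: "v = x \<oplus>\<^bsub>P\<^esub> r (Suc k) \<odot>\<^bsub>P\<^esub> u" "x \<in> J P k" "u \<in> carrier P" by auto
    have "\<ominus>\<^bsub>P\<^esub> v = \<ominus>\<^bsub>P\<^esub> x \<oplus>\<^bsub>P\<^esub> r (Suc k) \<odot>\<^bsub>P\<^esub> (\<ominus>\<^bsub>P\<^esub> u)"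
      using * ops(1)[OF *(2)] rk by (simp add: P.minus_add P.smult_r_minus)
    moreover have "\<ominus>\<^bsub>P\<^esub> x \<in> J P k" "\<ominus>\<^bsub>P\<^esub> u \<in> carrier P"
      using * P.submoduleE(3)[OF IH] by simp_all
    ultimately show "\<ominus>\<^bsub>P\<^esub> v \<in> J P (Suc k)" using J_SucI by (simp del: head_mult.simps)
  qed
qed

lemma J_carrier: "\<lbrakk>module R P; k \<le> d; x \<in> J P k\<rbrakk> \<Longrightarrow> x \<in> carrier P"
  by (rule submodule_ops(1)[OF _ J_submodule])

lemma J_Suc_mono:
  assumes P: "module R P" and k: "Suc k \<le> d" and x: "x \<in> J P k"
  shows "x \<in> J P (Suc k)"
proof -
  interpret P: module R P by (rule P)
  have "x \<in> carrier P" by (rule J_carrier[OF P Suc_leD[OF k] x])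
  moreover have "r (Suc k) \<in> carrier R" by (rule r_closed) (use k in simp)
  ultimately have eq: "x \<oplus>\<^bsub>P\<^esub> r (Suc k) \<odot>\<^bsub>P\<^esub> \<zero>\<^bsub>P\<^esub> = x" by simp
  show ?thesis using J_SucI[OF x P.zero_closed] unfolding eq .
qed

lemma J_image:
  assumes P: "module R P" and Q: "module R Q" and f: "linear_map R P Q f"
    and "k \<le> d" "x \<in> J P k"
  shows "f x \<in> J Q k"
  using assms(4,5)
proof (induction k arbitrary: x)
  case 0
  then show ?case using linear_map_zero[OF f P Q] by simp
next
  case (Suc k)
  then obtain y u where *: "x = y \<oplus>\<^bsub>P\<^esub> r (Suc k) \<odot>\<^bsub>P\<^esub> u" "y \<in> J P k" "u \<in> carrier P" by auto
  interpret P: module R P by (rule P)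
  have rk: "r (Suc k) \<in> carrier R" using Suc.prems(1) by (intro r_closed) auto
  have y: "y \<in> carrier P" by (rule J_carrier[OF P Suc_leD[OF Suc.prems(1)] *(2)])
  have "f x = f y \<oplus>\<^bsub>Q\<^esub> r (Suc k) \<odot>\<^bsub>Q\<^esub> f u"
    using *(1,3) y rk by (simp add: linear_map_add[OF f] linear_map_smult[OF f])
  moreover have "f y \<in> J Q k" using Suc *(2) by simp
  moreover have "f u \<in> carrier Q" by (rule linear_map_closed[OF f *(3)])
  ultimately show ?case using J_SucI by (simp del: head_mult.simps)
qed

text \<open>The element \<open>r\<^sub>k\<^sub>+\<^sub>1\<close> is a nonzerodivisor on \<open>P / (r\<^sub>1, \<dots>, r\<^sub>k) P\<close>.\<close>

definition regular_at :: "('a, 'p) module \<Rightarrow> nat \<Rightarrow> bool" where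
  "regular_at P k \<longleftrightarrow> (\<forall>t\<in>carrier P. r (Suc k) \<odot>\<^bsub>P\<^esub> t \<in> J P k \<longrightarrow> t \<in> J P k)"

text \<open>This condition is what an injective linear map from the elements of \<open>P / (r\<^sub>1, \<dots>, r\<^sub>k) P\<close> killed
  by the sequence to \<open>R / (r\<^sub>1, \<dots>, r\<^sub>d)\<close> implies for two such elements: if \<open>t\<close> and \<open>t'\<close> are mapped to
  the classes of \<open>c'\<close> and \<open>c\<close>, then \<open>c t\<close> and \<open>c' t'\<close> have the same image, and \<open>t\<close> vanishes with \<open>c'\<close>.
  In this form it passes from one tensor power to the next without constructing the map.\<close>

definition socle_cyclic_at :: "('a, 'p) module \<Rightarrow> nat \<Rightarrow> bool" where
  "socle_cyclic_at P k \<longleftrightarrow> (\<forall>t\<in>carrier P. \<forall>t'\<in>carrier P.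
     (\<forall>i\<in>{1..d}. r i \<odot>\<^bsub>P\<^esub> t \<in> J P k) \<longrightarrow> (\<forall>i\<in>{1..d}. r i \<odot>\<^bsub>P\<^esub> t' \<in> J P k) \<longrightarrow>
     (\<exists>c\<in>carrier R. \<exists>c'\<in>carrier R. c \<odot>\<^bsub>P\<^esub> t \<ominus>\<^bsub>P\<^esub> c' \<odot>\<^bsub>P\<^esub> t' \<in> J P k \<and>
       (c' \<in> J (self_module R) d \<longrightarrow> t \<in> J P k)))"

end

lemma (in abelian_group) diff_diff_add_cancel:
  assumes "x \<in> carrier G" "q \<in> carrier G" "w \<in> carrier G"
  shows "(x \<ominus> q \<ominus> w) \<oplus> q = x \<ominus> w"
proof -
  have "(x \<ominus> q \<ominus> w) \<oplus> q = (x \<ominus> w) \<oplus> (q \<oplus> \<ominus> q)"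
    using assms by (simp add: a_minus_def a_ac)
  then show ?thesis using assms by (simp add: r_neg)
qed

lemma (in abelian_group) zero_diff_diff_add:
  assumes "q \<in> carrier G" "w \<in> carrier G"
  shows "(\<zero> \<ominus> (q \<ominus> w)) \<oplus> q = w"
proof -
  have "(\<zero> \<ominus> (q \<ominus> w)) \<oplus> q = w \<oplus> (q \<oplus> \<ominus> q)"
    using assms by (simp add: a_minus_def minus_add a_ac)
  then show ?thesis using assms by (simp add: r_neg)
qed

text \<open>An exact sequence \<open>N \<rightarrow> N\<^sup>d \<rightarrow> N' \<rightarrow> 0\<close> whose first map is \<open>u \<mapsto> (r\<^sub>1 u, \<dots>, r\<^sub>d u)\<close> and whose second map
  has the components \<open>e i\<close>.\<close>

locale tower_step = ring_sequence R d r for R (structure) and d r +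
  fixes N :: "('a, 'n) module" and N' :: "('a, 'p) module" and e :: "nat \<Rightarrow> 'n \<Rightarrow> 'p"
  assumes N: "module R N" and N': "module R N'"
    and e: "\<And>i. i \<in> {1..d} \<Longrightarrow> linear_map R N N' (e i)"
    and expand: "\<And>y. y \<in> carrier N' \<Longrightarrow>
      \<exists>t. (\<forall>i\<in>{1..d}. t i \<in> carrier N) \<and> y = famsum N' {1..d} e t"
    and famsum_zero_iff: "\<And>t. (\<And>i. i \<in> {1..d} \<Longrightarrow> t i \<in> carrier N) \<Longrightarrow>
      famsum N' {1..d} e t = \<zero>\<^bsub>N'\<^esub> \<longleftrightarrow> (\<exists>u\<in>carrier N. \<forall>i\<in>{1..d}. t i = r i \<odot>\<^bsub>N\<^esub> u)"
begin

lemma fam_closed: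
  "(\<And>i. i \<in> {1..d} \<Longrightarrow> t i \<in> carrier N) \<Longrightarrow> famsum N' {1..d} e t \<in> carrier N'"
  by (rule famsum_closed[OF N' e])

lemma fam_diff:
  assumes "\<And>i. i \<in> {1..d} \<Longrightarrow> t i \<in> carrier N" "\<And>i. i \<in> {1..d} \<Longrightarrow> s i \<in> carrier N"
  shows "famsum N' {1..d} e (\<lambda>i. t i \<ominus>\<^bsub>N\<^esub> s i) =
    famsum N' {1..d} e t \<ominus>\<^bsub>N'\<^esub> famsum N' {1..d} e s"
  by (rule famsum_diff[OF N' N finite_atLeastAtMost e assms])

lemma fam_smult:
  assumes "c \<in> carrier R" "\<And>i. i \<in> {1..d} \<Longrightarrow> t i \<in> carrier N"
  shows "famsum N' {1..d} e (\<lambda>i. c \<odot>\<^bsub>N\<^esub> t i) = c \<odot>\<^bsub>N'\<^esub> famsum N' {1..d} e t"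
  by (rule famsum_smult[OF N' finite_atLeastAtMost e assms(2,1)])

text \<open>The sequence presenting \<open>N'\<close> remains exact modulo \<open>(r\<^sub>1, \<dots>, r\<^sub>k)\<close>: a summand \<open>r\<^sub>k y\<close> in \<open>N'\<close> lifts
  to a multiple of \<open>r\<^sub>k\<close> in \<open>N\<^sup>d\<close>, which can be subtracted from \<open>t\<close>.\<close>

lemma famsum_in_J_iff:
  assumes "k \<le> d" "\<And>i. i \<in> {1..d} \<Longrightarrow> t i \<in> carrier N"
  shows "famsum N' {1..d} e t \<in> J N' k \<longleftrightarrow>
    (\<exists>u\<in>carrier N. \<forall>i\<in>{1..d}. t i \<ominus>\<^bsub>N\<^esub> r i \<odot>\<^bsub>N\<^esub> u \<in> J N k)"
proof
  interpret N: module R N by (rule N)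
  interpret N': module R N' by (rule N')
  assume "\<exists>u\<in>carrier N. \<forall>i\<in>{1..d}. t i \<ominus>\<^bsub>N\<^esub> r i \<odot>\<^bsub>N\<^esub> u \<in> J N k"
  then obtain u where u: "u \<in> carrier N" "\<And>i. i \<in> {1..d} \<Longrightarrow> t i \<ominus>\<^bsub>N\<^esub> r i \<odot>\<^bsub>N\<^esub> u \<in> J N k" by blast
  have ru: "\<And>i. i \<in> {1..d} \<Longrightarrow> r i \<odot>\<^bsub>N\<^esub> u \<in> carrier N" using r_closed u(1) by simp
  have "famsum N' {1..d} e (\<lambda>i. r i \<odot>\<^bsub>N\<^esub> u) = \<zero>\<^bsub>N'\<^esub>"
    using famsum_zero_iff[of "\<lambda>i. r i \<odot>\<^bsub>N\<^esub> u", OF ru] u(1) by blast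
  then have "famsum N' {1..d} e (\<lambda>i. t i \<ominus>\<^bsub>N\<^esub> r i \<odot>\<^bsub>N\<^esub> u) = famsum N' {1..d} e t \<ominus>\<^bsub>N'\<^esub> \<zero>\<^bsub>N'\<^esub>"
    using fam_diff[of t "\<lambda>i. r i \<odot>\<^bsub>N\<^esub> u", OF assms(2) ru] by simp
  also have "\<dots> = famsum N' {1..d} e t"
    using fam_closed[of t, OF assms(2)] N'.minus_equality[of "\<zero>\<^bsub>N'\<^esub>" "\<zero>\<^bsub>N'\<^esub>"]
    by (simp add: a_minus_def)
  finally have eq: "famsum N' {1..d} e t = famsum N' {1..d} e (\<lambda>i. t i \<ominus>\<^bsub>N\<^esub> r i \<odot>\<^bsub>N\<^esub> u)" ..
  show "famsum N' {1..d} e t \<in> J N' k"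
    unfolding eq unfolding famsum_def
    by (rule submodule_finsum[OF N' J_submodule[OF N' assms(1)]])
       (use J_image[OF N N' e assms(1) u(2)] in auto)
next
  interpret N: module R N by (rule N)
  interpret N': module R N' by (rule N')
  assume "famsum N' {1..d} e t \<in> J N' k"
  then show "\<exists>u\<in>carrier N. \<forall>i\<in>{1..d}. t i \<ominus>\<^bsub>N\<^esub> r i \<odot>\<^bsub>N\<^esub> u \<in> J N k"
    using assms
  proof (induction k arbitrary: t)
    case 0
    then obtain u where u: "u \<in> carrier N" "\<And>i. i \<in> {1..d} \<Longrightarrow> t i = r i \<odot>\<^bsub>N\<^esub> u"
      using famsum_zero_iff by auto
    then have "\<forall>i\<in>{1..d}. t i \<ominus>\<^bsub>N\<^esub> r i \<odot>\<^bsub>N\<^esub> u \<in> J N 0"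
      using 0(3) module_diff_eq_zero_iff[OF N] by simp
    with u(1) show ?case by blast
  next
    case (Suc k)
    have rk: "r (Suc k) \<in> carrier R" using Suc.prems(2) by (intro r_closed) auto
    obtain x y where x: "famsum N' {1..d} e t = x \<oplus>\<^bsub>N'\<^esub> r (Suc k) \<odot>\<^bsub>N'\<^esub> y" "x \<in> J N' k"
      and y: "y \<in> carrier N'" using Suc.prems(1) by auto
    obtain s where s: "\<And>i. i \<in> {1..d} \<Longrightarrow> s i \<in> carrier N" "y = famsum N' {1..d} e s"
      using expand[OF y] by blast
    have xc: "x \<in> carrier N'"
      by (rule J_carrier[OF N' Suc_leD[OF Suc.prems(2)] x(2)])
    have rs: "\<And>i. i \<in> {1..d} \<Longrightarrow> r (Suc k) \<odot>\<^bsub>N\<^esub> s i \<in> carrier N" using s(1) rk by simp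
    have "famsum N' {1..d} e (\<lambda>i. t i \<ominus>\<^bsub>N\<^esub> r (Suc k) \<odot>\<^bsub>N\<^esub> s i) =
        (x \<oplus>\<^bsub>N'\<^esub> r (Suc k) \<odot>\<^bsub>N'\<^esub> y) \<ominus>\<^bsub>N'\<^esub> r (Suc k) \<odot>\<^bsub>N'\<^esub> y"
      using fam_diff[of t "\<lambda>i. r (Suc k) \<odot>\<^bsub>N\<^esub> s i", OF Suc.prems(3) rs]
        fam_smult[of "r (Suc k)" s, OF rk s(1)] s(2) x(1) by simp
    also have "\<dots> = x" using xc y rk by (simp add: a_minus_def N'.a_assoc N'.r_neg)
    finally have "famsum N' {1..d} e (\<lambda>i. t i \<ominus>\<^bsub>N\<^esub> r (Suc k) \<odot>\<^bsub>N\<^esub> s i) \<in> J N' k" using x(2) by simp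
    then obtain u where u: "u \<in> carrier N"
      "\<And>i. i \<in> {1..d} \<Longrightarrow> t i \<ominus>\<^bsub>N\<^esub> r (Suc k) \<odot>\<^bsub>N\<^esub> s i \<ominus>\<^bsub>N\<^esub> r i \<odot>\<^bsub>N\<^esub> u \<in> J N k"
      using Suc.IH[of "\<lambda>i. t i \<ominus>\<^bsub>N\<^esub> r (Suc k) \<odot>\<^bsub>N\<^esub> s i"] Suc.prems(2,3) rs by auto
    have "t i \<ominus>\<^bsub>N\<^esub> r i \<odot>\<^bsub>N\<^esub> u \<in> J N (Suc k)" if i: "i \<in> {1..d}" for i
    proof -
      have "t i \<ominus>\<^bsub>N\<^esub> r i \<odot>\<^bsub>N\<^esub> u =
          (t i \<ominus>\<^bsub>N\<^esub> r (Suc k) \<odot>\<^bsub>N\<^esub> s i \<ominus>\<^bsub>N\<^esub> r i \<odot>\<^bsub>N\<^esub> u) \<oplus>\<^bsub>N\<^esub> r (Suc k) \<odot>\<^bsub>N\<^esub> s i"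
        using N.diff_diff_add_cancel[OF Suc.prems(3)[OF i] rs[OF i]] r_closed[OF i] u(1) by simp
      then show ?thesis using J_SucI[OF u(2)[OF i] s(1)[OF i]] by (simp del: head_mult.simps)
    qed
    with u(1) show ?case by blast
  qed
qed

text \<open>The connecting map of the snake lemma for multiplication by \<open>r\<^sub>k\<^sub>+\<^sub>1\<close>: lift \<open>y\<close> to a tuple \<open>t\<close>; then
  \<open>r\<^sub>k\<^sub>+\<^sub>1 t\<close> comes from some \<open>u\<close>. Since each \<open>r\<^sub>i u\<close> is congruent to \<open>r\<^sub>k\<^sub>+\<^sub>1 t\<^sub>i\<close>, the element \<open>u\<close> is
  killed by the whole sequence modulo \<open>(r\<^sub>1, \<dots>, r\<^sub>k\<^sub>+\<^sub>1)\<close>.\<close>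

lemma connecting_element:
  assumes k: "k < d" and y: "y \<in> carrier N'" and ry: "r (Suc k) \<odot>\<^bsub>N'\<^esub> y \<in> J N' k"
  shows "\<exists>t u. (\<forall>i\<in>{1..d}. t i \<in> carrier N) \<and> y = famsum N' {1..d} e t \<and> u \<in> carrier N \<and>
    (\<forall>i\<in>{1..d}. r (Suc k) \<odot>\<^bsub>N\<^esub> t i \<ominus>\<^bsub>N\<^esub> r i \<odot>\<^bsub>N\<^esub> u \<in> J N k) \<and>
    (\<forall>i\<in>{1..d}. r i \<odot>\<^bsub>N\<^esub> u \<in> J N (Suc k))"
proof -
  interpret N: module R N by (rule N)
  have rk: "r (Suc k) \<in> carrier R" using k by (intro r_closed) auto
  obtain t where t: "\<And>i. i \<in> {1..d} \<Longrightarrow> t i \<in> carrier N" "y = famsum N' {1..d} e t"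
    using expand[OF y] by blast
  have rt: "\<And>i. i \<in> {1..d} \<Longrightarrow> r (Suc k) \<odot>\<^bsub>N\<^esub> t i \<in> carrier N" using t(1) rk by simp
  have "famsum N' {1..d} e (\<lambda>i. r (Suc k) \<odot>\<^bsub>N\<^esub> t i) \<in> J N' k"
    using fam_smult[of "r (Suc k)" t, OF rk t(1)] ry t(2) by simp
  then obtain u where u: "u \<in> carrier N"
    "\<And>i. i \<in> {1..d} \<Longrightarrow> r (Suc k) \<odot>\<^bsub>N\<^esub> t i \<ominus>\<^bsub>N\<^esub> r i \<odot>\<^bsub>N\<^esub> u \<in> J N k"
    using famsum_in_J_iff[of k "\<lambda>i. r (Suc k) \<odot>\<^bsub>N\<^esub> t i"] k rt by auto
  have sub: "submodule (J N k) R N" using J_submodule[OF N] k by simp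
  have "r i \<odot>\<^bsub>N\<^esub> u \<in> J N (Suc k)" if i: "i \<in> {1..d}" for i
  proof -
    let ?x = "r (Suc k) \<odot>\<^bsub>N\<^esub> t i \<ominus>\<^bsub>N\<^esub> r i \<odot>\<^bsub>N\<^esub> u"
    have eq: "r i \<odot>\<^bsub>N\<^esub> u = (\<zero>\<^bsub>N\<^esub> \<ominus>\<^bsub>N\<^esub> ?x) \<oplus>\<^bsub>N\<^esub> r (Suc k) \<odot>\<^bsub>N\<^esub> t i"
      using N.zero_diff_diff_add[OF rt[OF i]] r_closed[OF i] u(1) by simp
    have "\<zero>\<^bsub>N\<^esub> \<ominus>\<^bsub>N\<^esub> ?x \<in> J N k"
      by (rule submodule_ops(4)[OF N sub submodule_ops(2)[OF N sub] u(2)[OF i]])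
    then show ?thesis by (subst eq) (rule J_SucI[OF _ t(1)[OF i]])
  qed
  then show ?thesis using t u by blast
qed

text \<open>If \<open>u\<close> is \<open>r\<^sub>k\<^sub>+\<^sub>1 v\<close> modulo \<open>(r\<^sub>1, \<dots>, r\<^sub>k)\<close>, then \<open>t\<close> minus the relation \<open>(r\<^sub>1 v, \<dots>, r\<^sub>d v)\<close> is killed by
  \<open>r\<^sub>k\<^sub>+\<^sub>1\<close>, hence is zero by regularity.\<close>

lemma connecting_element_injective:
  assumes k: "k < d" and reg: "regular_at N k"
    and t: "\<And>i. i \<in> {1..d} \<Longrightarrow> t i \<in> carrier N" and u: "u \<in> J N (Suc k)"
    and tu: "\<And>i. i \<in> {1..d} \<Longrightarrow> r (Suc k) \<odot>\<^bsub>N\<^esub> t i \<ominus>\<^bsub>N\<^esub> r i \<odot>\<^bsub>N\<^esub> u \<in> J N k"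
  shows "famsum N' {1..d} e t \<in> J N' k"
proof -
  interpret N: module R N by (rule N)
  have rk: "r (Suc k) \<in> carrier R" using k by (intro r_closed) auto
  have sub: "submodule (J N k) R N" using J_submodule[OF N] k by simp
  note ops = submodule_ops[OF N sub]
  obtain x v where x: "u = x \<oplus>\<^bsub>N\<^esub> r (Suc k) \<odot>\<^bsub>N\<^esub> v" "x \<in> J N k" and v: "v \<in> carrier N" using u by auto
  have "t i \<ominus>\<^bsub>N\<^esub> r i \<odot>\<^bsub>N\<^esub> v \<in> J N k" if i: "i \<in> {1..d}" for i
  proof -
    note c = r_closed[OF i] rk t[OF i] v ops(1)[OF x(2)]
    have swap: "r i \<odot>\<^bsub>N\<^esub> (r (Suc k) \<odot>\<^bsub>N\<^esub> v) = r (Suc k) \<odot>\<^bsub>N\<^esub> (r i \<odot>\<^bsub>N\<^esub> v)"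
      using c by (metis N.smult_assoc1 m_comm)
    have "r (Suc k) \<odot>\<^bsub>N\<^esub> (t i \<ominus>\<^bsub>N\<^esub> r i \<odot>\<^bsub>N\<^esub> v) =
        (r (Suc k) \<odot>\<^bsub>N\<^esub> t i \<ominus>\<^bsub>N\<^esub> r i \<odot>\<^bsub>N\<^esub> u) \<oplus>\<^bsub>N\<^esub> r i \<odot>\<^bsub>N\<^esub> x"
    proof -
      have "(r (Suc k) \<odot>\<^bsub>N\<^esub> t i \<ominus>\<^bsub>N\<^esub> r i \<odot>\<^bsub>N\<^esub> u) \<oplus>\<^bsub>N\<^esub> r i \<odot>\<^bsub>N\<^esub> x =
          (r (Suc k) \<odot>\<^bsub>N\<^esub> t i \<ominus>\<^bsub>N\<^esub> r (Suc k) \<odot>\<^bsub>N\<^esub> (r i \<odot>\<^bsub>N\<^esub> v)) \<oplus>\<^bsub>N\<^esub>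
          (r i \<odot>\<^bsub>N\<^esub> x \<oplus>\<^bsub>N\<^esub> \<ominus>\<^bsub>N\<^esub> (r i \<odot>\<^bsub>N\<^esub> x))"
        unfolding x(1) using c
        by (simp add: a_minus_def N.smult_r_distr N.minus_add N.a_ac swap)
      then show ?thesis
        using c by (simp add: N.r_neg a_minus_def N.smult_r_distr N.smult_r_minus)
    qed
    moreover have "\<dots> \<in> J N k" using tu[OF i] ops(3,5) x(2) c(1) by blast
    ultimately have "r (Suc k) \<odot>\<^bsub>N\<^esub> (t i \<ominus>\<^bsub>N\<^esub> r i \<odot>\<^bsub>N\<^esub> v) \<in> J N k" by simp
    moreover have "t i \<ominus>\<^bsub>N\<^esub> r i \<odot>\<^bsub>N\<^esub> v \<in> carrier N" using c by simp
    ultimately show ?thesis using reg unfolding regular_at_def by blast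
  qed
  then show ?thesis using famsum_in_J_iff[of k t, OF less_imp_le[OF k] t] v by blast
qed

text \<open>The connecting element is killed by \<open>r\<^sub>k\<^sub>+\<^sub>2\<close>, which is regular where it lives.\<close>

lemma regular_step:
  assumes k: "Suc k < d" and "regular_at N k" "regular_at N (Suc k)"
  shows "regular_at N' k"
  unfolding regular_at_def
proof (intro ballI impI)
  fix y assume "y \<in> carrier N'" "r (Suc k) \<odot>\<^bsub>N'\<^esub> y \<in> J N' k"
  then obtain t u where *: "\<And>i. i \<in> {1..d} \<Longrightarrow> t i \<in> carrier N" "y = famsum N' {1..d} e t" "u \<in> carrier N"
    "\<And>i. i \<in> {1..d} \<Longrightarrow> r (Suc k) \<odot>\<^bsub>N\<^esub> t i \<ominus>\<^bsub>N\<^esub> r i \<odot>\<^bsub>N\<^esub> u \<in> J N k"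
    "\<And>i. i \<in> {1..d} \<Longrightarrow> r i \<odot>\<^bsub>N\<^esub> u \<in> J N (Suc k)"
    using connecting_element[OF Suc_lessD[OF k], of y] by blast
  have "r (Suc (Suc k)) \<odot>\<^bsub>N\<^esub> u \<in> J N (Suc k)" using k by (intro *(5)) auto
  then have "u \<in> J N (Suc k)" using assms(3) *(3) unfolding regular_at_def by blast
  then show "y \<in> J N' k"
    unfolding *(2) by (intro connecting_element_injective[OF _ assms(2) *(1) _ *(4)]) (use k in auto)
qed

text \<open>The connecting map is linear and injective, so a relation between the connecting elements of \<open>y\<close> and
  \<open>y'\<close> pulls back to \<open>y\<close> and \<open>y'\<close>.\<close>

lemma socle_step:
  assumes k: "k < d" and reg: "regular_at N k" and soc: "socle_cyclic_at N (Suc k)"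
  shows "socle_cyclic_at N' k"
  unfolding socle_cyclic_at_def
proof (intro ballI impI)
  interpret N: module R N by (rule N)
  interpret N': module R N' by (rule N')
  fix y y' assume y: "y \<in> carrier N'" and y': "y' \<in> carrier N'"
    and "\<forall>i\<in>{1..d}. r i \<odot>\<^bsub>N'\<^esub> y \<in> J N' k" "\<forall>i\<in>{1..d}. r i \<odot>\<^bsub>N'\<^esub> y' \<in> J N' k"
  then have ry: "r (Suc k) \<odot>\<^bsub>N'\<^esub> y \<in> J N' k" "r (Suc k) \<odot>\<^bsub>N'\<^esub> y' \<in> J N' k" using k by auto
  obtain t u where t: "\<And>i. i \<in> {1..d} \<Longrightarrow> t i \<in> carrier N" "y = famsum N' {1..d} e t" "u \<in> carrier N"
    "\<And>i. i \<in> {1..d} \<Longrightarrow> r (Suc k) \<odot>\<^bsub>N\<^esub> t i \<ominus>\<^bsub>N\<^esub> r i \<odot>\<^bsub>N\<^esub> u \<in> J N k"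
    "\<And>i. i \<in> {1..d} \<Longrightarrow> r i \<odot>\<^bsub>N\<^esub> u \<in> J N (Suc k)"
    using connecting_element[OF k y ry(1)] by blast
  obtain t' u' where t': "\<And>i. i \<in> {1..d} \<Longrightarrow> t' i \<in> carrier N" "y' = famsum N' {1..d} e t'" "u' \<in> carrier N"
    "\<And>i. i \<in> {1..d} \<Longrightarrow> r (Suc k) \<odot>\<^bsub>N\<^esub> t' i \<ominus>\<^bsub>N\<^esub> r i \<odot>\<^bsub>N\<^esub> u' \<in> J N k"
    "\<And>i. i \<in> {1..d} \<Longrightarrow> r i \<odot>\<^bsub>N\<^esub> u' \<in> J N (Suc k)"
    using connecting_element[OF k y' ry(2)] by blast
  have ru: "\<forall>i\<in>{1..d}. r i \<odot>\<^bsub>N\<^esub> u \<in> J N (Suc k)" "\<forall>i\<in>{1..d}. r i \<odot>\<^bsub>N\<^esub> u' \<in> J N (Suc k)"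
    using t(5) t'(5) by blast+
  have "\<exists>c\<in>carrier R. \<exists>c'\<in>carrier R. c \<odot>\<^bsub>N\<^esub> u \<ominus>\<^bsub>N\<^esub> c' \<odot>\<^bsub>N\<^esub> u' \<in> J N (Suc k) \<and>
       (c' \<in> J (self_module R) d \<longrightarrow> u \<in> J N (Suc k))"
    by (rule soc[unfolded socle_cyclic_at_def, THEN bspec, OF t(3), THEN bspec, OF t'(3),
        THEN mp, OF ru(1), THEN mp, OF ru(2)])
  then obtain c c' where c: "c \<in> carrier R" "c' \<in> carrier R"
    and cu: "c \<odot>\<^bsub>N\<^esub> u \<ominus>\<^bsub>N\<^esub> c' \<odot>\<^bsub>N\<^esub> u' \<in> J N (Suc k)"
    and c': "c' \<in> J (self_module R) d \<Longrightarrow> u \<in> J N (Suc k)"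
    by blast
  have rk: "r (Suc k) \<in> carrier R" using k by (intro r_closed) auto
  have sub: "submodule (J N k) R N" using J_submodule[OF N] k by simp
  note ops = submodule_ops[OF N sub]
  have swap: "a \<odot>\<^bsub>N\<^esub> (b \<odot>\<^bsub>N\<^esub> x) = b \<odot>\<^bsub>N\<^esub> (a \<odot>\<^bsub>N\<^esub> x)"
    if "a \<in> carrier R" "b \<in> carrier R" "x \<in> carrier N" for a b x
    using that by (metis N.smult_assoc1 m_comm)
  have ct: "c \<odot>\<^bsub>N\<^esub> t i \<in> carrier N" "c' \<odot>\<^bsub>N\<^esub> t' i \<in> carrier N" if "i \<in> {1..d}" for i
    using t(1) t'(1) c that by simp_all
  have "c \<odot>\<^bsub>N'\<^esub> y \<ominus>\<^bsub>N'\<^esub> c' \<odot>\<^bsub>N'\<^esub> y' = famsum N' {1..d} e (\<lambda>i. c \<odot>\<^bsub>N\<^esub> t i \<ominus>\<^bsub>N\<^esub> c' \<odot>\<^bsub>N\<^esub> t' i)"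
    unfolding t(2) t'(2)
    using fam_diff[of "\<lambda>i. c \<odot>\<^bsub>N\<^esub> t i" "\<lambda>i. c' \<odot>\<^bsub>N\<^esub> t' i", OF ct(1) ct(2)]
      fam_smult[of c t, OF c(1) t(1)] fam_smult[of c' t', OF c(2) t'(1)]
    by simp
  also have "\<dots> \<in> J N' k"
  proof (rule connecting_element_injective[OF k reg _ cu])
    fix i assume i: "i \<in> {1..d}"
    show "c \<odot>\<^bsub>N\<^esub> t i \<ominus>\<^bsub>N\<^esub> c' \<odot>\<^bsub>N\<^esub> t' i \<in> carrier N" using ct[OF i] by simp
    note cl = c rk r_closed[OF i] t(1)[OF i] t'(1)[OF i] t(3) t'(3)
    have "r (Suc k) \<odot>\<^bsub>N\<^esub> (c \<odot>\<^bsub>N\<^esub> t i \<ominus>\<^bsub>N\<^esub> c' \<odot>\<^bsub>N\<^esub> t' i) \<ominus>\<^bsub>N\<^esub> r i \<odot>\<^bsub>N\<^esub> (c \<odot>\<^bsub>N\<^esub> u \<ominus>\<^bsub>N\<^esub> c' \<odot>\<^bsub>N\<^esub> u') =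
        c \<odot>\<^bsub>N\<^esub> (r (Suc k) \<odot>\<^bsub>N\<^esub> t i \<ominus>\<^bsub>N\<^esub> r i \<odot>\<^bsub>N\<^esub> u) \<ominus>\<^bsub>N\<^esub> c' \<odot>\<^bsub>N\<^esub> (r (Suc k) \<odot>\<^bsub>N\<^esub> t' i \<ominus>\<^bsub>N\<^esub> r i \<odot>\<^bsub>N\<^esub> u')"
      using cl
      by (simp add: a_minus_def N.smult_r_distr N.smult_r_minus N.minus_add N.a_ac N.minus_minus
          swap[of "r (Suc k)" c] swap[of "r (Suc k)" c'] swap[of "r i" c] swap[of "r i" c'])
    also have "\<dots> \<in> J N k" using ops(4,5) c t(4)[OF i] t'(4)[OF i] by blast
    finally show "r (Suc k) \<odot>\<^bsub>N\<^esub> (c \<odot>\<^bsub>N\<^esub> t i \<ominus>\<^bsub>N\<^esub> c' \<odot>\<^bsub>N\<^esub> t' i) \<ominus>\<^bsub>N\<^esub> r i \<odot>\<^bsub>N\<^esub> (c \<odot>\<^bsub>N\<^esub> u \<ominus>\<^bsub>N\<^esub> c' \<odot>\<^bsub>N\<^esub> u')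
      \<in> J N k" .
  qed
  finally have "c \<odot>\<^bsub>N'\<^esub> y \<ominus>\<^bsub>N'\<^esub> c' \<odot>\<^bsub>N'\<^esub> y' \<in> J N' k" .
  moreover have "c' \<in> J (self_module R) d \<longrightarrow> y \<in> J N' k"
    unfolding t(2) by (intro impI connecting_element_injective[OF k reg t(1) c' t(4)])
  ultimately show "\<exists>c\<in>carrier R. \<exists>c'\<in>carrier R. c \<odot>\<^bsub>N'\<^esub> y \<ominus>\<^bsub>N'\<^esub> c' \<odot>\<^bsub>N'\<^esub> y' \<in> J N' k \<and>
      (c' \<in> J (self_module R) d \<longrightarrow> y \<in> J N' k)"
    using c by blast
qed

end

section \<open>The tensor powers form a tower\<close>

text \<open>The module \<open>N\<^sup>I\<close>. Its elements are zero outside \<open>I\<close>, which makes the pointwise operations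
  total.\<close>

definition fun_module :: "'i set \<Rightarrow> ('a, 'b) module \<Rightarrow> ('a, 'i \<Rightarrow> 'b) module" where
  "fun_module I N =
     \<lparr>carrier = {f. (\<forall>i\<in>I. f i \<in> carrier N) \<and> (\<forall>i. i \<notin> I \<longrightarrow> f i = \<zero>\<^bsub>N\<^esub>)},
      monoid.mult = undefined, monoid.one = undefined, ring.zero = (\<lambda>_. \<zero>\<^bsub>N\<^esub>),
      ring.add = (\<lambda>f g i. f i \<oplus>\<^bsub>N\<^esub> g i), smult = (\<lambda>a f i. a \<odot>\<^bsub>N\<^esub> f i)\<rparr>"

lemma fun_module_simps:
  "carrier (fun_module I N) = {f. (\<forall>i\<in>I. f i \<in> carrier N) \<and> (\<forall>i. i \<notin> I \<longrightarrow> f i = \<zero>\<^bsub>N\<^esub>)}"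
  "\<zero>\<^bsub>fun_module I N\<^esub> = (\<lambda>_. \<zero>\<^bsub>N\<^esub>)"
  "f \<oplus>\<^bsub>fun_module I N\<^esub> g = (\<lambda>i. f i \<oplus>\<^bsub>N\<^esub> g i)"
  "a \<odot>\<^bsub>fun_module I N\<^esub> f = (\<lambda>i. a \<odot>\<^bsub>N\<^esub> f i)"
  by (simp_all add: fun_module_def)

lemma fun_module_coord:
  assumes "module R N" "f \<in> carrier (fun_module I N)"
  shows "f i \<in> carrier N"
proof -
  interpret N: module R N by (rule assms(1))
  show ?thesis using assms(2) by (cases "i \<in> I") (simp_all add: fun_module_simps(1))
qed

lemma fun_is_module:
  assumes N: "module R N"
  shows "module R (fun_module I N)"
proof -
  interpret N: module R N by (rule N)
  note cl = fun_module_coord[OF N, where I = I]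
  let ?D = "fun_module I N"
  have neg: "(\<lambda>i. \<ominus>\<^bsub>N\<^esub> f i) \<in> carrier ?D" if "f \<in> carrier ?D" for f
    using that N.minus_equality[of "\<zero>\<^bsub>N\<^esub>" "\<zero>\<^bsub>N\<^esub>"] by (simp add: fun_module_simps(1))
  show ?thesis
  proof (rule moduleI)
    show "abelian_group ?D"
    proof (rule abelian_groupI)
      fix f assume f: "f \<in> carrier ?D"
      have "(\<lambda>i. \<ominus>\<^bsub>N\<^esub> f i) \<oplus>\<^bsub>?D\<^esub> f = \<zero>\<^bsub>?D\<^esub>"
        using cl[OF f] by (simp add: fun_module_simps(2,3) N.l_neg)
      with neg[OF f] show "\<exists>g\<in>carrier ?D. g \<oplus>\<^bsub>?D\<^esub> f = \<zero>\<^bsub>?D\<^esub>" by blast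
      show "\<zero>\<^bsub>?D\<^esub> \<oplus>\<^bsub>?D\<^esub> f = f" using cl[OF f] by (simp add: fun_module_simps(2,3))
      fix g assume g: "g \<in> carrier ?D"
      show "f \<oplus>\<^bsub>?D\<^esub> g \<in> carrier ?D" using f g by (simp add: fun_module_simps(1,3))
      show "f \<oplus>\<^bsub>?D\<^esub> g = g \<oplus>\<^bsub>?D\<^esub> f"
        using cl[OF f] cl[OF g] by (simp add: fun_module_simps(3) N.a_comm)
      fix h assume h: "h \<in> carrier ?D"
      show "f \<oplus>\<^bsub>?D\<^esub> g \<oplus>\<^bsub>?D\<^esub> h = f \<oplus>\<^bsub>?D\<^esub> (g \<oplus>\<^bsub>?D\<^esub> h)"
        using cl[OF f] cl[OF g] cl[OF h] by (simp add: fun_module_simps(3) N.a_assoc)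
    qed (simp add: fun_module_simps(1,2))
  next
    fix a f assume a: "a \<in> carrier R" and f: "f \<in> carrier ?D"
    show "a \<odot>\<^bsub>?D\<^esub> f \<in> carrier ?D" using a f by (simp add: fun_module_simps(1,4))
    {
      fix b assume b: "b \<in> carrier R"
      show "(a \<oplus>\<^bsub>R\<^esub> b) \<odot>\<^bsub>?D\<^esub> f = a \<odot>\<^bsub>?D\<^esub> f \<oplus>\<^bsub>?D\<^esub> b \<odot>\<^bsub>?D\<^esub> f"
        using a b cl[OF f] by (simp add: fun_module_simps(3,4) N.smult_l_distr)
      show "(a \<otimes>\<^bsub>R\<^esub> b) \<odot>\<^bsub>?D\<^esub> f = a \<odot>\<^bsub>?D\<^esub> (b \<odot>\<^bsub>?D\<^esub> f)"
        using a b cl[OF f] by (simp add: fun_module_simps(4) N.smult_assoc1)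
    next
      fix g assume g: "g \<in> carrier ?D"
      show "a \<odot>\<^bsub>?D\<^esub> (f \<oplus>\<^bsub>?D\<^esub> g) = a \<odot>\<^bsub>?D\<^esub> f \<oplus>\<^bsub>?D\<^esub> a \<odot>\<^bsub>?D\<^esub> g"
        using a cl[OF f] cl[OF g] by (simp add: fun_module_simps(3,4) N.smult_r_distr)
    }
  next
    fix f assume f: "f \<in> carrier ?D"
    show "\<one>\<^bsub>R\<^esub> \<odot>\<^bsub>?D\<^esub> f = f" using cl[OF f] by (simp add: fun_module_simps(4))
  qed (rule N.is_cring)
qed

definition single :: "('a, 'b) module \<Rightarrow> 'i \<Rightarrow> 'b \<Rightarrow> 'i \<Rightarrow> 'b" where
  "single N i x = (\<lambda>j. if j = i then x else \<zero>\<^bsub>N\<^esub>)"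

lemma single_linear:
  assumes "module R N" "i \<in> I"
  shows "linear_map R N (fun_module I N) (single N i)"
proof -
  interpret N: module R N by (rule assms(1))
  show ?thesis
    by (rule linear_mapI) (use assms(2) in \<open>auto simp: fun_module_simps single_def fun_eq_iff\<close>)
qed

lemma coord_linear:
  assumes "module R N" "i \<in> I"
  shows "linear_map R (fun_module I N) N (\<lambda>f. f i)"
  by (rule linear_mapI) (use assms(2) in \<open>auto simp: fun_module_simps\<close>)

lemma famsum_single:
  assumes N: "module R N" and I: "finite I" and t: "\<And>i. i \<in> I \<Longrightarrow> t i \<in> carrier N"
  shows "famsum (fun_module I N) I (single N) t = (\<lambda>j. if j \<in> I then t j else \<zero>\<^bsub>N\<^esub>)"
proof
  fix j
  interpret N: module R N by (rule N)
  let ?D = "fun_module I N"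
  note D = fun_is_module[OF N, of I]
  show "famsum ?D I (single N) t j = (if j \<in> I then t j else \<zero>\<^bsub>N\<^esub>)"
  proof (cases "j \<in> I")
    case True
    have "famsum ?D I (single N) t j = famsum N I (\<lambda>i x. single N i x j) t"
      by (rule linear_map_famsum[OF coord_linear[OF N True] D N I single_linear[OF N] t])
    also have "\<dots> = (\<Oplus>\<^bsub>N\<^esub>i\<in>I. if j = i then t i else \<zero>\<^bsub>N\<^esub>)"
      by (simp add: famsum_def single_def)
    also have "\<dots> = t j" by (rule N.finsum_singleton[OF True I]) (use t in auto)
    finally show ?thesis using True by simp
  next
    case False
    have "famsum ?D I (single N) t \<in> carrier ?D"
      by (rule famsum_closed[OF D single_linear[OF N] t])
    then show ?thesis using False by (simp add: fun_module_simps(1))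
  qed
qed

lemma lincomb_eq_famsum:
  assumes P: "module R P" and N: "module R N"
    and f: "\<And>i. i \<in> I \<Longrightarrow> linear_map R N P (f i)"
    and a: "\<And>i. i \<in> I \<Longrightarrow> a i \<in> carrier R" and u: "u \<in> carrier N"
  shows "lincomb P I a (\<lambda>i. f i u) = famsum P I f (\<lambda>i. a i \<odot>\<^bsub>N\<^esub> u)"
proof -
  interpret P: module R P by (rule P)
  interpret N: module R N by (rule N)
  show ?thesis
    unfolding lincomb_def famsum_def
    by (rule P.finsum_cong'[OF refl])
       (use a u linear_map_closed[OF f] linear_map_smult[OF f] in auto)
qed

context ring_sequence
begin

abbreviation adjoin_sum where "adjoin_sum n \<equiv> famsum (T (Suc n)) {1..d} (adjoin n)"

lemma pure_Suc_expand:
  assumes x: "x \<in> tuples (Suc n)"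
  obtains v where "v \<in> carrier F"
    "pure (Suc n) x =
      adjoin_sum n (\<lambda>i. v i \<odot>\<^bsub>T n\<^esub> pure n (restrict x {1..n}))"
proof -
  obtain v where v: "v \<in> carrier F" "x (Suc n) = lincomb M {1..d} v m"
    using M_expand[OF tuples_last[OF x]] by blast
  let ?y = "restrict x {1..n}"
  have y: "?y \<in> tuples n" by (rule tuples_take[OF x])
  note vc = free_coord_closed[OF is_cring v(1)]
  let ?f = "\<lambda>u. pure (Suc n) (x(Suc n := u))"
  have f: "linear_map R M (T (Suc n)) ?f"
    by (rule pure_tensor_slot_linear[OF M_module x]) simp
  have "pure (Suc n) x = ?f (lincomb M {1..d} v m)" by (simp flip: v(2))
  also have "\<dots> = lincomb (T (Suc n)) {1..d} v (\<lambda>i. ?f (m i))"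
    by (rule linear_map_lincomb_image[OF f M_module T_module]) (simp_all add: vc gen_closed)
  also have "\<dots> = lincomb (T (Suc n)) {1..d} v (\<lambda>i. adjoin n i (pure n ?y))"
  proof (rule lincomb_cong[OF T_module])
    fix i assume i: "i \<in> {1..d}"
    show "adjoin n i (pure n ?y) \<in> carrier (T (Suc n))"
      by (rule linear_map_closed[OF adjoin_linear[OF i] pure_tensor_closed[OF M_module y]])
    show "?f (m i) = adjoin n i (pure n ?y)"
      unfolding adjoin_pure[OF i y] by (rule pure_tensor_cong) (auto simp: le_Suc_eq)
  qed (simp_all add: vc)
  also have "\<dots> = adjoin_sum n (\<lambda>i. v i \<odot>\<^bsub>T n\<^esub> pure n ?y)"
    by (rule lincomb_eq_famsum[OF T_module T_module adjoin_linear vc pure_tensor_closed[OF M_module y]])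
  finally show ?thesis using that v(1) by blast
qed

lemma T_Suc_expand:
  assumes "y \<in> carrier (T (Suc n))"
  shows "\<exists>t. (\<forall>i\<in>{1..d}. t i \<in> carrier (T n)) \<and> y = adjoin_sum n t"
  using M_module assms
proof (induction rule: tensor_power_induct)
  case zero
  interpret N: module R "T n" by (rule T_module)
  interpret N': module R "T (Suc n)" by (rule T_module)
  have z: "\<zero>\<^bsub>T n\<^esub> \<in> carrier (T n)" by simp
  have "adjoin_sum n (\<lambda>i. \<zero> \<odot>\<^bsub>T n\<^esub> \<zero>\<^bsub>T n\<^esub>) =
      \<zero> \<odot>\<^bsub>T (Suc n)\<^esub> adjoin_sum n (\<lambda>i. \<zero>\<^bsub>T n\<^esub>)"
    by (rule famsum_smult[OF T_module finite_atLeastAtMost adjoin_linear z zero_closed])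
  also have "\<dots> = \<zero>\<^bsub>T (Suc n)\<^esub>"
    by (rule N'.smult_l_null[OF famsum_closed[OF T_module adjoin_linear z]])
  finally show ?case using N.smult_closed[OF zero_closed z] by metis
next
  case (step u a x)
  interpret N: module R "T n" by (rule T_module)
  interpret N': module R "T (Suc n)" by (rule T_module)
  obtain t where t: "\<And>i. i \<in> {1..d} \<Longrightarrow> t i \<in> carrier (T n)"
    "u = adjoin_sum n t" using step.IH by blast
  let ?p = "pure n (restrict x {1..n})"
  have p: "?p \<in> carrier (T n)"
    by (rule pure_tensor_closed[OF M_module tuples_take[OF step.hyps(3)]])
  obtain v where v: "v \<in> carrier F"
    "pure (Suc n) x = adjoin_sum n (\<lambda>i. v i \<odot>\<^bsub>T n\<^esub> ?p)"
    by (rule pure_Suc_expand[OF step.hyps(3)])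
  have vp: "v i \<odot>\<^bsub>T n\<^esub> ?p \<in> carrier (T n)" for i
    using free_coord_closed[OF is_cring v(1)] p by simp
  have avp: "a \<odot>\<^bsub>T n\<^esub> (v i \<odot>\<^bsub>T n\<^esub> ?p) \<in> carrier (T n)" for i
    using vp step.hyps(2) by simp
  have "u \<oplus>\<^bsub>T (Suc n)\<^esub> a \<odot>\<^bsub>T (Suc n)\<^esub> pure (Suc n) x =
      adjoin_sum n t \<oplus>\<^bsub>T (Suc n)\<^esub>
      adjoin_sum n (\<lambda>i. a \<odot>\<^bsub>T n\<^esub> (v i \<odot>\<^bsub>T n\<^esub> ?p))"
    unfolding v(2) t(2)
    by (simp only: famsum_smult[OF T_module finite_atLeastAtMost adjoin_linear vp step.hyps(2)])
  also have "\<dots> = adjoin_sum n (\<lambda>i. t i \<oplus>\<^bsub>T n\<^esub> a \<odot>\<^bsub>T n\<^esub> (v i \<odot>\<^bsub>T n\<^esub> ?p))"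
    by (rule famsum_add[OF T_module adjoin_linear t(1) avp, symmetric])
  finally have "u \<oplus>\<^bsub>T (Suc n)\<^esub> a \<odot>\<^bsub>T (Suc n)\<^esub> pure (Suc n) x =
      adjoin_sum n (\<lambda>i. t i \<oplus>\<^bsub>T n\<^esub> a \<odot>\<^bsub>T n\<^esub> (v i \<odot>\<^bsub>T n\<^esub> ?p))" .
  moreover have "\<forall>i\<in>{1..d}. t i \<oplus>\<^bsub>T n\<^esub> a \<odot>\<^bsub>T n\<^esub> (v i \<odot>\<^bsub>T n\<^esub> ?p) \<in> carrier (T n)"
    using t(1) avp by simp
  ultimately show ?case
    by (intro exI[where x = "\<lambda>i. t i \<oplus>\<^bsub>T n\<^esub> a \<odot>\<^bsub>T n\<^esub> (v i \<odot>\<^bsub>T n\<^esub> ?p)"] conjI)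
qed

text \<open>On a pure tensor this is linearity of the last slot, applied to \<open>r\<^sub>1 m\<^sub>1 + \<dots> + r\<^sub>d m\<^sub>d = 0\<close>.\<close>

lemma adjoin_relation:
  assumes u: "u \<in> carrier (T n)"
  shows "adjoin_sum n (\<lambda>i. r i \<odot>\<^bsub>T n\<^esub> u) = \<zero>\<^bsub>T (Suc n)\<^esub>"
proof -
  interpret N: module R "T n" by (rule T_module)
  interpret N': module R "T (Suc n)" by (rule T_module)
  have z: "linear_map R (T n) (T (Suc n)) (\<lambda>_. \<zero>\<^bsub>T (Suc n)\<^esub>)"
    by (rule linear_mapI) simp_all
  have "lincomb (T (Suc n)) {1..d} r (\<lambda>i. adjoin n i u) = \<zero>\<^bsub>T (Suc n)\<^esub>"
  proof (rule tensor_power_ext[OF M_module T_module _ z _ u])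
    show "linear_map R (T n) (T (Suc n)) (\<lambda>u. lincomb (T (Suc n)) {1..d} r (\<lambda>i. adjoin n i u))"
      by (rule lincomb_linear_right[OF T_module T_module _ adjoin_linear r_closed]) simp_all
    fix x assume x: "x \<in> tuples n"
    let ?y = "x(Suc n := \<zero>\<^bsub>M\<^esub>)"
    interpret M: module R M by (rule M_module)
    have y: "?y \<in> tuples (Suc n)" by (rule tuples_append[OF x M.zero_closed])
    let ?f = "\<lambda>u. pure (Suc n) (?y(Suc n := u))"
    have f: "linear_map R M (T (Suc n)) ?f"
      by (rule pure_tensor_slot_linear[OF M_module y]) simp
    have "lincomb (T (Suc n)) {1..d} r (\<lambda>i. adjoin n i (pure n x)) =
        lincomb (T (Suc n)) {1..d} r (\<lambda>i. ?f (m i))"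
      by (rule lincomb_cong[OF T_module])
         (simp_all add: r_closed adjoin_pure[OF _ x] linear_map_closed[OF f, simplified] gen_closed)
    also have "\<dots> = ?f (lincomb M {1..d} r m)"
      by (rule linear_map_lincomb_image[OF f M_module T_module, symmetric])
         (simp_all add: r_closed gen_closed)
    also have "\<dots> = \<zero>\<^bsub>T (Suc n)\<^esub>"
      unfolding sum_r_m by (rule linear_map_zero[OF f M_module T_module])
    finally show "lincomb (T (Suc n)) {1..d} r (\<lambda>i. adjoin n i (pure n x)) = \<zero>\<^bsub>T (Suc n)\<^esub>" .
  qed
  then show ?thesis
    using lincomb_eq_famsum[where I = "{1..d}" and f = "adjoin n" and a = r, OF T_module T_module adjoin_linear r_closed u]
    by simp
qed

text \<open>Right exactness of tensoring with \<open>T n\<close>. If the sum vanishes, compare with the quotient of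
  \<open>(T n)\<^sup>d\<close> by the submodule \<open>G\<close> of the tuples \<open>(r\<^sub>1 u, \<dots>, r\<^sub>d u)\<close>: by the universal property it
  receives a map from \<open>T (Suc n)\<close>, which returns the class of \<open>t\<close>.\<close>

lemma T_famsum_zero_iff:
  assumes t: "\<And>i. i \<in> {1..d} \<Longrightarrow> t i \<in> carrier (T n)"
  shows "adjoin_sum n t = \<zero>\<^bsub>T (Suc n)\<^esub> \<longleftrightarrow>
    (\<exists>u\<in>carrier (T n). \<forall>i\<in>{1..d}. t i = r i \<odot>\<^bsub>T n\<^esub> u)"
proof
  assume "\<exists>u\<in>carrier (T n). \<forall>i\<in>{1..d}. t i = r i \<odot>\<^bsub>T n\<^esub> u"
  then obtain u where u: "u \<in> carrier (T n)" "\<And>i. i \<in> {1..d} \<Longrightarrow> t i = r i \<odot>\<^bsub>T n\<^esub> u" by blast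
  interpret N: module R "T n" by (rule T_module)
  have "adjoin_sum n t =
      adjoin_sum n (\<lambda>i. r i \<odot>\<^bsub>T n\<^esub> u)"
    by (rule famsum_cong[OF T_module adjoin_linear]) (use u r_closed in simp_all)
  then show "adjoin_sum n t = \<zero>\<^bsub>T (Suc n)\<^esub>"
    using adjoin_relation[OF u(1)] by simp
next
  assume zero: "adjoin_sum n t = \<zero>\<^bsub>T (Suc n)\<^esub>"
  interpret N: module R "T n" by (rule T_module)
  let ?D = "fun_module {1..d} (T n)"
  have D: "module R ?D" by (rule fun_is_module[OF T_module])
  let ?g = "\<lambda>u. famsum ?D {1..d} (single (T n)) (\<lambda>i. r i \<odot>\<^bsub>T n\<^esub> u)"
  have sl: "\<And>i. i \<in> {1..d} \<Longrightarrow> linear_map R (T n) ?D (single (T n) i)"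
    by (rule single_linear[OF T_module])
  have "linear_map R (T n) ?D (\<lambda>u. lincomb ?D {1..d} r (\<lambda>i. single (T n) i u))"
    by (rule lincomb_linear_right[OF T_module D _ sl r_closed]) simp_all
  then have g: "linear_map R (T n) ?D ?g"
    by (rule linear_map_cong[OF _ T_module]) (rule lincomb_eq_famsum[OF D T_module sl r_closed, symmetric])
  define G where "G = ?g ` carrier (T n)"
  have G: "submodule G R ?D" unfolding G_def by (rule image_submodule[OF g T_module D])
  let ?Q = "quot_module ?D G"
  have Q: "module R ?Q" by (rule quot_is_module[OF D G])
  note pr = quot_proj_linear[OF D G]
  have lin: "\<And>i. i \<in> {1..d} \<Longrightarrow> linear_map R (T n) ?Q (\<lambda>u. G +>\<^bsub>?D\<^esub> single (T n) i u)"
    by (rule linear_map_comp[OF sl pr])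
  have "\<exists>h. linear_map R (T (Suc n)) ?Q h \<and>
      (\<forall>i\<in>{1..d}. \<forall>t\<in>carrier (T n). h (adjoin n i t) = G +>\<^bsub>?D\<^esub> single (T n) i t)"
  proof (rule tower_universal[OF Q lin])
    fix u assume u: "u \<in> carrier (T n)"
    have "lincomb ?Q {1..d} r (\<lambda>i. G +>\<^bsub>?D\<^esub> single (T n) i u) =
        G +>\<^bsub>?D\<^esub> lincomb ?D {1..d} r (\<lambda>i. single (T n) i u)"
      by (rule linear_map_lincomb_image[OF pr D Q _ r_closed linear_map_closed[OF sl u], symmetric])
         simp_all
    also have "\<dots> = G +>\<^bsub>?D\<^esub> ?g u"
      using lincomb_eq_famsum[where I = "{1..d}" and f = "single (T n)" and a = r, OF D T_module sl r_closed u] by simp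
    also have "\<dots> = \<zero>\<^bsub>?Q\<^esub>"
      unfolding quot_eq_zero_iff[OF D G linear_map_closed[OF g u]] unfolding G_def by (rule imageI[OF u])
    finally show "lincomb ?Q {1..d} r (\<lambda>i. G +>\<^bsub>?D\<^esub> single (T n) i u) = \<zero>\<^bsub>?Q\<^esub>" .
  qed
  then obtain h where h: "linear_map R (T (Suc n)) ?Q h"
    "\<And>i t. \<lbrakk>i \<in> {1..d}; t \<in> carrier (T n)\<rbrakk> \<Longrightarrow> h (adjoin n i t) = G +>\<^bsub>?D\<^esub> single (T n) i t"
    by blast
  have st: "famsum ?D {1..d} (single (T n)) t \<in> carrier ?D" by (rule famsum_closed[OF D sl t])
  have "G +>\<^bsub>?D\<^esub> famsum ?D {1..d} (single (T n)) t =
      famsum ?Q {1..d} (\<lambda>i x. G +>\<^bsub>?D\<^esub> single (T n) i x) t"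
    by (rule linear_map_famsum[OF pr D Q finite_atLeastAtMost sl t])
  also have "\<dots> = famsum ?Q {1..d} (\<lambda>i x. h (adjoin n i x)) t"
  proof -
    interpret Q: module R ?Q by (rule Q)
    show ?thesis
      unfolding famsum_def
      by (rule Q.finsum_cong'[OF refl])
         (use t h(2) linear_map_closed[OF h(1) linear_map_closed[OF adjoin_linear]] in auto)
  qed
  also have "\<dots> = h (adjoin_sum n t)"
    by (rule linear_map_famsum[OF h(1) T_module Q finite_atLeastAtMost adjoin_linear t, symmetric])
  also have "\<dots> = \<zero>\<^bsub>?Q\<^esub>" unfolding zero by (rule linear_map_zero[OF h(1) T_module Q])
  finally have "famsum ?D {1..d} (single (T n)) t \<in> G"
    unfolding quot_eq_zero_iff[OF D G st] .
  then obtain u where u: "famsum ?D {1..d} (single (T n)) t = ?g u" "u \<in> carrier (T n)"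
    unfolding G_def by (rule imageE)
  have ru: "\<And>i. i \<in> {1..d} \<Longrightarrow> r i \<odot>\<^bsub>T n\<^esub> u \<in> carrier (T n)" using r_closed u(2) by simp
  have "famsum ?D {1..d} (single (T n)) t = (\<lambda>j. if j \<in> {1..d} then t j else \<zero>\<^bsub>T n\<^esub>)"
    by (rule famsum_single[OF T_module finite_atLeastAtMost t])
  moreover have "?g u = (\<lambda>j. if j \<in> {1..d} then r j \<odot>\<^bsub>T n\<^esub> u else \<zero>\<^bsub>T n\<^esub>)"
    by (rule famsum_single[OF T_module finite_atLeastAtMost ru])
  ultimately have eq: "(\<lambda>j. if j \<in> {1..d} then t j else \<zero>\<^bsub>T n\<^esub>) =
      (\<lambda>j. if j \<in> {1..d} then r j \<odot>\<^bsub>T n\<^esub> u else \<zero>\<^bsub>T n\<^esub>)"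
    using u(1) by simp
  have "t i = r i \<odot>\<^bsub>T n\<^esub> u" if "i \<in> {1..d}" for i
    using fun_cong[OF eq, of i] that by simp
  then show "\<exists>u\<in>carrier (T n). \<forall>i\<in>{1..d}. t i = r i \<odot>\<^bsub>T n\<^esub> u" using u(2) by blast
qed

lemma tower_step_T: "tower_step R d r (T n) (T (Suc n)) (adjoin n)"
  by (intro tower_step.intro tower_step_axioms.intro ring_sequence_axioms T_module adjoin_linear
      T_Suc_expand T_famsum_zero_iff)

section \<open>The bottom of the tower\<close>

text \<open>The empty tensor power is free of rank one, generated by the empty tensor.\<close>

lemma T_0_iso:
  obtains \<phi> p where "linear_map R (T 0) (self_module R) \<phi>" "p \<in> carrier (T 0)" "\<phi> p = \<one>"
    "\<And>t. t \<in> carrier (T 0) \<Longrightarrow> t = \<phi> t \<odot>\<^bsub>T 0\<^esub> p"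
proof -
  interpret N: module R "T 0" by (rule T_module)
  note S = self_is_module[OF is_cring]
  let ?x = "\<lambda>_::nat. undefined :: (nat \<Rightarrow> 'a) set"
  let ?p = "pure 0 ?x"
  have x: "?x \<in> tuples 0" by simp
  have p: "?p \<in> carrier (T 0)" by (rule pure_tensor_closed[OF M_module x])
  have "multilinear R M 0 (self_module R) (\<lambda>_. \<one>)" by (simp add: multilinear_def)
  from tensor_power_universal[OF M_module S this] obtain \<phi> where
    \<phi>: "linear_map R (T 0) (self_module R) \<phi>" "\<forall>x\<in>tuples 0. \<phi> (pure 0 x) = \<one>" by blast
  have \<phi>p: "\<phi> ?p = \<one>" using \<phi>(2) x by blast
  have \<phi>c: "\<And>t. t \<in> carrier (T 0) \<Longrightarrow> \<phi> t \<in> carrier R" using linear_map_closed[OF \<phi>(1)] by simp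
  have lin: "linear_map R (T 0) (T 0) (\<lambda>t. \<phi> t \<odot>\<^bsub>T 0\<^esub> ?p)"
    by (rule linear_mapI)
       (use p \<phi>c linear_map_add[OF \<phi>(1)] linear_map_smult[OF \<phi>(1)] in
         \<open>simp_all add: N.smult_l_distr N.smult_assoc1\<close>)
  have "t = \<phi> t \<odot>\<^bsub>T 0\<^esub> ?p" if t: "t \<in> carrier (T 0)" for t
  proof (rule tensor_power_ext[OF M_module T_module linear_map_id lin _ t])
    fix x assume "x \<in> tuples 0"
    then have "x = ?x" by simp
    then show "pure 0 x = \<phi> (pure 0 x) \<odot>\<^bsub>T 0\<^esub> ?p" using \<phi>p p by simp
  qed
  with that[OF \<phi>(1) p \<phi>p] show ?thesis by blast
qed

lemma J_self_module_ideal: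
  assumes "k \<le> d"
  shows "J (self_module R) k = Idl (r ` {1..k})"
proof -
  note S = self_is_module[OF is_cring]
  have rk: "r ` {1..k} \<subseteq> carrier R" if "k \<le> d" for k using r_closed that by auto
  show ?thesis
    using assms
  proof (induction k)
    case 0
    have "Idl ({} :: 'a set) = {\<zero>}"
      using genideal_minimal[OF zeroideal, of "{}"] genideal_ideal[of "{}"]
        additive_subgroup.zero_closed[OF ideal.axioms(1)] by blast
    then show ?case by simp
  next
    case (Suc k)
    interpret I: ideal "Idl (r ` {1..Suc k})" R by (rule genideal_ideal[OF rk[OF Suc.prems]])
    have sub: "r ` {1..Suc k} \<subseteq> Idl (r ` {1..Suc k})" by (rule genideal_self[OF rk[OF Suc.prems]])
    have "Idl (r ` {1..k}) \<subseteq> Idl (r ` {1..Suc k})"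
      by (rule genideal_minimal[OF I.ideal_axioms]) (use sub in auto)
    then have *: "J (self_module R) k \<subseteq> Idl (r ` {1..Suc k})" using Suc by simp
    show ?case
    proof (rule equalityI)
      show "J (self_module R) (Suc k) \<subseteq> Idl (r ` {1..Suc k})"
      proof
        fix y assume "y \<in> J (self_module R) (Suc k)"
        then obtain x u where y: "y = x \<oplus> r (Suc k) \<otimes> u" "x \<in> J (self_module R) k" "u \<in> carrier R"
          by auto
        have "r (Suc k) \<otimes> u \<in> Idl (r ` {1..Suc k})"
          by (rule I.I_r_closed[OF _ y(3)]) (use sub in auto)
        then show "y \<in> Idl (r ` {1..Suc k})" unfolding y(1) using * y(2) I.a_closed by blast
      qed
      have J: "submodule (J (self_module R) (Suc k)) R (self_module R)"
        by (rule J_submodule[OF S Suc.prems])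
      note ops = submodule_ops[OF S J]
      have idl: "ideal (J (self_module R) (Suc k)) R"
      proof (rule idealI[OF ring_axioms])
        show "subgroup (J (self_module R) (Suc k)) (add_monoid R)"
        proof (rule add.subgroupI)
          show "J (self_module R) (Suc k) \<subseteq> carrier R" using ops(1) unfolding self_module_simps(1) by blast
          show "J (self_module R) (Suc k) \<noteq> {}" using ops(2) by blast
          fix a assume a: "a \<in> J (self_module R) (Suc k)"
          have "a \<in> carrier R" using ops(1)[OF a] by simp
          then have "(\<ominus> \<one>) \<odot>\<^bsub>self_module R\<^esub> a = \<ominus> a" by (simp add: l_minus)
          then show "\<ominus> a \<in> J (self_module R) (Suc k)" using ops(5)[OF a_inv_closed[OF one_closed] a] by (simp del: head_mult.simps)
          fix b assume b: "b \<in> J (self_module R) (Suc k)"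
          show "a \<oplus> b \<in> J (self_module R) (Suc k)" using ops(3)[OF a b] by (simp del: head_mult.simps)
        qed
        fix a x assume a: "a \<in> J (self_module R) (Suc k)" and x: "x \<in> carrier R"
        show xa: "x \<otimes> a \<in> J (self_module R) (Suc k)" using ops(5)[OF x a] by (simp del: head_mult.simps)
        have "a \<otimes> x = x \<otimes> a" using ops(1)[OF a] x by (simp add: m_comm)
        then show "a \<otimes> x \<in> J (self_module R) (Suc k)" using xa by (simp del: head_mult.simps)
      qed
      show "Idl (r ` {1..Suc k}) \<subseteq> J (self_module R) (Suc k)"
      proof (rule genideal_minimal[OF idl], rule image_subsetI)
        fix i assume i: "i \<in> {1..Suc k}"
        show "r i \<in> J (self_module R) (Suc k)"
        proof (cases "i = Suc k")
          case True
          have "\<zero> \<in> J (self_module R) k"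
            using submodule_ops(2)[OF S J_submodule[OF S Suc_leD[OF Suc.prems]]] by simp
          from J_SucI[OF this, of \<one>] show ?thesis
            using True r_closed Suc.prems by (simp del: head_mult.simps)
        next
          case False
          then have "i \<in> {1..k}" using i by auto
          then have "r i \<in> J (self_module R) k"
            using Suc genideal_self[OF rk[OF Suc_leD[OF Suc.prems]]] by auto
          then show ?thesis by (rule J_Suc_mono[OF S Suc.prems])
        qed
      qed
    qed
  qed
qed

lemma regular_T_0:
  assumes reg: "regular_sequence R d r" and k: "k < d"
  shows "regular_at (T 0) k"
  unfolding regular_at_def
proof (intro ballI impI)
  note S = self_is_module[OF is_cring]
  interpret N: module R "T 0" by (rule T_module)
  fix t assume t: "t \<in> carrier (T 0)" and rt: "r (Suc k) \<odot>\<^bsub>T 0\<^esub> t \<in> J (T 0) k"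
  obtain \<phi> p where \<phi>: "linear_map R (T 0) (self_module R) \<phi>" and p: "p \<in> carrier (T 0)"
    and "\<phi> p = \<one>" and inv: "\<And>t. t \<in> carrier (T 0) \<Longrightarrow> t = \<phi> t \<odot>\<^bsub>T 0\<^esub> p"
    by (rule T_0_iso) blast
  have rk: "r (Suc k) \<in> carrier R" by (rule r_closed) (use k in auto)
  have \<phi>t: "\<phi> t \<in> carrier R" using linear_map_closed[OF \<phi> t] by simp
  let ?I = "Idl (r ` {1..<Suc k})"
  have I: "?I = J (self_module R) k"
    using J_self_module_ideal[of k] k by (simp add: atLeastLessThanSuc_atLeastAtMost)
  have sub: "submodule ?I R (self_module R)" unfolding I by (rule J_submodule[OF S]) (use k in simp)
  have "r (Suc k) \<otimes> \<phi> t \<in> ?I"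
    using J_image[OF T_module S \<phi> less_imp_le[OF k] rt] linear_map_smult[OF \<phi> rk t] I by simp
  then have "r (Suc k) \<odot>\<^bsub>cyclic_module R ?I\<^esub> (?I +>\<^bsub>self_module R\<^esub> \<phi> t) = \<zero>\<^bsub>cyclic_module R ?I\<^esub>"
    unfolding cyclic_module_def using rk \<phi>t quot_smult[OF S sub rk, of "\<phi> t"]
      quot_eq_zero_iff[OF S sub, of "r (Suc k) \<otimes> \<phi> t"] by simp
  moreover have "?I +>\<^bsub>self_module R\<^esub> \<phi> t \<in> carrier (cyclic_module R ?I)"
    unfolding cyclic_module_def quot_carrier by (rule imageI) (simp add: \<phi>t)
  moreover have "Suc k \<in> {1..d}" using k by simp
  ultimately have "?I +>\<^bsub>self_module R\<^esub> \<phi> t = \<zero>\<^bsub>cyclic_module R ?I\<^esub>"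
    using reg unfolding regular_sequence_def Let_def by blast
  then have "\<phi> t \<in> J (self_module R) k"
    unfolding cyclic_module_def using quot_eq_zero_iff[OF S sub, of "\<phi> t"] \<phi>t I by simp
  moreover have "linear_map R (self_module R) (T 0) (\<lambda>a. a \<odot>\<^bsub>T 0\<^esub> p)"
    by (rule linear_mapI) (use p in \<open>simp_all add: N.smult_l_distr N.smult_assoc1\<close>)
  ultimately have "\<phi> t \<odot>\<^bsub>T 0\<^esub> p \<in> J (T 0) k"
    using J_image[OF S T_module _ less_imp_le[OF k]] by blast
  then show "t \<in> J (T 0) k" using inv[OF t] by simp
qed

text \<open>With the rank-one coordinate \<open>\<phi>\<close>, the multipliers \<open>\<phi> t'\<close> and \<open>\<phi> t\<close> work by commutativity.\<close>

lemma socle_T_0: "socle_cyclic_at (T 0) d"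
  unfolding socle_cyclic_at_def
proof (intro ballI impI)
  note S = self_is_module[OF is_cring]
  interpret N: module R "T 0" by (rule T_module)
  fix t t' assume t: "t \<in> carrier (T 0)" and t': "t' \<in> carrier (T 0)"
  obtain \<phi> p where \<phi>: "linear_map R (T 0) (self_module R) \<phi>" and p: "p \<in> carrier (T 0)"
    and "\<phi> p = \<one>" and inv: "\<And>t. t \<in> carrier (T 0) \<Longrightarrow> t = \<phi> t \<odot>\<^bsub>T 0\<^esub> p"
    by (rule T_0_iso) blast
  have c: "\<phi> t \<in> carrier R" "\<phi> t' \<in> carrier R"
    using linear_map_closed[OF \<phi> t] linear_map_closed[OF \<phi> t'] by simp_all
  have lin: "linear_map R (self_module R) (T 0) (\<lambda>a. a \<odot>\<^bsub>T 0\<^esub> p)"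
    by (rule linear_mapI) (use p in \<open>simp_all add: N.smult_l_distr N.smult_assoc1\<close>)
  have "\<phi> t' \<odot>\<^bsub>T 0\<^esub> t = (\<phi> t' \<otimes> \<phi> t) \<odot>\<^bsub>T 0\<^esub> p"
    using inv[OF t] c p by (metis N.smult_assoc1)
  also have "\<dots> = (\<phi> t \<otimes> \<phi> t') \<odot>\<^bsub>T 0\<^esub> p" using c by (simp add: m_comm)
  also have "\<dots> = \<phi> t \<odot>\<^bsub>T 0\<^esub> t'" using inv[OF t'] c p by (metis N.smult_assoc1)
  finally have "\<phi> t' \<odot>\<^bsub>T 0\<^esub> t \<ominus>\<^bsub>T 0\<^esub> \<phi> t \<odot>\<^bsub>T 0\<^esub> t' = \<zero>\<^bsub>T 0\<^esub>"
    using module_diff_eq_zero_iff[OF T_module] c t t' by simp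
  then have "\<phi> t' \<odot>\<^bsub>T 0\<^esub> t \<ominus>\<^bsub>T 0\<^esub> \<phi> t \<odot>\<^bsub>T 0\<^esub> t' \<in> J (T 0) d"
    using submodule_ops(2)[OF T_module J_submodule[OF T_module le_refl]] by simp
  moreover have "\<phi> t \<in> J (self_module R) d \<longrightarrow> t \<in> J (T 0) d"
    using J_image[OF S T_module lin le_refl, of "\<phi> t"] inv[OF t] by simp
  ultimately show "\<exists>c\<in>carrier R. \<exists>c'\<in>carrier R. c \<odot>\<^bsub>T 0\<^esub> t \<ominus>\<^bsub>T 0\<^esub> c' \<odot>\<^bsub>T 0\<^esub> t' \<in> J (T 0) d \<and>
      (c' \<in> J (self_module R) d \<longrightarrow> t \<in> J (T 0) d)"
    using c by blast
qed

lemma regular_T: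
  assumes "regular_sequence R d r" "n + k < d"
  shows "regular_at (T n) k"
  using assms(2)
proof (induction n arbitrary: k)
  case 0
  then show ?case using regular_T_0[OF assms(1)] by simp
next
  case (Suc n)
  show ?case
    by (rule tower_step.regular_step[OF tower_step_T]) (use Suc in auto)
qed

lemma socle_T:
  assumes "regular_sequence R d r" "n + k = d"
  shows "socle_cyclic_at (T n) k"
  using assms(2)
proof (induction n arbitrary: k)
  case 0
  then show ?case using socle_T_0 by simp
next
  case (Suc n)
  show ?case
    by (rule tower_step.socle_step[OF tower_step_T]) (use Suc regular_T[OF assms(1)] in auto)
qed

end

section \<open>Torsion in the tensor powers is killed by powers of the sequence\<close>

context ring_sequence
begin

text \<open>The functional \<open>m\<^sub>i \<mapsto> r\<^sub>j\<close>, \<open>m\<^sub>j \<mapsto> - r\<^sub>i\<close> (and zero on the other generators) respects the relation of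
  \<open>M\<close> because \<open>r\<^sub>i r\<^sub>j - r\<^sub>j r\<^sub>i = 0\<close>. Contracting the last tensor slot against it gives the map \<open>D\<close>.\<close>

lemma koszul_contraction:
  assumes i: "i \<in> {1..d}" and j: "j \<in> {1..d}"
  shows "\<exists>D. linear_map R (T (Suc n)) (T n) D \<and>
    (\<forall>t. (\<forall>l\<in>{1..d}. t l \<in> carrier (T n)) \<longrightarrow>
       D (adjoin_sum n t) = r j \<odot>\<^bsub>T n\<^esub> t i \<ominus>\<^bsub>T n\<^esub> r i \<odot>\<^bsub>T n\<^esub> t j)"
proof -
  interpret N: module R "T n" by (rule T_module)
  have ri: "r i \<in> carrier R" and rj: "r j \<in> carrier R" using r_closed i j by blast+
  define g where "g l u = (if i = l then r j \<odot>\<^bsub>T n\<^esub> u else \<zero>\<^bsub>T n\<^esub>) \<oplus>\<^bsub>T n\<^esub>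
    (if j = l then \<ominus>\<^bsub>T n\<^esub> (r i \<odot>\<^bsub>T n\<^esub> u) else \<zero>\<^bsub>T n\<^esub>)" for l u
  have sw: "a \<odot>\<^bsub>T n\<^esub> (b \<odot>\<^bsub>T n\<^esub> x) = b \<odot>\<^bsub>T n\<^esub> (a \<odot>\<^bsub>T n\<^esub> x)"
    if "a \<in> carrier R" "b \<in> carrier R" "x \<in> carrier (T n)" for a b x
    using that by (metis N.smult_assoc1 m_comm)
  have g: "linear_map R (T n) (T n) (g l)" for l
  proof (rule linear_mapI)
    fix x assume x: "x \<in> carrier (T n)"
    show "g l x \<in> carrier (T n)" using ri rj x by (simp add: g_def)
    fix y assume y: "y \<in> carrier (T n)"
    show "g l (x \<oplus>\<^bsub>T n\<^esub> y) = g l x \<oplus>\<^bsub>T n\<^esub> g l y"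
      using ri rj x y
      by (cases "i = l"; cases "j = l"; simp add: g_def N.smult_r_distr N.minus_add N.a_ac)
  next
    fix a x assume a: "a \<in> carrier R" and x: "x \<in> carrier (T n)"
    show "g l (a \<odot>\<^bsub>T n\<^esub> x) = a \<odot>\<^bsub>T n\<^esub> g l x"
      using ri rj x a sw[OF rj a x] sw[OF ri a x]
      by (cases "i = l"; cases "j = l"; simp add: g_def N.smult_r_distr N.smult_r_minus)
  qed
  have sum: "famsum (T n) {1..d} g t = r j \<odot>\<^bsub>T n\<^esub> t i \<ominus>\<^bsub>T n\<^esub> r i \<odot>\<^bsub>T n\<^esub> t j"
    if t: "\<forall>l\<in>{1..d}. t l \<in> carrier (T n)" for t
  proof -
    have "famsum (T n) {1..d} g t =
        (\<Oplus>\<^bsub>T n\<^esub>l\<in>{1..d}. if i = l then r j \<odot>\<^bsub>T n\<^esub> t l else \<zero>\<^bsub>T n\<^esub>) \<oplus>\<^bsub>T n\<^esub>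
        (\<Oplus>\<^bsub>T n\<^esub>l\<in>{1..d}. if j = l then \<ominus>\<^bsub>T n\<^esub> (r i \<odot>\<^bsub>T n\<^esub> t l) else \<zero>\<^bsub>T n\<^esub>)"
      unfolding famsum_def g_def by (rule N.finsum_addf) (use t ri rj in auto)
    also have "(\<Oplus>\<^bsub>T n\<^esub>l\<in>{1..d}. if i = l then r j \<odot>\<^bsub>T n\<^esub> t l else \<zero>\<^bsub>T n\<^esub>) = r j \<odot>\<^bsub>T n\<^esub> t i"
      by (rule N.finsum_singleton[OF i]) (use t rj in auto)
    also have "(\<Oplus>\<^bsub>T n\<^esub>l\<in>{1..d}. if j = l then \<ominus>\<^bsub>T n\<^esub> (r i \<odot>\<^bsub>T n\<^esub> t l) else \<zero>\<^bsub>T n\<^esub>) =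
        \<ominus>\<^bsub>T n\<^esub> (r i \<odot>\<^bsub>T n\<^esub> t j)"
      by (rule N.finsum_singleton[OF j]) (use t ri in auto)
    finally show ?thesis by (simp add: a_minus_def)
  qed
  have "\<exists>D. linear_map R (T (Suc n)) (T n) D \<and>
      (\<forall>l\<in>{1..d}. \<forall>t\<in>carrier (T n). D (adjoin n l t) = g l t)"
  proof (rule tower_universal[OF T_module g])
    fix u assume u: "u \<in> carrier (T n)"
    have "lincomb (T n) {1..d} r (\<lambda>l. g l u) = famsum (T n) {1..d} g (\<lambda>l. r l \<odot>\<^bsub>T n\<^esub> u)"
      by (rule lincomb_eq_famsum[OF T_module T_module g r_closed u])
    also have "\<dots> = r j \<odot>\<^bsub>T n\<^esub> (r i \<odot>\<^bsub>T n\<^esub> u) \<ominus>\<^bsub>T n\<^esub> r i \<odot>\<^bsub>T n\<^esub> (r j \<odot>\<^bsub>T n\<^esub> u)"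
      by (rule sum) (use r_closed u in simp)
    also have "\<dots> = \<zero>\<^bsub>T n\<^esub>"
      unfolding sw[OF rj ri u] using ri rj u by (simp add: module_diff_eq_zero_iff[OF T_module])
    finally show "lincomb (T n) {1..d} r (\<lambda>l. g l u) = \<zero>\<^bsub>T n\<^esub>" .
  qed
  then obtain D where D: "linear_map R (T (Suc n)) (T n) D"
    "\<And>l t. \<lbrakk>l \<in> {1..d}; t \<in> carrier (T n)\<rbrakk> \<Longrightarrow> D (adjoin n l t) = g l t" by blast
  have "D (adjoin_sum n t) = r j \<odot>\<^bsub>T n\<^esub> t i \<ominus>\<^bsub>T n\<^esub> r i \<odot>\<^bsub>T n\<^esub> t j"
    if t: "\<forall>l\<in>{1..d}. t l \<in> carrier (T n)" for t
  proof -
    have "D (adjoin_sum n t) = famsum (T n) {1..d} (\<lambda>l x. D (adjoin n l x)) t"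
      by (rule linear_map_famsum[OF D(1) T_module T_module finite_atLeastAtMost adjoin_linear])
         (use t in auto)
    also have "\<dots> = famsum (T n) {1..d} g t"
      unfolding famsum_def
      by (rule N.finsum_cong'[OF refl]) (use t D(2) linear_map_closed[OF g] in auto)
    finally show ?thesis using sum[OF t] by simp
  qed
  with D(1) show ?thesis by blast
qed

text \<open>After inversion of \<open>r\<^sub>j\<close> the tensor powers become free, so functionals separate their elements up to
  powers of \<open>r\<^sub>j\<close>. In terms of elements: a contraction \<open>r\<^sub>j t\<^sub>i - r\<^sub>i t\<^sub>j\<close> of \<open>x\<close> is again killed by all
  functionals, hence by \<open>r\<^sub>j\<^sup>n\<close>, so \<open>r\<^sub>j\<^sup>n\<^sup>+\<^sup>1 t\<^sub>i = r\<^sub>i (r\<^sub>j\<^sup>n t\<^sub>j)\<close> for all \<open>i\<close>; such a tuple is a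
  relation.\<close>

lemma functional_kernel_power_torsion:
  assumes j: "j \<in> {1..d}" and x: "x \<in> carrier (T n)"
    and kill: "\<And>\<phi>. linear_map R (T n) (self_module R) \<phi> \<Longrightarrow> \<phi> x = \<zero>"
  shows "(r j [^] n) \<odot>\<^bsub>T n\<^esub> x = \<zero>\<^bsub>T n\<^esub>"
  using x kill
proof (induction n arbitrary: x)
  case 0
  interpret N: module R "T 0" by (rule T_module)
  obtain \<phi> p where \<phi>: "linear_map R (T 0) (self_module R) \<phi>" and p: "p \<in> carrier (T 0)"
    and "\<phi> p = \<one>" and inv: "\<And>t. t \<in> carrier (T 0) \<Longrightarrow> t = \<phi> t \<odot>\<^bsub>T 0\<^esub> p"
    by (rule T_0_iso) blast
  have "x = \<zero> \<odot>\<^bsub>T 0\<^esub> p" using inv[OF 0(1)] 0(2)[OF \<phi>] by simp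
  then show ?case using p by simp
next
  case (Suc n)
  interpret N: module R "T n" by (rule T_module)
  have rj: "r j \<in> carrier R" by (rule r_closed[OF j])
  obtain t where t: "\<forall>l\<in>{1..d}. t l \<in> carrier (T n)" "x = adjoin_sum n t"
    using T_Suc_expand[OF Suc.prems(1)] by blast
  let ?c = "r j [^] n"
  have c: "?c \<in> carrier R" using rj by simp
  have tj: "t j \<in> carrier (T n)" using t(1) j by blast
  have eq: "(r j [^] Suc n) \<odot>\<^bsub>T n\<^esub> t i = r i \<odot>\<^bsub>T n\<^esub> (?c \<odot>\<^bsub>T n\<^esub> t j)" if i: "i \<in> {1..d}" for i
  proof -
    have ti: "t i \<in> carrier (T n)" and ri: "r i \<in> carrier R" using t(1) i r_closed by blast+
    obtain D where D: "linear_map R (T (Suc n)) (T n) D"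
      "D x = r j \<odot>\<^bsub>T n\<^esub> t i \<ominus>\<^bsub>T n\<^esub> r i \<odot>\<^bsub>T n\<^esub> t j"
      using koszul_contraction[OF i j, of n] t by blast
    have "?c \<odot>\<^bsub>T n\<^esub> D x = \<zero>\<^bsub>T n\<^esub>"
      by (rule Suc.IH[OF linear_map_closed[OF D(1) Suc.prems(1)]])
         (rule Suc.prems(2)[OF linear_map_comp[OF D(1)]])
    then have "?c \<odot>\<^bsub>T n\<^esub> (r j \<odot>\<^bsub>T n\<^esub> t i) \<ominus>\<^bsub>T n\<^esub> ?c \<odot>\<^bsub>T n\<^esub> (r i \<odot>\<^bsub>T n\<^esub> t j) = \<zero>\<^bsub>T n\<^esub>"
      unfolding D(2) using c rj ri ti tj by (simp add: a_minus_def N.smult_r_distr N.smult_r_minus)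
    then have "?c \<odot>\<^bsub>T n\<^esub> (r j \<odot>\<^bsub>T n\<^esub> t i) = ?c \<odot>\<^bsub>T n\<^esub> (r i \<odot>\<^bsub>T n\<^esub> t j)"
      using module_diff_eq_zero_iff[OF T_module] c rj ri ti tj by simp
    moreover have "(r j [^] Suc n) \<odot>\<^bsub>T n\<^esub> t i = ?c \<odot>\<^bsub>T n\<^esub> (r j \<odot>\<^bsub>T n\<^esub> t i)"
      using c rj ti by (simp add: N.smult_assoc1)
    moreover have "?c \<odot>\<^bsub>T n\<^esub> (r i \<odot>\<^bsub>T n\<^esub> t j) = r i \<odot>\<^bsub>T n\<^esub> (?c \<odot>\<^bsub>T n\<^esub> t j)"
      using c ri tj by (metis N.smult_assoc1 m_comm)
    ultimately show ?thesis by simp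
  qed
  have c': "r j [^] Suc n \<in> carrier R" by (rule nat_pow_closed[OF rj])
  have "(r j [^] Suc n) \<odot>\<^bsub>T (Suc n)\<^esub> x =
      adjoin_sum n (\<lambda>i. (r j [^] Suc n) \<odot>\<^bsub>T n\<^esub> t i)"
    unfolding t(2)
    by (rule famsum_smult[OF T_module finite_atLeastAtMost adjoin_linear _ c', symmetric])
       (use t(1) in blast)+
  also have "\<dots> = adjoin_sum n (\<lambda>i. r i \<odot>\<^bsub>T n\<^esub> (?c \<odot>\<^bsub>T n\<^esub> t j))"
    by (rule famsum_cong[OF T_module adjoin_linear _ eq]) (simp_all add: r_closed c tj)
  also have "\<dots> = \<zero>\<^bsub>T (Suc n)\<^esub>" by (rule adjoin_relation[OF N.smult_closed[OF c tj]])
  finally show ?case .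
qed

lemma regular_at_0_power:
  assumes "regular_at (T n) 0" "0 < d" "x \<in> carrier (T n)" "(r 1 [^] (e::nat)) \<odot>\<^bsub>T n\<^esub> x = \<zero>\<^bsub>T n\<^esub>"
  shows "x = \<zero>\<^bsub>T n\<^esub>"
  using assms(4)
proof (induction e)
  case 0
  interpret N: module R "T n" by (rule T_module)
  show ?case using 0 assms(3) by simp
next
  case (Suc e)
  interpret N: module R "T n" by (rule T_module)
  have r1: "r 1 \<in> carrier R" by (rule r_closed) (use assms(2) in auto)
  have "r (Suc 0) \<odot>\<^bsub>T n\<^esub> ((r 1 [^] e) \<odot>\<^bsub>T n\<^esub> x) = (r 1 [^] Suc e) \<odot>\<^bsub>T n\<^esub> x"
    using r1 assms(3) by (simp add: One_nat_def N.smult_assoc1[symmetric] m_comm)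
  then have "(r 1 [^] e) \<odot>\<^bsub>T n\<^esub> x \<in> J (T n) 0"
    using assms(1) Suc.prems r1 assms(3) unfolding regular_at_def by simp
  then show ?case using Suc.IH by simp
qed

lemma torsion_free_below:
  assumes reg: "regular_sequence R d r" and n: "n < d"
  shows "torsion_free R (T n)"
proof -
  have "x = \<zero>\<^bsub>T n\<^esub>" if x: "x \<in> torsion_submodule R (T n)" for x
  proof -
    have xc: "x \<in> carrier (T n)" using x by (simp add: torsion_submodule_def Let_def)
    have kill: "\<phi> x = \<zero>" if "linear_map R (T n) (self_module R) \<phi>" for \<phi>
      by (rule functional_vanishes_on_torsion[OF T_module x that])
    have "1 \<in> {1..d}" using n by simp
    then have "(r 1 [^] n) \<odot>\<^bsub>T n\<^esub> x = \<zero>\<^bsub>T n\<^esub>"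
      by (rule functional_kernel_power_torsion[OF _ xc]) (rule kill)
    then show ?thesis
      using regular_at_0_power[OF regular_T[OF reg] _ xc] n by simp
  qed
  then show ?thesis
    unfolding torsion_free_def using zero_in_torsion_submodule[OF T_module] by blast
qed

text \<open>A nonzero element killed by powers of the \<open>r\<^sub>i\<close> would have a nonzero multiple killed by the \<open>r\<^sub>i\<close>
  themselves: multiply by \<open>r\<^sub>1\<close> as long as the result is nonzero, then by \<open>r\<^sub>2\<close>, and so on.\<close>

lemma power_torsion_zero:
  assumes P: "module R P" and W: "submodule W R P"
    and socle: "\<And>y. \<lbrakk>y \<in> W; \<And>i. i \<in> {1..d} \<Longrightarrow> r i \<odot>\<^bsub>P\<^esub> y = \<zero>\<^bsub>P\<^esub>\<rbrakk> \<Longrightarrow> y = \<zero>\<^bsub>P\<^esub>"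
    and y: "y \<in> W" and pow: "\<And>i. i \<in> {1..d} \<Longrightarrow> (r i [^] (e::nat)) \<odot>\<^bsub>P\<^esub> y = \<zero>\<^bsub>P\<^esub>"
  shows "y = \<zero>\<^bsub>P\<^esub>"
proof -
  interpret P: module R P by (rule P)
  note ops = submodule_ops[OF P W]
  have swap: "a \<odot>\<^bsub>P\<^esub> (b \<odot>\<^bsub>P\<^esub> x) = b \<odot>\<^bsub>P\<^esub> (a \<odot>\<^bsub>P\<^esub> x)"
    if "a \<in> carrier R" "b \<in> carrier R" "x \<in> carrier P" for a b x
    using that by (metis P.smult_assoc1 m_comm)
  \<comment> \<open>\<open>k\<close> counts the generators that already kill \<open>y\<close>, and decreases from \<open>d\<close> to \<open>0\<close>.\<close>
  have main: "y = \<zero>\<^bsub>P\<^esub>" if "y \<in> W" "\<forall>i\<in>{1..d}. (r i [^] e) \<odot>\<^bsub>P\<^esub> y = \<zero>\<^bsub>P\<^esub>"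
    "\<forall>i\<in>{1..k}. r i \<odot>\<^bsub>P\<^esub> y = \<zero>\<^bsub>P\<^esub>" "k \<le> d" for k y
    using that(4,1-3)
  proof (induction k arbitrary: y rule: inc_induct)
    case base
    show ?case by (rule socle[OF base(1)]) (use base(3) in blast)
  next
    case (step k)
    have rk: "r (Suc k) \<in> carrier R" by (rule r_closed) (use step.hyps in auto)
    \<comment> \<open>The exponent of \<open>r (Suc k)\<close> is lowered one step at a time.\<close>
    have *: "y = \<zero>\<^bsub>P\<^esub>" if "(r (Suc k) [^] f) \<odot>\<^bsub>P\<^esub> y = \<zero>\<^bsub>P\<^esub>" for f :: nat
      using that
    proof (induction f)
      case 0
      then show ?case using ops(1)[OF step.prems(1)] by simp
    next
      case (Suc f)
      let ?c = "r (Suc k) [^] f"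
      have c: "?c \<in> carrier R" using rk by simp
      have yc: "y \<in> carrier P" by (rule ops(1)[OF step.prems(1)])
      have "?c \<odot>\<^bsub>P\<^esub> y = \<zero>\<^bsub>P\<^esub>"
      proof (rule step.IH)
        show "?c \<odot>\<^bsub>P\<^esub> y \<in> W" by (rule ops(5)[OF c step.prems(1)])
        show "\<forall>i\<in>{1..d}. (r i [^] e) \<odot>\<^bsub>P\<^esub> (?c \<odot>\<^bsub>P\<^esub> y) = \<zero>\<^bsub>P\<^esub>"
          using step.prems(2) swap[OF _ c yc] r_closed c by simp
        have "r (Suc k) \<odot>\<^bsub>P\<^esub> (?c \<odot>\<^bsub>P\<^esub> y) = (r (Suc k) [^] Suc f) \<odot>\<^bsub>P\<^esub> y"
          using rk c yc by (simp add: P.smult_assoc1[symmetric] m_comm)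
        then have last: "r (Suc k) \<odot>\<^bsub>P\<^esub> (?c \<odot>\<^bsub>P\<^esub> y) = \<zero>\<^bsub>P\<^esub>" using Suc.prems by simp
        have "r i \<odot>\<^bsub>P\<^esub> (?c \<odot>\<^bsub>P\<^esub> y) = \<zero>\<^bsub>P\<^esub>" if "i \<in> {1..k}" for i
        proof -
          have "r i \<in> carrier R" by (rule r_closed) (use that step.hyps in auto)
          then show ?thesis using step.prems(3) that swap[OF _ c yc] c by simp
        qed
        then show "\<forall>i\<in>{1..Suc k}. r i \<odot>\<^bsub>P\<^esub> (?c \<odot>\<^bsub>P\<^esub> y) = \<zero>\<^bsub>P\<^esub>"
          using last by (auto simp: le_Suc_eq)
      qed
      then show ?case by (rule Suc.IH)
    qed
    show ?case by (rule *[of e]) (use step.prems(2) step.hyps in auto)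
  qed
  show ?thesis by (rule main[of y 0]) (use y pow in auto)
qed

section \<open>The alternating tensor\<close>

abbreviation perms where "perms \<equiv> {\<sigma>. \<sigma> permutes {1..d}}"

text \<open>The sign as a ring element, which makes the alternating sum a linear combination.\<close>

definition perm_sign :: "(nat \<Rightarrow> nat) \<Rightarrow> 'a" where
  "perm_sign \<sigma> = (if evenperm \<sigma> then \<one> else \<ominus> \<one>)"

definition alt :: "(nat \<Rightarrow> (nat \<Rightarrow> 'a) set) \<Rightarrow> ((nat \<Rightarrow> (nat \<Rightarrow> 'a) set) \<Rightarrow> 'a) set" where
  "alt p = lincomb (T d) perms perm_sign (\<lambda>\<sigma>. pure d (\<lambda>i. p (\<sigma> i)))"

lemma perm_sign_closed: "perm_sign \<sigma> \<in> carrier R"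
  by (simp add: perm_sign_def)

lemma finite_perms: "finite perms"
  by (rule finite_permutations) simp

lemma pure_perm_closed:
  assumes "\<And>i. i \<in> {1..d} \<Longrightarrow> p i \<in> carrier M" "\<sigma> permutes {1..d}"
  shows "pure d (\<lambda>i. p (\<sigma> i)) \<in> carrier (T d)"
proof -
  have "pure d (\<lambda>i. p (\<sigma> i)) = pure d (restrict (\<lambda>i. p (\<sigma> i)) {1..d})"
    by (rule pure_tensor_cong) simp
  moreover have "restrict (\<lambda>i. p (\<sigma> i)) {1..d} \<in> tuples d"
    using assms(1) permutes_in_image[OF assms(2)] by simp
  ultimately show ?thesis using pure_tensor_closed[OF M_module] by simp
qed

lemma tau_eq_alt: "tau R M d m = alt m"
proof -
  interpret N: module R "T d" by (rule T_module)
  have sg: "[sign \<sigma>] \<cdot>\<^bsub>T d\<^esub> x = perm_sign \<sigma> \<odot>\<^bsub>T d\<^esub> x" if x: "x \<in> carrier (T d)" for \<sigma> :: "nat \<Rightarrow> nat" and x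
  proof -
    have one: "[(1::nat)] \<cdot>\<^bsub>T d\<^esub> x = x" using x by (simp add: One_nat_def)
    have "[(1::int)] \<cdot>\<^bsub>T d\<^esub> x = x" using add_pow_int_ge[of 1 "T d" x] one x by simp
    moreover have "[(-1::int)] \<cdot>\<^bsub>T d\<^esub> x = \<ominus>\<^bsub>T d\<^esub> x" using add_pow_int_lt[of "-1" "T d" x] one x by simp
    moreover have "(\<ominus> \<one>) \<odot>\<^bsub>T d\<^esub> x = \<ominus>\<^bsub>T d\<^esub> x" using x by (simp add: N.smult_l_minus)
    ultimately show ?thesis using x by (simp add: sign_def perm_sign_def)
  qed
  have mp: "pure d (\<lambda>i. m (\<sigma> i)) \<in> carrier (T d)" if "\<sigma> \<in> perms" for \<sigma>
    by (rule pure_perm_closed[OF gen_closed]) (use that in simp_all)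
  show ?thesis
    unfolding tau_def alt_def lincomb_def
    by (intro N.finsum_cong'[OF refl] Pi_I N.smult_closed perm_sign_closed mp sg)
qed

lemma alt_closed:
  assumes "\<And>i. i \<in> {1..d} \<Longrightarrow> p i \<in> carrier M"
  shows "alt p \<in> carrier (T d)"
  unfolding alt_def
  by (rule lincomb_closed[OF T_module perm_sign_closed]) (rule pure_perm_closed[OF assms], simp_all)

text \<open>Composition with the transposition of \<open>i\<close> and \<open>j\<close> matches the even with the odd permutations and
  leaves the pure tensors unchanged, so the terms cancel in pairs, also in characteristic two.\<close>

lemma alt_repeated:
  assumes p: "\<And>i. i \<in> {1..d} \<Longrightarrow> p i \<in> carrier M"
    and ij: "i \<in> {1..d}" "j \<in> {1..d}" "i \<noteq> j" and eq: "p i = p j"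
  shows "alt p = \<zero>\<^bsub>T d\<^esub>"
proof -
  interpret N: module R "T d" by (rule T_module)
  let ?E = "{\<sigma> \<in> perms. evenperm \<sigma>}" and ?O = "{\<sigma> \<in> perms. \<not> evenperm \<sigma>}"
  let ?s = "\<lambda>\<sigma>. transpose i j \<circ> \<sigma>"
  let ?f = "\<lambda>\<sigma>. pure d (\<lambda>i. p (\<sigma> i))"
  let ?g = "\<lambda>\<sigma>. perm_sign \<sigma> \<odot>\<^bsub>T d\<^esub> ?f \<sigma>"
  have fin: "finite ?E" "finite ?O" using finite_perms by simp_all
  have fc: "\<And>\<sigma>. \<sigma> \<in> perms \<Longrightarrow> ?f \<sigma> \<in> carrier (T d)" using pure_perm_closed[OF p] by simp
  have gc: "\<And>\<sigma>. \<sigma> \<in> perms \<Longrightarrow> ?g \<sigma> \<in> carrier (T d)" using fc perm_sign_closed by simp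
  have tr: "transpose i j permutes {1..d}" by (rule permutes_swap_id[OF ij(1,2)])
  have sp: "?s \<sigma> \<in> perms" if "\<sigma> \<in> perms" for \<sigma>
    using permutes_compose[of \<sigma> "{1..d}" "transpose i j"] that tr by simp
  have par: "evenperm (?s \<sigma>) \<longleftrightarrow> \<not> evenperm \<sigma>" if "\<sigma> \<in> perms" for \<sigma>
  proof -
    have "permutation \<sigma>" "permutation (transpose i j)"
      using that tr permutes_imp_permutation[of "{1..d}"] by auto
    then have "evenperm (?s \<sigma>) \<longleftrightarrow> evenperm (transpose i j) = evenperm \<sigma>" by (rule evenperm_comp[rotated])
    then show ?thesis using ij(3) by (simp add: evenperm_swap)
  qed
  have ss: "?s (?s \<sigma>) = \<sigma>" for \<sigma> :: "nat \<Rightarrow> nat" by (simp add: fun_eq_iff)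
  have O: "?O = ?s ` ?E"
  proof (intro equalityI subsetI)
    fix \<sigma> assume "\<sigma> \<in> ?O"
    then have "?s \<sigma> \<in> ?E" using sp par by blast
    then show "\<sigma> \<in> ?s ` ?E" by (rule image_eqI[where x = "?s \<sigma>", rotated]) (simp only: ss)
  next
    fix \<sigma> assume "\<sigma> \<in> ?s ` ?E"
    then obtain \<rho> where "\<sigma> = ?s \<rho>" "\<rho> \<in> ?E" by (rule imageE)
    then show "\<sigma> \<in> ?O" using sp[of \<rho>] par[of \<rho>] by blast
  qed
  have gs: "?g (?s \<sigma>) \<in> carrier (T d)" if "\<sigma> \<in> ?E" for \<sigma>
    by (rule gc[OF sp]) (use that in simp)
  have inj: "inj_on ?s ?E" by (rule inj_on_inverseI[of _ ?s]) (rule ss)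
  have fs: "?f (?s \<sigma>) = ?f \<sigma>" for \<sigma>
    by (rule pure_tensor_cong) (simp add: transpose_def eq)
  have "alt p = (\<Oplus>\<^bsub>T d\<^esub>\<sigma>\<in>?E \<union> ?O. ?g \<sigma>)"
  proof -
    have "perms = ?E \<union> ?O" by blast
    then show ?thesis by (simp only: alt_def lincomb_def)
  qed
  also have "\<dots> = (\<Oplus>\<^bsub>T d\<^esub>\<sigma>\<in>?E. ?g \<sigma>) \<oplus>\<^bsub>T d\<^esub> (\<Oplus>\<^bsub>T d\<^esub>\<sigma>\<in>?O. ?g \<sigma>)"
    by (rule N.finsum_Un_disjoint[OF fin]) (use gc in auto)
  also have "(\<Oplus>\<^bsub>T d\<^esub>\<sigma>\<in>?O. ?g \<sigma>) = (\<Oplus>\<^bsub>T d\<^esub>\<sigma>\<in>?E. ?g (?s \<sigma>))"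
    unfolding O
    by (rule N.finsum_reindex[OF _ inj], rule Pi_I, elim imageE) (simp only: gs)
  also have "(\<Oplus>\<^bsub>T d\<^esub>\<sigma>\<in>?E. ?g \<sigma>) \<oplus>\<^bsub>T d\<^esub> (\<Oplus>\<^bsub>T d\<^esub>\<sigma>\<in>?E. ?g (?s \<sigma>)) =
      (\<Oplus>\<^bsub>T d\<^esub>\<sigma>\<in>?E. ?g \<sigma> \<oplus>\<^bsub>T d\<^esub> ?g (?s \<sigma>))"
    by (rule N.finsum_addf[symmetric], rule Pi_I, rule gc, simp, rule Pi_I, rule gs)
  also have "\<dots> = \<zero>\<^bsub>T d\<^esub>"
  proof (rule N.add.finprod_one_eqI)
    fix \<sigma> assume \<sigma>: "\<sigma> \<in> ?E"
    then have "\<sigma> \<in> perms" "perm_sign \<sigma> = \<one>" "perm_sign (?s \<sigma>) = \<ominus> \<one>"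
      using par[of \<sigma>] by (simp_all add: perm_sign_def)
    then show "?g \<sigma> \<oplus>\<^bsub>T d\<^esub> ?g (?s \<sigma>) = \<zero>\<^bsub>T d\<^esub>"
      unfolding fs using fc[of \<sigma>] by (simp add: N.smult_l_minus N.r_neg)
  qed
  finally show ?thesis .
qed

lemma alt_slot_linear:
  assumes p: "\<And>i. i \<in> {1..d} \<Longrightarrow> p i \<in> carrier M" and j: "j \<in> {1..d}"
  shows "linear_map R M (T d) (\<lambda>u. alt (p(j := u)))"
  unfolding alt_def
proof (rule lincomb_linear_right[OF M_module T_module finite_perms _ perm_sign_closed])
  fix \<sigma> assume "\<sigma> \<in> perms"
  then have \<sigma>: "\<sigma> permutes {1..d}" by simp
  let ?q = "inv_into UNIV \<sigma> j"
  let ?x = "restrict (\<lambda>i. p (\<sigma> i)) {1..d}"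
  have q: "?q \<in> {1..d}" using permutes_in_image[OF permutes_inv[OF \<sigma>]] j by blast
  have x: "?x \<in> tuples d" using p permutes_in_image[OF \<sigma>] by simp
  have "\<sigma> i = j \<longleftrightarrow> i = ?q" for i
    using permutes_inverses[OF \<sigma>] by metis
  then have "pure d (\<lambda>i. (p(j := u)) (\<sigma> i)) = pure d (?x(?q := u))" for u
    by (intro pure_tensor_cong) simp
  then show "linear_map R M (T d) (\<lambda>u. pure d (\<lambda>i. (p(j := u)) (\<sigma> i)))"
    using pure_tensor_slot_linear[OF M_module x q] by simp
qed

text \<open>Put \<open>r\<^sub>1 m\<^sub>1 + \<dots> + r\<^sub>d m\<^sub>d = 0\<close> in the place of \<open>m\<^sub>j\<close> and expand: every term other than that of \<open>m\<^sub>j\<close>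
  has a repeated entry.\<close>

lemma r_alt_m: 
  assumes j: "j \<in> {1..d}"
  shows "r j \<odot>\<^bsub>T d\<^esub> alt m = \<zero>\<^bsub>T d\<^esub>"
proof -
  let ?f = "\<lambda>u. alt (m(j := u))"
  have f: "linear_map R M (T d) ?f" by (rule alt_slot_linear[OF gen_closed j])
  have "\<zero>\<^bsub>T d\<^esub> = ?f (lincomb M {1..d} r m)"
    unfolding sum_r_m by (rule linear_map_zero[OF f M_module T_module, symmetric])
  also have "\<dots> = lincomb (T d) {1..d} r (\<lambda>l. ?f (m l))"
    by (rule linear_map_lincomb_image[OF f M_module T_module finite_atLeastAtMost r_closed gen_closed])
  also have "\<dots> = r j \<odot>\<^bsub>T d\<^esub> ?f (m j)"
  proof (rule lincomb_single[OF T_module finite_atLeastAtMost j])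
    show "?f (m j) \<in> carrier (T d)" by (rule linear_map_closed[OF f gen_closed[OF j]])
    show "r j \<in> carrier R" by (rule r_closed[OF j])
    interpret N: module R "T d" by (rule T_module)
    fix l assume l: "l \<in> {1..d}" "l \<noteq> j"
    have "?f (m l) = \<zero>\<^bsub>T d\<^esub>"
      by (rule alt_repeated[OF _ j l(1)]) (use l gen_closed in auto)
    then show "r l \<odot>\<^bsub>T d\<^esub> ?f (m l) = \<zero>\<^bsub>T d\<^esub>" using r_closed[OF l(1)] by simp
  qed
  finally show ?thesis by simp
qed

end

section \<open>Splitting off the torsion of the top tensor power\<close>

lemma hom_from_cyclic:
  assumes N: "module R N" and I: "submodule I R (self_module R)"
  shows "bij_betw (\<lambda>f. f (I +>\<^bsub>R\<^esub> \<one>\<^bsub>R\<^esub>)) (mod_hom R (cyclic_module R I) N)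
    {t \<in> carrier N. \<forall>a\<in>I. a \<odot>\<^bsub>N\<^esub> t = \<zero>\<^bsub>N\<^esub>}"
proof -
  interpret N: module R N by (rule N)
  have S: "module R (self_module R)" by (rule self_is_module[OF N.is_cring])
  let ?C = "cyclic_module R I"
  let ?c = "I +>\<^bsub>R\<^esub> \<one>\<^bsub>R\<^esub>"
  have C: "module R ?C" unfolding cyclic_module_def by (rule quot_is_module[OF S I])
  have c: "?c = I +>\<^bsub>self_module R\<^esub> \<one>\<^bsub>R\<^esub>" by simp
  have cc: "?c \<in> carrier ?C" unfolding c cyclic_module_def quot_carrier by (rule imageI) simp
  have sm: "a \<odot>\<^bsub>?C\<^esub> ?c = I +>\<^bsub>self_module R\<^esub> a" if "a \<in> carrier R" for a
    unfolding cyclic_module_def using quot_smult[OF S I that, of "\<one>\<^bsub>R\<^esub>"] that by simp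
  have gen: "\<exists>a\<in>carrier R. x = a \<odot>\<^bsub>?C\<^esub> ?c" if "x \<in> carrier ?C" for x
    using that sm unfolding cyclic_module_def quot_carrier by auto
  have lin: "linear_map R ?C N f" if "f \<in> mod_hom R ?C N" for f
    using that by (auto simp: mod_hom_def linear_map_def)
  show ?thesis
  proof (rule bij_betw_imageI)
    show "inj_on (\<lambda>f. f ?c) (mod_hom R ?C N)"
    proof (rule inj_onI)
      fix f g assume f: "f \<in> mod_hom R ?C N" and g: "g \<in> mod_hom R ?C N" and eq: "f ?c = g ?c"
      have "f \<in> carrier ?C \<rightarrow>\<^sub>E carrier N" "g \<in> carrier ?C \<rightarrow>\<^sub>E carrier N"
        using f g by (simp_all add: mod_hom_def)
      then show "f = g"
      proof (rule PiE_ext)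
        fix x assume "x \<in> carrier ?C"
        then obtain a where a: "a \<in> carrier R" "x = a \<odot>\<^bsub>?C\<^esub> ?c" using gen by blast
        show "f x = g x"
          unfolding a(2) linear_map_smult[OF lin[OF f] a(1) cc] linear_map_smult[OF lin[OF g] a(1) cc]
          by (simp only: eq)
      qed
    qed
    show "(\<lambda>f. f ?c) ` mod_hom R ?C N = {t \<in> carrier N. \<forall>a\<in>I. a \<odot>\<^bsub>N\<^esub> t = \<zero>\<^bsub>N\<^esub>}"
    proof (intro equalityI subsetI)
      fix t assume "t \<in> (\<lambda>f. f ?c) ` mod_hom R ?C N"
      then obtain f where t: "t = f ?c" and f: "f \<in> mod_hom R ?C N" by (rule imageE)
      have "a \<odot>\<^bsub>N\<^esub> t = \<zero>\<^bsub>N\<^esub>" if a: "a \<in> I" for a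
      proof -
        have ac: "a \<in> carrier R" using submodule_ops(1)[OF S I a] by simp
        have "a \<odot>\<^bsub>?C\<^esub> ?c = \<zero>\<^bsub>?C\<^esub>"
          unfolding sm[OF ac] unfolding cyclic_module_def using quot_eq_zero_iff[OF S I, of a] ac a by simp
        then show ?thesis
          unfolding t linear_map_smult[OF lin[OF f] ac cc, symmetric]
          using linear_map_zero[OF lin[OF f] C N] by simp
      qed
      then show "t \<in> {t \<in> carrier N. \<forall>a\<in>I. a \<odot>\<^bsub>N\<^esub> t = \<zero>\<^bsub>N\<^esub>}"
        using linear_map_closed[OF lin[OF f] cc] t by simp
    next
      fix t assume "t \<in> {t \<in> carrier N. \<forall>a\<in>I. a \<odot>\<^bsub>N\<^esub> t = \<zero>\<^bsub>N\<^esub>}"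
      then have t: "t \<in> carrier N" "\<And>a. a \<in> I \<Longrightarrow> a \<odot>\<^bsub>N\<^esub> t = \<zero>\<^bsub>N\<^esub>" by blast+
      have "linear_map R (self_module R) N (\<lambda>a. a \<odot>\<^bsub>N\<^esub> t)"
        by (rule linear_mapI) (use t(1) in \<open>simp_all add: N.smult_l_distr N.smult_assoc1\<close>)
      from quot_universal[OF S I N this t(2)]
      obtain h where h: "linear_map R ?C N h" "\<forall>a\<in>carrier (self_module R). h (I +>\<^bsub>self_module R\<^esub> a) = a \<odot>\<^bsub>N\<^esub> t"
        unfolding cyclic_module_def by blast
      interpret C: module R ?C by (rule C)
      let ?f = "restrict h (carrier ?C)"
      have "?f \<in> mod_hom R ?C N"
        using h(1) by (simp add: mod_hom_def linear_map_def)
      moreover have "?f ?c = t"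
        using cc h(2)[rule_format, of "\<one>\<^bsub>R\<^esub>"] t(1) by simp
      ultimately show "t \<in> (\<lambda>f. f ?c) ` mod_hom R ?C N" by (metis imageI)
    qed
  qed
qed

lemma direct_sum_simps:
  "carrier (direct_sum_module M N) = carrier M \<times> carrier N"
  "(x, y) \<oplus>\<^bsub>direct_sum_module M N\<^esub> (x', y') = (x \<oplus>\<^bsub>M\<^esub> x', y \<oplus>\<^bsub>N\<^esub> y')"
  "a \<odot>\<^bsub>direct_sum_module M N\<^esub> (x, y) = (a \<odot>\<^bsub>M\<^esub> x, a \<odot>\<^bsub>N\<^esub> y)"
  by (simp_all add: direct_sum_module_def)

text \<open>The inverse of the isomorphism is \<open>t \<mapsto> (p t, t - h (p t))\<close>.\<close>

lemma retraction_splitting: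
  assumes C: "module R C" and N: "module R N"
    and h: "linear_map R C N h" and p: "linear_map R N C p"
    and ph: "\<And>x. x \<in> carrier C \<Longrightarrow> p (h x) = x"
  defines "W \<equiv> {t \<in> carrier N. p t = \<zero>\<^bsub>C\<^esub>}"
  shows "\<exists>\<phi>\<in>mod_iso R (direct_sum_module C (N\<lparr>carrier := W\<rparr>)) N.
    \<forall>x\<in>carrier C. \<forall>w\<in>W. \<phi> (x, w) = h x \<oplus>\<^bsub>N\<^esub> w"
proof -
  interpret C: module R C by (rule C)
  interpret N: module R N by (rule N)
  let ?D = "direct_sum_module C (N\<lparr>carrier := W\<rparr>)"
  have W: "submodule W R N" unfolding W_def by (rule kernel_submodule[OF p N C])
  note ops = submodule_ops[OF N W]
  have pw: "w \<in> W \<Longrightarrow> p w = \<zero>\<^bsub>C\<^esub>" for w by (simp add: W_def)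
  note hc = linear_map_closed[OF h]
  define \<phi> where "\<phi> = restrict (\<lambda>(x, w). h x \<oplus>\<^bsub>N\<^esub> w) (carrier C \<times> W)"
  have \<phi>: "\<phi> (x, w) = h x \<oplus>\<^bsub>N\<^esub> w" if "x \<in> carrier C" "w \<in> W" for x w
    using that by (simp add: \<phi>_def)
  have carD: "carrier ?D = carrier C \<times> W" by (simp add: direct_sum_simps)
  have p\<phi>: "p (\<phi> (x, w)) = x" if "x \<in> carrier C" "w \<in> W" for x w
    using that ops(1) hc by (simp add: \<phi> linear_map_add[OF p] ph pw)
  have "\<phi> \<in> mod_hom R ?D N"
    unfolding mod_hom_def carD
  proof (intro CollectI conjI ballI)
    show "\<phi> \<in> carrier C \<times> W \<rightarrow>\<^sub>E carrier N"
      unfolding \<phi>_def by (rule restrict_PiE_iff[THEN iffD2]) (use hc ops(1) in auto)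
    fix z assume "z \<in> carrier C \<times> W"
    then obtain x w where z: "z = (x, w)" "x \<in> carrier C" "w \<in> W" by (rule SigmaE)
    {
      fix z' assume "z' \<in> carrier C \<times> W"
      then obtain x' w' where z': "z' = (x', w')" "x' \<in> carrier C" "w' \<in> W" by (rule SigmaE)
      note cl = hc[OF z(2)] hc[OF z'(2)] ops(1)[OF z(3)] ops(1)[OF z'(3)]
      have "\<phi> (z \<oplus>\<^bsub>?D\<^esub> z') = h (x \<oplus>\<^bsub>C\<^esub> x') \<oplus>\<^bsub>N\<^esub> (w \<oplus>\<^bsub>N\<^esub> w')"
        unfolding z(1) z'(1) direct_sum_simps using \<phi>[of "x \<oplus>\<^bsub>C\<^esub> x'" "w \<oplus>\<^bsub>N\<^esub> w'"] z z' ops(3) by simp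
      also have "\<dots> = \<phi> z \<oplus>\<^bsub>N\<^esub> \<phi> z'"
        unfolding z(1) z'(1) \<phi>[OF z(2,3)] \<phi>[OF z'(2,3)] linear_map_add[OF h z(2) z'(2)]
        using cl by (simp add: N.a_ac)
      finally show "\<phi> (z \<oplus>\<^bsub>?D\<^esub> z') = \<phi> z \<oplus>\<^bsub>N\<^esub> \<phi> z'" .
    }
  next
    fix a z assume a: "a \<in> carrier R" and "z \<in> carrier C \<times> W"
    then obtain x w where z: "z = (x, w)" "x \<in> carrier C" "w \<in> W" by (auto elim: SigmaE)
    have "\<phi> (a \<odot>\<^bsub>?D\<^esub> z) = h (a \<odot>\<^bsub>C\<^esub> x) \<oplus>\<^bsub>N\<^esub> a \<odot>\<^bsub>N\<^esub> w"
      unfolding z(1) direct_sum_simps using \<phi>[of "a \<odot>\<^bsub>C\<^esub> x" "a \<odot>\<^bsub>N\<^esub> w"] z a ops(5) by simp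
    also have "\<dots> = a \<odot>\<^bsub>N\<^esub> \<phi> z"
      unfolding z(1) \<phi>[OF z(2,3)] linear_map_smult[OF h a z(2)]
      using hc[OF z(2)] ops(1)[OF z(3)] a by (simp add: N.smult_r_distr)
    finally show "\<phi> (a \<odot>\<^bsub>?D\<^esub> z) = a \<odot>\<^bsub>N\<^esub> \<phi> z" .
  qed
  moreover have "bij_betw \<phi> (carrier ?D) (carrier N)"
    unfolding carD
  proof (rule bij_betw_imageI)
    show "inj_on \<phi> (carrier C \<times> W)"
    proof (rule inj_onI)
      fix z z' assume "z \<in> carrier C \<times> W" "z' \<in> carrier C \<times> W" and eq: "\<phi> z = \<phi> z'"
      then obtain x w x' w' where z: "z = (x, w)" "x \<in> carrier C" "w \<in> W"
        and z': "z' = (x', w')" "x' \<in> carrier C" "w' \<in> W" by (elim SigmaE)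
      have x: "x = x'" using p\<phi>[OF z(2,3)] p\<phi>[OF z'(2,3)] eq z(1) z'(1) by simp
      have "h x \<oplus>\<^bsub>N\<^esub> w = h x \<oplus>\<^bsub>N\<^esub> w'" using eq \<phi>[OF z(2,3)] \<phi>[OF z'(2,3)] z(1) z'(1) x by simp
      then have "w = w'" using hc[OF z(2)] ops(1)[OF z(3)] ops(1)[OF z'(3)] by simp
      then show "z = z'" using x z(1) z'(1) by simp
    qed
    show "\<phi> ` (carrier C \<times> W) = carrier N"
    proof (intro equalityI subsetI)
      fix t assume "t \<in> \<phi> ` (carrier C \<times> W)"
      then obtain z where t: "t = \<phi> z" "z \<in> carrier C \<times> W" by (rule imageE)
      then obtain x w where z: "z = (x, w)" "x \<in> carrier C" "w \<in> W" by (elim SigmaE)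
      show "t \<in> carrier N" unfolding t(1) z(1) \<phi>[OF z(2,3)] using hc[OF z(2)] ops(1)[OF z(3)] by simp
    next
      fix t assume t: "t \<in> carrier N"
      have pt: "p t \<in> carrier C" by (rule linear_map_closed[OF p t])
      have hpt: "h (p t) \<in> carrier N" by (rule hc[OF pt])
      have "p (t \<ominus>\<^bsub>N\<^esub> h (p t)) = \<zero>\<^bsub>C\<^esub>"
        using linear_map_diff[OF p N C t hpt] ph[OF pt] module_diff_eq_zero_iff[OF C pt pt] by simp
      then have w: "t \<ominus>\<^bsub>N\<^esub> h (p t) \<in> W" using t hpt by (simp add: W_def)
      have "\<phi> (p t, t \<ominus>\<^bsub>N\<^esub> h (p t)) = t"
        unfolding \<phi>[OF pt w] using t hpt by (simp add: a_minus_def N.a_lcomm N.r_neg)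
      then show "t \<in> \<phi> ` (carrier C \<times> W)" using pt w by (metis SigmaI imageI)
    qed
  qed
  ultimately have "\<phi> \<in> mod_iso R ?D N" by (simp add: mod_iso_def)
  with \<phi> show ?thesis by blast
qed

locale proper_regular_sequence = ring_sequence +
  assumes reg: "regular_sequence R d r" and d_pos: "d \<ge> 1"
    and proper: "Idl (r ` {1..d}) \<noteq> carrier R"
begin

abbreviation I where "I \<equiv> Idl (r ` {1..d})"
abbreviation C where "C \<equiv> cyclic_module R I"
abbreviation c1 where "c1 \<equiv> I +> \<one>"

lemma I_eq_J: "J (self_module R) d = I"
  by (rule J_self_module_ideal[OF le_refl])

lemma I_submodule: "submodule I R (self_module R)"
  using J_submodule[OF self_is_module[OF is_cring] le_refl] unfolding I_eq_J .

lemma I_carrier: "a \<in> I \<Longrightarrow> a \<in> carrier R"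
  using submodule_ops(1)[OF self_is_module[OF is_cring] I_submodule] by simp

lemma r_in_I: "i \<in> {1..d} \<Longrightarrow> r i \<in> I"
  using genideal_self[of "r ` {1..d}"] r_closed by blast

lemma one_notin_I: "\<one> \<notin> I"
proof
  assume "\<one> \<in> I"
  moreover have "ideal I R" by (rule genideal_ideal) (use r_closed in blast)
  ultimately show False using ideal.one_imp_carrier proper by blast
qed

lemma C_module: "module R C"
  unfolding cyclic_module_def by (rule quot_is_module[OF self_is_module[OF is_cring] I_submodule])

lemma smult_c1: "a \<in> carrier R \<Longrightarrow> a \<odot>\<^bsub>C\<^esub> c1 = I +> a"
  using quot_smult[OF self_is_module[OF is_cring] I_submodule, of a \<one>]
  by (simp add: cyclic_module_def)

lemma c1_closed: "c1 \<in> carrier C"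
  using imageI[of \<one> "carrier (self_module R)" "\<lambda>x. I +>\<^bsub>self_module R\<^esub> x"]
  by (simp add: cyclic_module_def quot_carrier)

lemma C_generated:
  assumes "x \<in> carrier C" obtains a where "a \<in> carrier R" "x = a \<odot>\<^bsub>C\<^esub> c1"
proof -
  obtain a where "x = I +>\<^bsub>self_module R\<^esub> a" "a \<in> carrier R"
    using assms unfolding cyclic_module_def quot_carrier self_module_simps(1) by (rule imageE)
  then show ?thesis using that smult_c1 by simp
qed

lemma smult_c1_zero_iff:
  assumes "a \<in> carrier R" shows "a \<odot>\<^bsub>C\<^esub> c1 = \<zero>\<^bsub>C\<^esub> \<longleftrightarrow> a \<in> I"
  unfolding smult_c1[OF assms] unfolding cyclic_module_def
  using quot_eq_zero_iff[OF self_is_module[OF is_cring] I_submodule, of a] assms by simp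

lemma I_kills_C:
  assumes "a \<in> I" "x \<in> carrier C" shows "a \<odot>\<^bsub>C\<^esub> x = \<zero>\<^bsub>C\<^esub>"
proof -
  interpret C: module R C by (rule C_module)
  obtain b where b: "b \<in> carrier R" "x = b \<odot>\<^bsub>C\<^esub> c1" by (rule C_generated[OF assms(2)])
  have a: "a \<in> carrier R" by (rule I_carrier[OF assms(1)])
  have "a \<odot>\<^bsub>C\<^esub> x = b \<odot>\<^bsub>C\<^esub> (a \<odot>\<^bsub>C\<^esub> c1)"
    unfolding b(2) using a b(1) c1_closed by (metis C.smult_assoc1 m_comm)
  then show ?thesis using smult_c1_zero_iff[OF a] assms(1) b(1) by simp
qed

text \<open>The indices of the monomial \<open>m\<^sub>1 \<otimes> \<dots> \<otimes> m\<^sub>d \<otimes> m\<^sub>1 \<otimes> \<dots> \<otimes> m\<^sub>1\<close> whose coefficient detects \<open>\<tau>\<close> and its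
  products with powers of \<open>m\<^sub>1\<close>.\<close>

definition word :: "nat \<Rightarrow> nat" where
  "word i = (if i \<le> d then i else 1)"

lemma word_range: "i \<ge> 1 \<Longrightarrow> word i \<in> {1..d}"
  using d_pos by (simp add: word_def)

text \<open>The coefficient of a tensor at this monomial, modulo \<open>I\<close>. It is well defined because the relation
  of \<open>M\<close> has coefficients in \<open>I\<close>; the recursion picks the maps supplied by the universal property of
  the tower.\<close>

primrec proj :: "nat \<Rightarrow> ((nat \<Rightarrow> (nat \<Rightarrow> 'a) set) \<Rightarrow> 'a) set \<Rightarrow> 'a set" where
  "proj 0 = (SOME h. linear_map R (T 0) C h \<and> (\<forall>x\<in>tuples 0. h (pure 0 x) = c1))"
| "proj (Suc n) = (SOME h. linear_map R (T (Suc n)) C h \<and>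
     (\<forall>i\<in>{1..d}. \<forall>t\<in>carrier (T n). h (adjoin n i t) = (if i = word (Suc n) then proj n t else \<zero>\<^bsub>C\<^esub>)))"

lemma proj_0: "linear_map R (T 0) C (proj 0)" "x \<in> tuples 0 \<Longrightarrow> proj 0 (pure 0 x) = c1"
proof -
  have "multilinear R M 0 C (\<lambda>_. c1)" using c1_closed by (simp add: multilinear_def)
  from someI_ex[OF tensor_power_universal[OF M_module C_module this]]
  have "linear_map R (T 0) C (proj 0) \<and> (\<forall>x\<in>tuples 0. proj 0 (pure 0 x) = c1)"
    unfolding proj.simps .
  then show "linear_map R (T 0) C (proj 0)" "x \<in> tuples 0 \<Longrightarrow> proj 0 (pure 0 x) = c1" by blast+
qed

lemma proj_Suc:
  assumes lin: "linear_map R (T n) C (proj n)"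
  shows "linear_map R (T (Suc n)) C (proj (Suc n)) \<and>
     (\<forall>i\<in>{1..d}. \<forall>t\<in>carrier (T n).
        proj (Suc n) (adjoin n i t) = (if i = word (Suc n) then proj n t else \<zero>\<^bsub>C\<^esub>))"
proof -
  interpret C: module R C by (rule C_module)
  have g: "linear_map R (T n) C (\<lambda>t. if i = word (Suc n) then proj n t else \<zero>\<^bsub>C\<^esub>)" for i
  proof (cases "i = word (Suc n)")
    case False
    have "linear_map R (T n) C (\<lambda>_. \<zero>\<^bsub>C\<^esub>)" by (rule linear_mapI) simp_all
    then show ?thesis using False by simp
  qed (use lin in simp)
  have w: "word (Suc n) \<in> {1..d}" by (rule word_range) simp
  have "lincomb C {1..d} r (\<lambda>i. if i = word (Suc n) then proj n t else \<zero>\<^bsub>C\<^esub>) = \<zero>\<^bsub>C\<^esub>"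
    if t: "t \<in> carrier (T n)" for t
  proof -
    have pt: "proj n t \<in> carrier C" by (rule linear_map_closed[OF lin t])
    have "lincomb C {1..d} r (\<lambda>i. if i = word (Suc n) then proj n t else \<zero>\<^bsub>C\<^esub>) =
        r (word (Suc n)) \<odot>\<^bsub>C\<^esub> (if word (Suc n) = word (Suc n) then proj n t else \<zero>\<^bsub>C\<^esub>)"
      by (rule lincomb_single[OF C_module finite_atLeastAtMost w])
         (use pt r_closed w in simp_all)
    then show ?thesis using I_kills_C[OF r_in_I[OF w] pt] by simp
  qed
  from someI_ex[OF tower_universal[OF C_module g this]] show ?thesis unfolding proj.simps .
qed

lemma proj_linear: "linear_map R (T n) C (proj n)"
  by (induction n) (use proj_0(1) proj_Suc in blast)+

lemma proj_adjoin:
  "\<lbrakk>i \<in> {1..d}; t \<in> carrier (T n)\<rbrakk>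
    \<Longrightarrow> proj (Suc n) (adjoin n i t) = (if i = word (Suc n) then proj n t else \<zero>\<^bsub>C\<^esub>)"
  using proj_Suc[OF proj_linear] by blast

lemma proj_pure:
  assumes "\<And>i. i \<in> {1..n} \<Longrightarrow> v i \<in> {1..d}"
  shows "proj n (pure n (\<lambda>i. m (v i))) = (if \<forall>i\<in>{1..n}. v i = word i then c1 else \<zero>\<^bsub>C\<^esub>)"
  using assms
proof (induction n)
  case 0
  have "pure 0 (\<lambda>i. m (v i)) = pure 0 (\<lambda>_. undefined)" by (rule pure_tensor_cong) simp
  then show ?case using proj_0(2)[of "\<lambda>_. undefined"] by simp
next
  case (Suc n)
  let ?x = "restrict (\<lambda>i. m (v i)) {1..n}"
  have x: "?x \<in> tuples n" using Suc.prems gen_closed by simp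
  have v: "v (Suc n) \<in> {1..d}" by (rule Suc.prems) simp
  have IH: "proj n (pure n (\<lambda>i. m (v i))) = (if \<forall>i\<in>{1..n}. v i = word i then c1 else \<zero>\<^bsub>C\<^esub>)"
    by (rule Suc.IH) (use Suc.prems in simp)
  have "pure (Suc n) (\<lambda>i. m (v i)) = pure (Suc n) (?x(Suc n := m (v (Suc n))))"
    by (rule pure_tensor_cong) (auto simp: le_Suc_eq)
  also have "\<dots> = adjoin n (v (Suc n)) (pure n ?x)" by (rule adjoin_pure[OF v x, symmetric])
  finally have "proj (Suc n) (pure (Suc n) (\<lambda>i. m (v i))) =
      (if v (Suc n) = word (Suc n) then proj n (pure n ?x) else \<zero>\<^bsub>C\<^esub>)"
    using proj_adjoin[OF v pure_tensor_closed[OF M_module x]] by simp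
  also have "pure n ?x = pure n (\<lambda>i. m (v i))" by (rule pure_tensor_cong) simp
  finally show ?case
    unfolding IH by (auto simp: le_Suc_eq)
qed

lemma alt_m_closed: "alt m \<in> carrier (T d)"
  by (rule alt_closed[OF gen_closed])

text \<open>Among the permutations of the indices only the identity spells \<open>1, \<dots>, d\<close>.\<close>

lemma proj_alt: "proj d (alt m) = c1"
proof -
  interpret C: module R C by (rule C_module)
  have mp: "pure d (\<lambda>i. m (\<sigma> i)) \<in> carrier (T d)" if "\<sigma> \<in> perms" for \<sigma>
    by (rule pure_perm_closed[OF gen_closed]) (use that in simp_all)
  have pp: "proj d (pure d (\<lambda>i. m (\<sigma> i))) = (if \<forall>i\<in>{1..d}. \<sigma> i = word i then c1 else \<zero>\<^bsub>C\<^esub>)"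
    if "\<sigma> \<in> perms" for \<sigma>
    by (rule proj_pure) (use permutes_in_image[of \<sigma> "{1..d}"] that in simp)
  have id: "id \<in> perms" by (simp add: permutes_id)
  have pid: "proj d (pure d (\<lambda>i. m (id i))) = c1"
    unfolding pp[OF id] by (simp add: word_def)
  have "proj d (alt m) = lincomb C perms perm_sign (\<lambda>\<sigma>. proj d (pure d (\<lambda>i. m (\<sigma> i))))"
    unfolding alt_def
    by (rule linear_map_lincomb_image[OF proj_linear T_module C_module finite_perms perm_sign_closed mp])
  also have "\<dots> = perm_sign id \<odot>\<^bsub>C\<^esub> proj d (pure d (\<lambda>i. m (id i)))"
  proof (rule lincomb_single[OF C_module finite_perms id])
    show "proj d (pure d (\<lambda>i. m (id i))) \<in> carrier C" unfolding pid by (rule c1_closed)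
    show "perm_sign id \<in> carrier R" by (rule perm_sign_closed)
    fix \<sigma> assume \<sigma>: "\<sigma> \<in> perms" "\<sigma> \<noteq> id"
    have "\<sigma> permutes {1..d}" using \<sigma>(1) by simp
    have "\<not> (\<forall>i\<in>{1..d}. \<sigma> i = word i)"
    proof
      assume all: "\<forall>i\<in>{1..d}. \<sigma> i = word i"
      have "\<sigma> i = i" for i
      proof (cases "i \<in> {1..d}")
        case True
        then show ?thesis using all by (simp add: word_def)
      next
        case False
        then show ?thesis using permutes_not_in[OF \<open>\<sigma> permutes {1..d}\<close>] by simp
      qed
      then show False using \<sigma>(2) by (simp add: fun_eq_iff)
    qed
    then have "proj d (pure d (\<lambda>i. m (\<sigma> i))) = \<zero>\<^bsub>C\<^esub>" unfolding pp[OF \<sigma>(1)] by (rule if_not_P)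
    then show "perm_sign \<sigma> \<odot>\<^bsub>C\<^esub> proj d (pure d (\<lambda>i. m (\<sigma> i))) = \<zero>\<^bsub>C\<^esub>"
      using perm_sign_closed by simp
  qed
  also have "\<dots> = c1" unfolding pid using c1_closed by (simp add: perm_sign_def evenperm_id)
  finally show ?thesis .
qed

lemma I_kills_alt:
  assumes "a \<in> I" shows "a \<odot>\<^bsub>T d\<^esub> alt m = \<zero>\<^bsub>T d\<^esub>"
proof -
  interpret N: module R "T d" by (rule T_module)
  have lin: "linear_map R (self_module R) (T d) (\<lambda>a. a \<odot>\<^bsub>T d\<^esub> alt m)"
    by (rule linear_mapI) (use alt_m_closed in \<open>simp_all add: N.smult_l_distr N.smult_assoc1\<close>)
  have "b \<odot>\<^bsub>T d\<^esub> alt m = \<zero>\<^bsub>T d\<^esub>" if "k \<le> d" "b \<in> J (self_module R) k" for b k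
    using that
  proof (induction k arbitrary: b)
    case 0
    then show ?case using alt_m_closed by simp
  next
    case (Suc k)
    have rk: "r (Suc k) \<in> carrier R" by (rule r_closed) (use Suc.prems in auto)
    obtain x u where b: "b = x \<oplus> r (Suc k) \<otimes> u" "x \<in> J (self_module R) k" "u \<in> carrier R"
      using Suc.prems(2) by auto
    have x: "x \<in> carrier R"
      using J_carrier[OF self_is_module[OF is_cring] Suc_leD[OF Suc.prems(1)] b(2)] by simp
    have "(r (Suc k) \<otimes> u) \<odot>\<^bsub>T d\<^esub> alt m = u \<odot>\<^bsub>T d\<^esub> (r (Suc k) \<odot>\<^bsub>T d\<^esub> alt m)"
      using rk b(3) alt_m_closed by (metis N.smult_assoc1 m_comm)
    also have "\<dots> = \<zero>\<^bsub>T d\<^esub>"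
      using r_alt_m[of "Suc k"] Suc.prems(1) b(3) by simp
    finally show ?case
      unfolding b(1) using Suc.IH[OF _ b(2)] Suc.prems(1) x rk b(3) alt_m_closed
      by (simp add: N.smult_l_distr)
  qed
  then show ?thesis using assms I_eq_J by blast
qed

lemma annihilator_alt: "annihilator R (T d) (alt m) = I"
proof (intro equalityI subsetI)
  fix a assume "a \<in> annihilator R (T d) (alt m)"
  then have a: "a \<in> carrier R" "a \<odot>\<^bsub>T d\<^esub> alt m = \<zero>\<^bsub>T d\<^esub>" by (simp_all add: annihilator_def)
  have "a \<odot>\<^bsub>C\<^esub> c1 = proj d (a \<odot>\<^bsub>T d\<^esub> alt m)"
    using linear_map_smult[OF proj_linear a(1) alt_m_closed] proj_alt by simp
  also have "\<dots> = \<zero>\<^bsub>C\<^esub>" unfolding a(2) by (rule linear_map_zero[OF proj_linear T_module C_module])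
  finally show "a \<in> I" using smult_c1_zero_iff[OF a(1)] by blast
next
  fix a assume "a \<in> I"
  then show "a \<in> annihilator R (T d) (alt m)"
    using I_kills_alt I_carrier by (simp add: annihilator_def)
qed

definition W where "W = {t \<in> carrier (T d). proj d t = \<zero>\<^bsub>C\<^esub>}"

lemma W_submodule: "submodule W R (T d)"
  unfolding W_def by (rule kernel_submodule[OF proj_linear T_module C_module])

text \<open>By \<open>socle_T\<close> some multiples \<open>c y\<close> and \<open>c' \<tau>\<close> are equal, and \<open>y\<close> vanishes if \<open>c'\<close> lies in \<open>I\<close>. The
  projection kills \<open>y\<close> and sends \<open>\<tau>\<close> to \<open>1\<close>, which puts \<open>c'\<close> into \<open>I\<close>.\<close>

lemma W_socle:
  assumes y: "y \<in> W" and ry: "\<And>i. i \<in> {1..d} \<Longrightarrow> r i \<odot>\<^bsub>T d\<^esub> y = \<zero>\<^bsub>T d\<^esub>"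
  shows "y = \<zero>\<^bsub>T d\<^esub>"
proof -
  interpret N: module R "T d" by (rule T_module)
  interpret C: module R C by (rule C_module)
  have yc: "y \<in> carrier (T d)" and py: "proj d y = \<zero>\<^bsub>C\<^esub>" using y by (simp_all add: W_def)
  have soc: "socle_cyclic_at (T d) 0" by (rule socle_T[OF reg]) simp
  have ry': "\<forall>i\<in>{1..d}. r i \<odot>\<^bsub>T d\<^esub> y \<in> J (T d) 0" "\<forall>i\<in>{1..d}. r i \<odot>\<^bsub>T d\<^esub> alt m \<in> J (T d) 0"
    using ry r_alt_m by simp_all
  have "\<exists>c\<in>carrier R. \<exists>c'\<in>carrier R. c \<odot>\<^bsub>T d\<^esub> y \<ominus>\<^bsub>T d\<^esub> c' \<odot>\<^bsub>T d\<^esub> alt m \<in> J (T d) 0 \<and>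
       (c' \<in> J (self_module R) d \<longrightarrow> y \<in> J (T d) 0)"
    by (rule soc[unfolded socle_cyclic_at_def, THEN bspec, OF yc, THEN bspec, OF alt_m_closed,
        THEN mp, OF ry'(1), THEN mp, OF ry'(2)])
  then obtain c c' where c: "c \<in> carrier R" "c' \<in> carrier R"
    and eq: "c \<odot>\<^bsub>T d\<^esub> y \<ominus>\<^bsub>T d\<^esub> c' \<odot>\<^bsub>T d\<^esub> alt m = \<zero>\<^bsub>T d\<^esub>" and imp: "c' \<in> I \<Longrightarrow> y = \<zero>\<^bsub>T d\<^esub>"
    unfolding I_eq_J by auto
  have eq': "c \<odot>\<^bsub>T d\<^esub> y = c' \<odot>\<^bsub>T d\<^esub> alt m"
    using eq module_diff_eq_zero_iff[OF T_module] c yc alt_m_closed by simp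
  have "c' \<odot>\<^bsub>C\<^esub> c1 = proj d (c \<odot>\<^bsub>T d\<^esub> y)"
    unfolding eq' using linear_map_smult[OF proj_linear c(2) alt_m_closed] proj_alt by simp
  also have "\<dots> = \<zero>\<^bsub>C\<^esub>" using linear_map_smult[OF proj_linear c(1) yc] py c(1) by simp
  finally show ?thesis using imp smult_c1_zero_iff[OF c(2)] by blast
qed

text \<open>The torsion of \<open>W\<close> is killed by powers of the \<open>r\<^sub>j\<close>, but no nonzero element of \<open>W\<close> is killed by all
  \<open>r\<^sub>j\<close>.\<close>

lemma W_torsion_free: "torsion_free R ((T d)\<lparr>carrier := W\<rparr>)"
proof -
  let ?W = "(T d)\<lparr>carrier := W\<rparr>"
  have mW: "module R ?W" by (rule submodule.submodule_is_module[OF W_submodule T_module])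
  note ops = submodule_ops[OF T_module W_submodule]
  have "x = \<zero>\<^bsub>?W\<^esub>" if x: "x \<in> torsion_submodule R ?W" for x
  proof -
    have xW: "x \<in> W" using x by (simp add: torsion_submodule_def Let_def)
    have kill: "\<phi> x = \<zero>" if \<phi>: "linear_map R (T d) (self_module R) \<phi>" for \<phi>
    proof (rule functional_vanishes_on_torsion[OF mW x])
      show "linear_map R ?W (self_module R) \<phi>"
        using \<phi> ops(1) unfolding linear_map_def by simp
    qed
    have "x = \<zero>\<^bsub>T d\<^esub>"
    proof (rule power_torsion_zero[where e = d, OF T_module W_submodule _ xW])
      show "y = \<zero>\<^bsub>T d\<^esub>" if "y \<in> W" "\<And>i. i \<in> {1..d} \<Longrightarrow> r i \<odot>\<^bsub>T d\<^esub> y = \<zero>\<^bsub>T d\<^esub>" for y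
        using that by (rule W_socle)
      show "(r i [^] d) \<odot>\<^bsub>T d\<^esub> x = \<zero>\<^bsub>T d\<^esub>" if "i \<in> {1..d}" for i
        by (rule functional_kernel_power_torsion[OF that ops(1)[OF xW]]) (rule kill)
    qed
    then show ?thesis by simp
  qed
  then show ?thesis
    unfolding torsion_free_def using zero_in_torsion_submodule[OF mW] by blast
qed

text \<open>Subtracting the multiple of \<open>\<tau>\<close> with the same projection moves an element killed by \<open>I\<close> into \<open>W\<close>.\<close>

lemma socle_eq_multiples:
  "{t \<in> carrier (T d). \<forall>a\<in>I. a \<odot>\<^bsub>T d\<^esub> t = \<zero>\<^bsub>T d\<^esub>} = {a \<odot>\<^bsub>T d\<^esub> alt m |a. a \<in> carrier R}"
proof (intro equalityI subsetI)
  interpret N: module R "T d" by (rule T_module)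
  fix t assume "t \<in> {t \<in> carrier (T d). \<forall>a\<in>I. a \<odot>\<^bsub>T d\<^esub> t = \<zero>\<^bsub>T d\<^esub>}"
  then have t: "t \<in> carrier (T d)" "\<And>a. a \<in> I \<Longrightarrow> a \<odot>\<^bsub>T d\<^esub> t = \<zero>\<^bsub>T d\<^esub>" by blast+
  obtain a where a: "a \<in> carrier R" "proj d t = a \<odot>\<^bsub>C\<^esub> c1"
    by (rule C_generated[OF linear_map_closed[OF proj_linear t(1)]])
  have ac: "a \<odot>\<^bsub>T d\<^esub> alt m \<in> carrier (T d)" using a alt_m_closed by simp
  let ?y = "t \<ominus>\<^bsub>T d\<^esub> a \<odot>\<^bsub>T d\<^esub> alt m"
  have pa: "proj d (a \<odot>\<^bsub>T d\<^esub> alt m) = proj d t"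
    using linear_map_smult[OF proj_linear a(1) alt_m_closed] proj_alt a(2) by simp
  have pt: "proj d t \<in> carrier C" by (rule linear_map_closed[OF proj_linear t(1)])
  have "proj d ?y = \<zero>\<^bsub>C\<^esub>"
    unfolding linear_map_diff[OF proj_linear T_module C_module t(1) ac] pa
    using module_diff_eq_zero_iff[OF C_module pt pt] by simp
  then have "?y \<in> W" using t(1) ac by (simp add: W_def)
  moreover have "r i \<odot>\<^bsub>T d\<^esub> ?y = \<zero>\<^bsub>T d\<^esub>" if i: "i \<in> {1..d}" for i
  proof -
    have ri: "r i \<in> carrier R" by (rule r_closed[OF i])
    have "r i \<odot>\<^bsub>T d\<^esub> (a \<odot>\<^bsub>T d\<^esub> alt m) = a \<odot>\<^bsub>T d\<^esub> (r i \<odot>\<^bsub>T d\<^esub> alt m)"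
      using ri a(1) alt_m_closed by (metis N.smult_assoc1 m_comm)
    then have "r i \<odot>\<^bsub>T d\<^esub> (a \<odot>\<^bsub>T d\<^esub> alt m) = \<zero>\<^bsub>T d\<^esub>" using r_alt_m[OF i] a(1) by simp
    then show ?thesis
      using t(2)[OF r_in_I[OF i]] ri t(1) ac N.minus_equality[of "\<zero>\<^bsub>T d\<^esub>" "\<zero>\<^bsub>T d\<^esub>"]
      by (simp add: a_minus_def N.smult_r_distr N.smult_r_minus)
  qed
  ultimately have "?y = \<zero>\<^bsub>T d\<^esub>" by (rule W_socle)
  then have "t = a \<odot>\<^bsub>T d\<^esub> alt m" using module_diff_eq_zero_iff[OF T_module t(1) ac] by simp
  then show "t \<in> {a \<odot>\<^bsub>T d\<^esub> alt m |a. a \<in> carrier R}" using a(1) by blast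
next
  interpret N: module R "T d" by (rule T_module)
  fix t assume "t \<in> {a \<odot>\<^bsub>T d\<^esub> alt m |a. a \<in> carrier R}"
  then obtain a where a: "t = a \<odot>\<^bsub>T d\<^esub> alt m" "a \<in> carrier R" by blast
  have "b \<odot>\<^bsub>T d\<^esub> t = \<zero>\<^bsub>T d\<^esub>" if b: "b \<in> I" for b
  proof -
    have "b \<odot>\<^bsub>T d\<^esub> t = a \<odot>\<^bsub>T d\<^esub> (b \<odot>\<^bsub>T d\<^esub> alt m)"
      unfolding a(1) using a(2) I_carrier[OF b] alt_m_closed by (metis N.smult_assoc1 m_comm)
    then show ?thesis using I_kills_alt[OF b] a(2) by simp
  qed
  then show "t \<in> {t \<in> carrier (T d). \<forall>a\<in>I. a \<odot>\<^bsub>T d\<^esub> t = \<zero>\<^bsub>T d\<^esub>}"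
    using a alt_m_closed by simp
qed

lemma r1_nonzerodivisor: "r 1 \<in> nonzerodivisors R"
proof -
  interpret N: module R "T 0" by (rule T_module)
  have 1: "1 \<in> {1..d}" using d_pos by simp
  have r1: "r 1 \<in> carrier R" by (rule r_closed[OF 1])
  obtain \<phi> p where \<phi>: "linear_map R (T 0) (self_module R) \<phi>" and p: "p \<in> carrier (T 0)"
    and \<phi>p: "\<phi> p = \<one>" by (rule T_0_iso) blast
  have "a = \<zero>" if a: "a \<in> carrier R" "r 1 \<otimes> a = \<zero>" for a
  proof -
    have "r 1 \<odot>\<^bsub>T 0\<^esub> (a \<odot>\<^bsub>T 0\<^esub> p) = \<zero>\<^bsub>T 0\<^esub>" using N.smult_assoc1[OF r1 a(1) p] a(2) p by simp
    then have "(r 1 [^] (1::nat)) \<odot>\<^bsub>T 0\<^esub> (a \<odot>\<^bsub>T 0\<^esub> p) = \<zero>\<^bsub>T 0\<^esub>" using r1 by simp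
    moreover have "regular_at (T 0) 0" by (rule regular_T[OF reg]) (use d_pos in simp)
    moreover have "0 < d" using d_pos by simp
    ultimately have "a \<odot>\<^bsub>T 0\<^esub> p = \<zero>\<^bsub>T 0\<^esub>"
      using regular_at_0_power[of 0 "a \<odot>\<^bsub>T 0\<^esub> p" 1] a(1) p by simp
    then have "a \<otimes> \<phi> p = \<zero>"
      using linear_map_smult[OF \<phi> a(1) p] linear_map_zero[OF \<phi> T_module self_is_module[OF is_cring]]
      by simp
    then show "a = \<zero>" using \<phi>p a(1) by simp
  qed
  then show ?thesis using r1 by (simp add: nonzerodivisors_def)
qed

text \<open>Tensoring \<open>\<tau>\<close> with copies of \<open>m\<^sub>1\<close> preserves both \<open>r\<^sub>1 \<tau> = 0\<close> and the coefficient \<open>1\<close>.\<close>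

lemma torsion_above:
  assumes "n \<ge> d"
  shows "\<exists>x\<in>carrier (T n). r 1 \<odot>\<^bsub>T n\<^esub> x = \<zero>\<^bsub>T n\<^esub> \<and> proj n x = c1"
  using assms
proof (induction n rule: dec_induct)
  case base
  have "1 \<in> {1..d}" using d_pos by simp
  then show ?case using alt_m_closed r_alt_m proj_alt by blast
next
  case (step n)
  obtain x where x: "x \<in> carrier (T n)" "r 1 \<odot>\<^bsub>T n\<^esub> x = \<zero>\<^bsub>T n\<^esub>" "proj n x = c1" using step.IH by blast
  have r1: "r 1 \<in> carrier R" by (rule r_closed) (use d_pos in simp)
  have w: "word (Suc n) \<in> {1..d}" by (rule word_range) simp
  let ?y = "adjoin n (word (Suc n)) x"
  have "?y \<in> carrier (T (Suc n))" by (rule linear_map_closed[OF adjoin_linear[OF w] x(1)])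
  moreover have "r 1 \<odot>\<^bsub>T (Suc n)\<^esub> ?y = \<zero>\<^bsub>T (Suc n)\<^esub>"
    using linear_map_smult[OF adjoin_linear[OF w] r1 x(1)] x(2)
      linear_map_zero[OF adjoin_linear[OF w] T_module T_module] by simp
  moreover have "proj (Suc n) ?y = c1" using proj_adjoin[OF w x(1)] x(3) by (simp del: proj.simps)
  ultimately show ?case by blast
qed

lemma not_torsion_free_above:
  assumes "n \<ge> d"
  shows "\<not> torsion_free R (T n)"
proof
  assume tf: "torsion_free R (T n)"
  obtain x where x: "x \<in> carrier (T n)" "r 1 \<odot>\<^bsub>T n\<^esub> x = \<zero>\<^bsub>T n\<^esub>" "proj n x = c1"
    using torsion_above[OF assms] by blast
  interpret C: module R C by (rule C_module)
  have "x \<in> torsion_submodule R (T n)"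
    by (rule torsion_if_killed_by_nonzerodivisor[OF T_module x(1) r1_nonzerodivisor x(2)])
  then have "x = \<zero>\<^bsub>T n\<^esub>" using tf unfolding torsion_free_def by blast
  then have "c1 = \<zero>\<^bsub>C\<^esub>" using x(3) linear_map_zero[OF proj_linear T_module C_module] by simp
  then have "\<one> \<odot>\<^bsub>C\<^esub> c1 = \<zero>\<^bsub>C\<^esub>" by simp
  then show False using smult_c1_zero_iff[OF one_closed] one_notin_I by blast
qed

lemma splitting:
  assumes h: "h \<in> mod_hom R C (T d)" and h1: "h c1 = alt m"
  shows "\<exists>\<phi>\<in>mod_iso R (direct_sum_module C ((T d)\<lparr>carrier := W\<rparr>)) (T d).
    \<forall>x\<in>carrier C. \<forall>w\<in>W. \<phi> (x, w) = h x \<oplus>\<^bsub>T d\<^esub> w"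
proof -
  have lin: "linear_map R C (T d) h" using h by (auto simp: mod_hom_def linear_map_def)
  have "proj d (h x) = x" if x: "x \<in> carrier C" for x
  proof -
    obtain a where a: "a \<in> carrier R" "x = a \<odot>\<^bsub>C\<^esub> c1" by (rule C_generated[OF x])
    show ?thesis
      unfolding a(2) linear_map_smult[OF lin a(1) c1_closed] h1
        linear_map_smult[OF proj_linear a(1) alt_m_closed] proj_alt ..
  qed
  from retraction_splitting[OF C_module T_module lin proj_linear this]
  show ?thesis unfolding W_def .
qed

lemma alt_multiples_nonzero: "{a \<odot>\<^bsub>T d\<^esub> alt m |a. a \<in> carrier R} \<noteq> {\<zero>\<^bsub>T d\<^esub>}"
proof
  interpret N: module R "T d" by (rule T_module)
  assume "{a \<odot>\<^bsub>T d\<^esub> alt m |a. a \<in> carrier R} = {\<zero>\<^bsub>T d\<^esub>}"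
  then have "\<one> \<odot>\<^bsub>T d\<^esub> alt m = \<zero>\<^bsub>T d\<^esub>" using one_closed by blast
  then have "\<one> \<in> annihilator R (T d) (alt m)" by (simp add: annihilator_def)
  then show False using annihilator_alt one_notin_I by blast
qed

end

theorem theorem2p8:
  fixes R :: "('a, 'x) ring_scheme" and d :: nat and r :: "nat \<Rightarrow> 'a"
  assumes "cring R" and "noetherian_ring R"
    and "d \<ge> 1"
    and "regular_sequence R d r"
    and "Idl\<^bsub>R\<^esub> (r ` {1..d}) \<noteq> carrier R"
  defines "I \<equiv> Idl\<^bsub>R\<^esub> (r ` {1..d})"
  defines "C \<equiv> cyclic_module R I"
  defines "M \<equiv> seq_coker R d r"
  defines "T \<equiv> tensor_power R M d"
  defines "\<tau> \<equiv> tau R M d (seq_coker_gen R d r)"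
  shows "(\<forall>n\<ge>1. torsion_free R (tensor_power R M n) \<longleftrightarrow> n \<le> d - 1)
    \<and> annihilator R T \<tau> = I
    \<and> (\<exists>!h. h \<in> mod_hom R C T \<and> h (I +>\<^bsub>R\<^esub> \<one>\<^bsub>R\<^esub>) = \<tau>)
    \<and> (\<forall>h\<in>mod_hom R C T. h (I +>\<^bsub>R\<^esub> \<one>\<^bsub>R\<^esub>) = \<tau> \<longrightarrow>
         (\<exists>W. submodule W R T \<and> torsion_free R (T\<lparr>carrier := W\<rparr>) \<and>
            (\<exists>\<phi>\<in>mod_iso R (direct_sum_module C (T\<lparr>carrier := W\<rparr>)) T.
               \<forall>x\<in>carrier C. \<forall>w\<in>W. \<phi> (x, w) = h x \<oplus>\<^bsub>T\<^esub> w)))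
    \<and> bij_betw (\<lambda>f. f (I +>\<^bsub>R\<^esub> \<one>\<^bsub>R\<^esub>)) (mod_hom R C T)
         {t \<in> carrier T. \<forall>a\<in>I. a \<odot>\<^bsub>T\<^esub> t = \<zero>\<^bsub>T\<^esub>}
    \<and> (\<lambda>f. f (I +>\<^bsub>R\<^esub> \<one>\<^bsub>R\<^esub>)) ` mod_hom R C T = {a \<odot>\<^bsub>T\<^esub> \<tau> |a. a \<in> carrier R}
    \<and> {a \<odot>\<^bsub>T\<^esub> \<tau> |a. a \<in> carrier R} \<noteq> {\<zero>\<^bsub>T\<^esub>}"
proof -
  have r: "\<And>i. i \<in> {1..d} \<Longrightarrow> r i \<in> carrier R" using assms(4) by (simp add: regular_sequence_def)
  interpret S: proper_regular_sequence R d r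
    by (intro proper_regular_sequence.intro ring_sequence.intro ring_sequence_axioms.intro
        proper_regular_sequence_axioms.intro assms(1,3,4,5) r)
  have \<tau>: "\<tau> = S.alt (seq_coker_gen R d r)"
    unfolding \<tau>_def M_def by (rule S.tau_eq_alt)
  let ?ev = "\<lambda>f. f (I +>\<^bsub>R\<^esub> \<one>\<^bsub>R\<^esub>)"
  let ?soc = "{t \<in> carrier T. \<forall>a\<in>I. a \<odot>\<^bsub>T\<^esub> t = \<zero>\<^bsub>T\<^esub>}"
  have bij: "bij_betw ?ev (mod_hom R C T) ?soc"
    unfolding I_def C_def T_def M_def by (rule hom_from_cyclic[OF S.T_module S.I_submodule])
  have soc: "?soc = {a \<odot>\<^bsub>T\<^esub> \<tau> |a. a \<in> carrier R}"
    unfolding \<tau> I_def T_def M_def by (rule S.socle_eq_multiples)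
  have "\<tau> \<in> ?soc"
    unfolding \<tau> I_def T_def M_def using S.alt_m_closed S.I_kills_alt by blast
  then have "\<tau> \<in> ?ev ` mod_hom R C T" unfolding bij_betw_imp_surj_on[OF bij] .
  then obtain h where h: "\<tau> = ?ev h" "h \<in> mod_hom R C T" by (rule imageE)
  have ex1: "\<exists>!h. h \<in> mod_hom R C T \<and> ?ev h = \<tau>"
  proof (rule ex1I)
    show "h \<in> mod_hom R C T \<and> ?ev h = \<tau>" using h by simp
    show "g = h" if "g \<in> mod_hom R C T \<and> ?ev g = \<tau>" for g
      using inj_onD[OF bij_betw_imp_inj_on[OF bij], of g h] that h by simp
  qed
  have tf: "torsion_free R (tensor_power R M n) \<longleftrightarrow> n \<le> d - 1" for n
    using S.torsion_free_below[OF assms(4), of n] S.not_torsion_free_above[of n] assms(3)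
    unfolding M_def by (cases "n < d") auto
  have ann: "annihilator R T \<tau> = I"
    unfolding \<tau> I_def T_def M_def by (rule S.annihilator_alt)
  have split: "\<exists>W. submodule W R T \<and> torsion_free R (T\<lparr>carrier := W\<rparr>) \<and>
      (\<exists>\<phi>\<in>mod_iso R (direct_sum_module C (T\<lparr>carrier := W\<rparr>)) T.
         \<forall>x\<in>carrier C. \<forall>w\<in>W. \<phi> (x, w) = h x \<oplus>\<^bsub>T\<^esub> w)"
    if h: "h \<in> mod_hom R C T" "?ev h = \<tau>" for h
  proof (intro exI conjI)
    show "submodule S.W R T" unfolding T_def M_def by (rule S.W_submodule)
    show "torsion_free R (T\<lparr>carrier := S.W\<rparr>)" unfolding T_def M_def by (rule S.W_torsion_free)
    show "\<exists>\<phi>\<in>mod_iso R (direct_sum_module C (T\<lparr>carrier := S.W\<rparr>)) T.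
        \<forall>x\<in>carrier C. \<forall>w\<in>S.W. \<phi> (x, w) = h x \<oplus>\<^bsub>T\<^esub> w"
      unfolding C_def I_def T_def M_def
      by (rule S.splitting[OF h[unfolded \<tau> C_def I_def T_def M_def]])
  qed
  have nz: "{a \<odot>\<^bsub>T\<^esub> \<tau> |a. a \<in> carrier R} \<noteq> {\<zero>\<^bsub>T\<^esub>}"
    unfolding \<tau> T_def M_def by (rule S.alt_multiples_nonzero)
  have img: "?ev ` mod_hom R C T = {a \<odot>\<^bsub>T\<^esub> \<tau> |a. a \<in> carrier R}"
    using bij soc by (simp add: bij_betw_def)
  show ?thesis
    by (intro conjI allI ballI impI tf ann ex1 split bij img nz)
qed

end
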